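(* Let $1<q<p<\infty$, $\omega\in\widehat{\mathcal D}$, $\nu,\eta\in\mathcal D$ and $\mu\in M^+([0,1))$. Then $C_{\mu,\omega}:A^p_\nu\to A^q_\eta$ is bounded if and only if $$N(\mu):=\left(\sum_{n=0}^\infty\left(\frac{\mu_n(n+1)}{\omega_n}\,\frac{\eta_n^{\frac1q}}{\nu_n^{\frac1q}}\right)^{\frac{qp}{p-q}}\frac{\nu_n}{(n+1)^2}\right)^{\frac{p-q}{qp}}<\infty.$$ Moreover, $N(\mu)\asymp\|C_{\mu,\omega}\|_{A^p_\nu\to A^q_\eta}$.
   Context: $\mathcal H(\mathbb D)$ is the space of analytic functions in the unit disc $\mathbb D$. A weight is an integrable function $\omega:\mathbb D\to[0,\infty)$; it is radial if $\omega(z)=\omega(|z|)$. For a radial weight, $\widehat\omega(r)=\int_r^1\omega(s)\,ds$ and $\omega_x=\int_0^1 r^x\omega(r)\,dr$. $\omega\in\widehat{\mathcal D}$ means: $\omega$ is a radial weight, not a.e. zero, and there is $C>1$ with $\widehat\omega(r)\le C\,\widehat\omega\left(\frac{1+r}2\right)$ for all $0\le r<1$. $\omega\in\check{\mathcal D}$ means: $\omega$ is a radial weight and there are $C'>1$, $K>1$ with $\widehat\omega(r)\ge C'\widehat\omega\left(1-\frac{1-r}K\right)$ for all $0\le r<1$. $\mathcal D=\widehat{\mathcal D}\cap\check{\mathcal D}$. $M^+([0,1))$ is the set of finite positive Borel measures on $[0,1)$; $\mu_x=\int_{[0,1)}r^x\,d\mu(r)$ (with $0^0=1$). Kernel: $B^\omega_t(z)=\sum_{n=0}^\infty\frac{(tz)^n}{2\omega_{2n+1}}$,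 $0\le t<1$, $z\in\mathbb D$. Operator: $C_{\mu,\omega}(f)(z)=\int_0^1 f(tz)B^\omega_t(z)\,d\mu(t)$ for $f\in\mathcal H(\mathbb D)$. $A^p_\nu$ is the space of $f\in\mathcal H(\mathbb D)$ with $\|f\|_{A^p_\nu}^p=\int_{\mathbb D}|f|^p\nu\,dA<\infty$, $dA$ being normalized area measure. Bounded $X\to Y$ means $\|C_{\mu,\omega}f\|_Y\le C\|f\|_X$ for all $f\in X$; the operator norm is the least such $C$ (infinite if unbounded). $A\asymp B$ means $c^{-1}B\le A\le cB$ with $c>0$ independent of $\mu$ (it may depend on $p,q,\omega,\nu,\eta$). *)

theory Defs
  imports "HOL-Complex_Analysis.Complex_Analysis"
begin

section \<open>Radial weights\<close>

definition weight :: "(complex \<Rightarrow> real) \<Rightarrow> bool" where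
  "weight \<omega> \<longleftrightarrow> (\<forall>z\<in>ball 0 1. 0 \<le> \<omega> z) \<and> set_integrable lebesgue (ball 0 1) \<omega>"

definition radial_weight :: "(complex \<Rightarrow> real) \<Rightarrow> bool" where
  "radial_weight \<omega> \<longleftrightarrow>
     weight \<omega> \<and> (\<forall>z\<in>ball 0 1. \<omega> z = \<omega> (complex_of_real (cmod z)))"

text \<open>
  The tail integral is extended-valued: integrability over the disc controls only
  the integral of \<open>s * \<omega> s\<close>, so the tail may be infinite at \<open>r = 0\<close>.
\<close>

definition weight_tail :: "(complex \<Rightarrow> real) \<Rightarrow> real \<Rightarrow> ennreal" where
  "weight_tail \<omega> r = (\<integral>\<^sup>+s\<in>{r..<1}. ennreal (\<omega> (complex_of_real s)) \<partial>lebesgue)"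

text \<open>
  For weights of \<open>D_hat\<close> the integrand below is integrable for every \<open>n\<close>, because the
  doubling condition at \<open>r = 0\<close> forces the tail there to be finite.
\<close>

definition weight_moment :: "(complex \<Rightarrow> real) \<Rightarrow> nat \<Rightarrow> real" where
  "weight_moment \<omega> n = (LINT r:{0..<1}|lebesgue. r ^ n * \<omega> (complex_of_real r))"

definition D_hat :: "(complex \<Rightarrow> real) set" where
  "D_hat = {\<omega>. radial_weight \<omega> \<and> \<not> (AE z in lebesgue. z \<in> ball 0 1 \<longrightarrow> \<omega> z = 0) \<and>
     (\<exists>C::real. C > 1 \<and>
        (\<forall>r. 0 \<le> r \<and> r < 1 \<longrightarrow> weight_tail \<omega> r \<le> ennreal C * weight_tail \<omega> ((1 + r) / 2)))}"

definition D_check :: "(complex \<Rightarrow> real) set" where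
  "D_check = {\<omega>. radial_weight \<omega> \<and>
     (\<exists>C K::real. C > 1 \<and> K > 1 \<and>
        (\<forall>r. 0 \<le> r \<and> r < 1 \<longrightarrow>
           weight_tail \<omega> r \<ge> ennreal C * weight_tail \<omega> (1 - (1 - r) / K)))}"

definition D_both :: "(complex \<Rightarrow> real) set" where
  "D_both = D_hat \<inter> D_check"

section \<open>Measures on the half-open unit interval\<close>

definition M_plus :: "real measure set" where
  "M_plus = {\<mu>. sets \<mu> = sets (restrict_space borel {0..<1}) \<and> finite_measure \<mu>}"

definition measure_moment :: "real measure \<Rightarrow> nat \<Rightarrow> real" where
  "measure_moment \<mu> n = (LINT r|\<mu>. r ^ n)"

section \<open>The operator\<close>

definition B_kernel :: "(complex \<Rightarrow> real) \<Rightarrow> real \<Rightarrow> complex \<Rightarrow> complex" where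
  "B_kernel \<omega> t z =
     (\<Sum>n. (complex_of_real t * z) ^ n / complex_of_real (2 * weight_moment \<omega> (2 * n + 1)))"

definition C_op ::
    "real measure \<Rightarrow> (complex \<Rightarrow> real) \<Rightarrow> (complex \<Rightarrow> complex) \<Rightarrow> complex \<Rightarrow> complex" where
  "C_op \<mu> \<omega> f z = (LINT t|\<mu>. f (complex_of_real t * z) * B_kernel \<omega> t z)"

section \<open>Weighted Bergman spaces\<close>

definition bergman_space :: "real \<Rightarrow> (complex \<Rightarrow> real) \<Rightarrow> (complex \<Rightarrow> complex) set" where
  "bergman_space p \<nu> =
     {f. f holomorphic_on ball 0 1 \<and>
         set_integrable lebesgue (ball 0 1) (\<lambda>z. cmod (f z) powr p * \<nu> z)}"

text \<open>The factor \<open>1 / pi\<close> normalizes the area measure of the disc.\<close>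

definition bergman_norm :: "real \<Rightarrow> (complex \<Rightarrow> real) \<Rightarrow> (complex \<Rightarrow> complex) \<Rightarrow> real" where
  "bergman_norm p \<nu> f =
     ((1 / pi) * (LINT z:ball 0 1|lebesgue. cmod (f z) powr p * \<nu> z)) powr (1 / p)"

definition bounding_constants ::
    "real \<Rightarrow> (complex \<Rightarrow> real) \<Rightarrow> real \<Rightarrow> (complex \<Rightarrow> real) \<Rightarrow>
     ((complex \<Rightarrow> complex) \<Rightarrow> complex \<Rightarrow> complex) \<Rightarrow> real set" where
  "bounding_constants p \<nu> q \<eta> T =
     {C. 0 \<le> C \<and> (\<forall>f\<in>bergman_space p \<nu>.
            T f \<in> bergman_space q \<eta> \<and> bergman_norm q \<eta> (T f) \<le> C * bergman_norm p \<nu> f)}"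

definition bergman_bounded ::
    "real \<Rightarrow> (complex \<Rightarrow> real) \<Rightarrow> real \<Rightarrow> (complex \<Rightarrow> real) \<Rightarrow>
     ((complex \<Rightarrow> complex) \<Rightarrow> complex \<Rightarrow> complex) \<Rightarrow> bool" where
  "bergman_bounded p \<nu> q \<eta> T \<longleftrightarrow> bounding_constants p \<nu> q \<eta> T \<noteq> {}"

text \<open>For an unbounded operator this is the infimum of the empty set, which is infinite.\<close>

definition bergman_opnorm ::
    "real \<Rightarrow> (complex \<Rightarrow> real) \<Rightarrow> real \<Rightarrow> (complex \<Rightarrow> real) \<Rightarrow>
     ((complex \<Rightarrow> complex) \<Rightarrow> complex \<Rightarrow> complex) \<Rightarrow> ennreal" where
  "bergman_opnorm p \<nu> q \<eta> T = Inf (ennreal ` bounding_constants p \<nu> q \<eta> T)"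

section \<open>The moment quantity\<close>

definition N_term ::
    "real \<Rightarrow> real \<Rightarrow> (complex \<Rightarrow> real) \<Rightarrow> (complex \<Rightarrow> real) \<Rightarrow> (complex \<Rightarrow> real) \<Rightarrow>
     real measure \<Rightarrow> nat \<Rightarrow> real" where
  "N_term p q \<omega> \<nu> \<eta> \<mu> n =
     (measure_moment \<mu> n * (real n + 1) / weight_moment \<omega> n *
        (weight_moment \<eta> n powr (1 / q) / weight_moment \<nu> n powr (1 / q)))
       powr (q * p / (p - q))
     * (weight_moment \<nu> n / (real n + 1)\<^sup>2)"

text \<open>The terms are nonnegative, so the series either is summable or has sum infinity.\<close>

definition N_quantity ::
    "real \<Rightarrow> real \<Rightarrow> (complex \<Rightarrow> real) \<Rightarrow> (complex \<Rightarrow> real) \<Rightarrow> (complex \<Rightarrow> real) \<Rightarrow>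
     real measure \<Rightarrow> ennreal" where
  "N_quantity p q \<omega> \<nu> \<eta> \<mu> =
     (if summable (N_term p q \<omega> \<nu> \<eta> \<mu>)
      then ennreal ((\<Sum>n. N_term p q \<omega> \<nu> \<eta> \<mu> n) powr ((p - q) / (q * p)))
      else \<infinity>)"

end

theory Submission
  imports Defs
begin

text \<open>
  Both directions are reduced to sums over the dyadic radii \<open>1 - 2\<^sup>-\<^sup>k\<close>. Expanding in power series,
  \<open>C_op \<mu> \<omega> f z\<close> is the \<open>\<mu>\<close>-average of the dilations \<open>(f \<cdot> K)(t z)\<close>, where \<open>K\<close> has the increasing
  coefficients \<open>1 / (2 \<omega>\<^sub>2\<^sub>n\<^sub>+\<^sub>1)\<close>; summation by parts gives
  \<open>\<bar>K z\<bar> \<le> (1 - \<bar>z\<bar>) K \<bar>z\<bar> / \<bar>1 - z\<bar>\<close>, hence the order of the \<open>L\<^sup>s\<close>-means of \<open>K\<close> for \<open>1/s = 1/q - 1/p\<close>.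

  Sufficiency: Minkowski's inequality, Hoelder's inequality on circles and the monotonicity of
  circle means bound the \<open>L\<^sup>q\<close>-mean of \<open>C_op \<mu> \<omega> f\<close> at level \<open>k\<close> by a sum over the levels \<open>j \<le> k\<close>, which is
  summed by a discrete Hardy inequality, because the tails of weights in \<open>D_check\<close> decay geometrically.

  Necessity: the test functions are sums of \<open>y\<^sub>j (2\<^sup>-\<^sup>j / (1 - r\<^sub>j z))\<^sup>M\<close> with \<open>r\<^sub>j = 1 - 2\<^sup>-\<^sup>j\<close> and \<open>y\<^sub>j \<ge> 0\<close>. They
  and \<open>K\<close> are positive on the radius, so \<open>C_op \<mu> \<omega> f\<close> is bounded below at \<open>r\<^sub>k\<close> by the \<open>k\<close>-th term alone, while
  the values at the points \<open>r\<^sub>k\<close> are controlled by the Bergman norm. Optimizing \<open>y\<close> gives the moment sum.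
\<close>

section \<open>Inequalities for sums and integrals\<close>

text \<open>The weights are doubling but \<mu> is arbitrary: its moments need not be comparable to
  its tails, and the two directions see \<mu> differently. Sufficiency uses only that the tail of
  \<mu> at level k is at most e^2 times each moment in block k. Necessity produces moments of
  exponent \<open>(M + 2) * (2 ^ k - 1)\<close>, with M fixed before \<mu>; these may be much
  smaller than the moments in block k. The loss is repaired by comparing block i with level i - m,
  where 2^m >= M + 2, at the cost of m doublings of the weights. The exponent s = qp/(p - q) is the
  one for which p/q and s/q are conjugate: Hoelder's inequality splits the level sums into the norm
  of f and a sum of s-th powers, and the same exponent returns when the test coefficients are
  optimized. The level sums in the necessity part are finite, so T <= K B^q T^(q/p) can be solved
  for T before the convergence of the full series is known.\<close>

lemma holder_nn_integral:
  fixes f g :: "'a \<Rightarrow> real"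
  assumes p: "1 < p" and q: "1 < q" and pq: "1/p + 1/q = 1"
    and [measurable]: "f \<in> borel_measurable M" "g \<in> borel_measurable M"
    and nn: "\<And>x. x \<in> space M \<Longrightarrow> 0 \<le> f x" "\<And>x. x \<in> space M \<Longrightarrow> 0 \<le> g x"
    and A: "(\<integral>\<^sup>+x. ennreal (f x powr p) \<partial>M) \<le> ennreal A" "0 \<le> A"
    and B: "(\<integral>\<^sup>+x. ennreal (g x powr q) \<partial>M) \<le> ennreal B" "0 \<le> B"
  shows "(\<integral>\<^sup>+x. ennreal (f x * g x) \<partial>M) \<le> ennreal (A powr (1/p) * B powr (1/q))"
\<comment> \<open>The normalization by A^(1/p) and B^(1/q) below needs both bounds positive; a zero
  bound forces the product to vanish almost everywhere.\<close>
proof (cases "A = 0 \<or> B = 0")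
  case True
  have "AE x in M. f x * g x = 0"
  proof (cases "A = 0")
    case True
    then have "AE x in M. ennreal (f x powr p) = 0"
      using A by (subst nn_integral_0_iff_AE[symmetric]) auto
    then show ?thesis by eventually_elim auto
  next
    case False
    with True have "B = 0" by simp
    then have "AE x in M. ennreal (g x powr q) = 0"
      using B by (subst nn_integral_0_iff_AE[symmetric]) auto
    then show ?thesis by eventually_elim auto
  qed
  then have "(\<integral>\<^sup>+x. ennreal (f x * g x) \<partial>M) = (\<integral>\<^sup>+x. 0 \<partial>M)"
    by (intro nn_integral_cong_AE) (auto elim!: eventually_mono simp del: mult_eq_0_iff)
  then show ?thesis by simp
next
  case False
  with A B have AB: "A > 0" "B > 0" by auto
  define a b where "a = A powr (1/p)" and "b = B powr (1/q)"
  have ab: "a > 0" "b > 0" "a powr p = A" "b powr q = B"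
    using AB p q by (auto simp: a_def b_def powr_powr)
  have "(\<integral>\<^sup>+x. ennreal (f x * g x) \<partial>M)
      \<le> (\<integral>\<^sup>+x. ennreal (a*b/(p*A)) * ennreal (f x powr p) + ennreal (a*b/(q*B)) * ennreal (g x powr q) \<partial>M)"
  proof (intro nn_integral_mono)
    fix x assume x: "x \<in> space M"
    have "(f x / a) * (g x / b) \<le> (f x / a) powr p / p + (g x / b) powr q / q"
      using nn[OF x] ab p q pq by (intro Youngs_inequality) auto
    also have "\<dots> = f x powr p / (p*A) + g x powr q / (q*B)"
      using nn[OF x] ab by (simp add: powr_divide mult.commute)
    finally have "(a*b) * ((f x / a) * (g x / b)) \<le> (a*b) * (f x powr p / (p*A) + g x powr q / (q*B))"
      using ab by (intro mult_left_mono) auto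
    then have "f x * g x \<le> a*b/(p*A) * (f x powr p) + a*b/(q*B) * (g x powr q)"
      using ab by (simp add: field_simps)
    then have "ennreal (f x * g x) \<le> ennreal (a*b/(p*A) * (f x powr p) + a*b/(q*B) * (g x powr q))"
      by (rule ennreal_leI)
    also have "\<dots> = ennreal (a*b/(p*A)) * ennreal (f x powr p) + ennreal (a*b/(q*B)) * ennreal (g x powr q)"
      using ab AB p q by (simp add: ennreal_plus ennreal_mult del: times_divide_eq_left)
    finally show "ennreal (f x * g x) \<le> ennreal (a*b/(p*A)) * ennreal (f x powr p) + ennreal (a*b/(q*B)) * ennreal (g x powr q)" .
  qed
  also have "\<dots> = ennreal (a*b/(p*A)) * (\<integral>\<^sup>+x. ennreal (f x powr p) \<partial>M) + ennreal (a*b/(q*B)) * (\<integral>\<^sup>+x. ennreal (g x powr q) \<partial>M)"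
    by (simp add: nn_integral_add nn_integral_cmult)
  also have "\<dots> \<le> ennreal (a*b/(p*A)) * ennreal A + ennreal (a*b/(q*B)) * ennreal B"
    using A B by (intro add_mono mult_left_mono) auto
  also have "\<dots> = ennreal (a*b/(p*A) * A + a*b/(q*B) * B)"
      using ab AB p q by (simp add: ennreal_plus ennreal_mult del: times_divide_eq_left nonzero_mult_divide_mult_cancel_right)
  also have "a*b/(p*A) * A + a*b/(q*B) * B = a*b*(1/p+1/q)"
    using AB by (simp add: field_simps)
  finally show ?thesis using pq by (simp add: a_def b_def)
qed

lemma holder_sum:
  fixes f g :: "'a \<Rightarrow> real"
  assumes "finite J" "1 < p" "1 < q" "1/p + 1/q = 1"
    and nn: "\<And>x. x \<in> J \<Longrightarrow> 0 \<le> f x" "\<And>x. x \<in> J \<Longrightarrow> 0 \<le> g x"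
  shows "(\<Sum>x\<in>J. f x * g x) \<le> (\<Sum>x\<in>J. f x powr p) powr (1/p) * (\<Sum>x\<in>J. g x powr q) powr (1/q)"
proof -
  have "(\<integral>\<^sup>+x. ennreal (f x * g x) \<partial>count_space J)
    \<le> ennreal ((\<Sum>x\<in>J. f x powr p) powr (1/p) * (\<Sum>x\<in>J. g x powr q) powr (1/q))"
    using assms by (intro holder_nn_integral) (auto simp: nn_integral_count_space_finite sum_nonneg sum_ennreal)
  then show ?thesis using assms
    by (simp add: nn_integral_count_space_finite sum_nonneg sum_ennreal ennreal_le_iff)
qed

text \<open>Hoelder's inequality with w split as w^(1/q') w^(1/q). This is Jensen's inequality for
  weights of arbitrary total mass; it serves Young's inequality below and the triangle inequality
  for circle means.\<close>

lemma jensen_powr_sum: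
  fixes w x :: "'a \<Rightarrow> real"
  assumes fin: "finite J" and q: "1 < q"
    and nn: "\<And>j. j \<in> J \<Longrightarrow> 0 \<le> w j" "\<And>j. j \<in> J \<Longrightarrow> 0 \<le> x j"
  shows "(\<Sum>j\<in>J. w j * x j) powr q \<le> (\<Sum>j\<in>J. w j) powr (q - 1) * (\<Sum>j\<in>J. w j * x j powr q)"
proof -
  define q' where "q' = q / (q - 1)"
  have q': "1 < q'" "1/q' + 1/q = 1" using q by (auto simp: q'_def field_simps)
  have "(\<Sum>j\<in>J. w j * x j) = (\<Sum>j\<in>J. w j powr (1/q') * (w j powr (1/q) * x j))"
    using nn q' by (intro sum.cong) (auto simp: powr_add[symmetric] mult.assoc[symmetric])
  also have "\<dots> \<le> (\<Sum>j\<in>J. (w j powr (1/q')) powr q') powr (1/q') * (\<Sum>j\<in>J. (w j powr (1/q) * x j) powr q) powr (1/q)"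
    using nn q q' fin by (intro holder_sum) auto
  also have "\<dots> = (\<Sum>j\<in>J. w j) powr (1/q') * (\<Sum>j\<in>J. w j * x j powr q) powr (1/q)"
    using nn q q' by (simp add: powr_powr powr_mult)
  finally have "(\<Sum>j\<in>J. w j * x j) powr q \<le> ((\<Sum>j\<in>J. w j) powr (1/q') * (\<Sum>j\<in>J. w j * x j powr q) powr (1/q)) powr q"
    using nn q by (intro powr_mono2) (auto intro!: sum_nonneg)
  also have "\<dots> = (\<Sum>j\<in>J. w j) powr (q - 1) * (\<Sum>j\<in>J. w j * x j powr q)"
    using nn q by (simp add: powr_powr powr_mult q'_def sum_nonneg)
  finally show ?thesis .
qed

text \<open>With truncated subtraction \<open>(k - j) + (j - k)\<close> is the distance |k - j|. The
  bound is that of two geometric series, one on each side of k, both counting j = k.\<close>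

lemma sum_geometric_distance_le:
  fixes a :: real
  assumes a: "0 < a" "a < 1"
  shows "(\<Sum>j<K. a ^ ((k - j) + (j - k))) \<le> 2 / (1 - a)"
proof -
  have geo: "(\<Sum>i\<in>I. a ^ i) \<le> 1 / (1 - a)" if "finite I" for I :: "nat set"
  proof -
    have "(\<Sum>i\<in>I. a ^ i) \<le> (\<Sum>i. a ^ i)"
      using a that by (intro sum_le_suminf summable_geometric) auto
    then show ?thesis using a by (simp add: suminf_geometric)
  qed
  have "(\<Sum>j<K. a ^ ((k - j) + (j - k))) \<le> (\<Sum>j<K. if j \<le> k then a ^ (k - j) else 0) + (\<Sum>j<K. if k \<le> j then a ^ (j - k) else 0)"
    unfolding sum.distrib[symmetric] using a by (intro sum_mono) auto
  also have "(\<Sum>j<K. if j \<le> k then a ^ (k - j) else 0) = (\<Sum>j\<in>{j. j < K \<and> j \<le> k}. a ^ (k - j))"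
    by (simp add: sum.If_cases Collect_conj_eq lessThan_def)
  also have "\<dots> = (\<Sum>i\<in>(\<lambda>j. k - j) ` {j. j < K \<and> j \<le> k}. a ^ i)"
    by (subst sum.reindex) (auto simp: inj_on_def)
  also have "\<dots> \<le> 1 / (1 - a)" by (intro geo) auto
  also have "(\<Sum>j<K. if k \<le> j then a ^ (j - k) else 0) = (\<Sum>j\<in>{j. j < K \<and> k \<le> j}. a ^ (j - k))"
    by (simp add: sum.If_cases Collect_conj_eq lessThan_def)
  also have "\<dots> = (\<Sum>i\<in>(\<lambda>j. j - k) ` {j. j < K \<and> k \<le> j}. a ^ i)"
    by (subst sum.reindex) (auto simp: inj_on_def)
  also have "\<dots> \<le> 1 / (1 - a)" by (intro geo) auto
  finally show ?thesis by simp
qed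

text \<open>Jensen's inequality for each k, then exchange of the sums: convolution with a^|k-j| is
  bounded on l^q. The kernel is symmetric, so its row and column sums have the same bound.\<close>

lemma young_convolution_geometric:
  fixes Z :: "nat \<Rightarrow> real"
  assumes a: "0 < a" "a < 1" and q: "1 < q" and Z: "\<And>j. 0 \<le> Z j"
  shows "(\<Sum>k<K. (\<Sum>j<K. a ^ ((k - j) + (j - k)) * Z j) powr q) \<le> (2 / (1 - a)) powr q * (\<Sum>j<K. Z j powr q)"
proof -
  let ?d = "\<lambda>k j. a ^ ((k - j) + (j - k))"
  let ?W = "2 / (1 - a)"
  have "(\<Sum>k<K. (\<Sum>j<K. ?d k j * Z j) powr q) \<le> (\<Sum>k<K. ?W powr (q - 1) * (\<Sum>j<K. ?d k j * Z j powr q))"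
  proof (intro sum_mono)
    fix k
    have "(\<Sum>j<K. ?d k j * Z j) powr q \<le> (\<Sum>j<K. ?d k j) powr (q - 1) * (\<Sum>j<K. ?d k j * Z j powr q)"
      using a q Z by (intro jensen_powr_sum) auto
    also have "\<dots> \<le> ?W powr (q - 1) * (\<Sum>j<K. ?d k j * Z j powr q)"
      using a q Z sum_geometric_distance_le[OF a]
      by (intro mult_right_mono powr_mono2 sum_nonneg) auto
    finally show "(\<Sum>j<K. ?d k j * Z j) powr q \<le> ?W powr (q - 1) * (\<Sum>j<K. ?d k j * Z j powr q)" .
  qed
  also have "\<dots> = ?W powr (q - 1) * (\<Sum>j<K. (\<Sum>k<K. ?d j k) * Z j powr q)"
    unfolding sum_distrib_left[symmetric] sum_distrib_right
    by (subst sum.swap) (simp add: add.commute)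
  also have "\<dots> \<le> ?W powr (q - 1) * (\<Sum>j<K. ?W * Z j powr q)"
    using a by (intro mult_left_mono sum_mono mult_right_mono sum_geometric_distance_le) auto
  also have "\<dots> = ?W powr q * (\<Sum>j<K. Z j powr q)"
  proof -
    have "?W powr (q - 1) * ?W = ?W powr q"
      using a powr_add[of ?W "q - 1" 1] by simp
    then show ?thesis by (simp only: sum_distrib_left[symmetric] mult.assoc[symmetric])
  qed
  finally show ?thesis .
qed

text \<open>Minkowski's integral inequality: Hoelder's inequality in t against the weight A gives
  g^q <= L^(q-1) times the integral of k^q A^(1-q), and Fubini's theorem finishes. The norms enter
  only through the real bounds A and L.\<close>

lemma minkowski_nn_integral:
  fixes k :: "'a \<Rightarrow> 'b \<Rightarrow> real" and A :: "'b \<Rightarrow> real" and g :: "'a \<Rightarrow> real"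
  assumes S: "sigma_finite_measure S" and \<mu>: "finite_measure \<mu>" and q: "1 < q"
    and km[measurable]: "(\<lambda>(x, t). k x t) \<in> borel_measurable (S \<Otimes>\<^sub>M \<mu>)"
    and Am[measurable]: "A \<in> borel_measurable \<mu>" and gm[measurable]: "g \<in> borel_measurable S"
    and knn: "\<And>x t. x \<in> space S \<Longrightarrow> t \<in> space \<mu> \<Longrightarrow> 0 \<le> k x t"
    and Ann: "\<And>t. t \<in> space \<mu> \<Longrightarrow> 0 \<le> A t"
    and kA: "\<And>t. t \<in> space \<mu> \<Longrightarrow> (\<integral>\<^sup>+x. ennreal (k x t powr q) \<partial>S) \<le> ennreal (A t powr q)"
    and AL: "(\<integral>\<^sup>+t. ennreal (A t) \<partial>\<mu>) \<le> ennreal L" "0 \<le> L"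
    and g: "\<And>x. x \<in> space S \<Longrightarrow> 0 \<le> g x" "\<And>x. x \<in> space S \<Longrightarrow> ennreal (g x) \<le> (\<integral>\<^sup>+t. ennreal (k x t) \<partial>\<mu>)"
  shows "(\<integral>\<^sup>+x. ennreal (g x powr q) \<partial>S) \<le> ennreal (L powr q)"
proof -
  interpret S: sigma_finite_measure S by fact
  interpret mu: finite_measure \<mu> by fact
  interpret pair_sigma_finite S \<mu> ..
  define q' where "q' = q / (q - 1)"
  have q': "1 < q'" "1/q + 1/q' = 1" using q by (auto simp: q'_def field_simps)
  define m where "m = measure \<mu> (space \<mu>)"
  have approx: "(\<integral>\<^sup>+x. ennreal (g x powr q) \<partial>S) \<le> ennreal ((L + e * (m + 1)) powr q)" if e: "e > 0" for e
  proof -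
    \<comment> \<open>A may vanish, so negative powers are taken of A + e, with e tending to 0 at
      the end. The 1 in m + 1 keeps L' positive even when L and the mass of \<mu> are both
      0.\<close>
    define A' where "A' t = A t + e" for t
    define L' where "L' = L + e * (m + 1)"
    have L': "L' > 0" using e AL by (auto simp: L'_def m_def intro!: add_nonneg_pos mult_pos_pos add_nonneg_pos)
    have A'pos: "A' t > 0" if "t \<in> space \<mu>" for t using Ann[OF that] e by (simp add: A'_def)
    have [measurable]: "A' \<in> borel_measurable \<mu>" unfolding A'_def by measurable
    have A'L: "(\<integral>\<^sup>+t. ennreal (A' t) \<partial>\<mu>) \<le> ennreal L'"
    proof -
      have "(\<integral>\<^sup>+t. ennreal (A' t) \<partial>\<mu>) = (\<integral>\<^sup>+t. ennreal (A t) + ennreal e \<partial>\<mu>)"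
        using Ann e by (intro nn_integral_cong) (auto simp: A'_def ennreal_plus)
      also have "\<dots> = (\<integral>\<^sup>+t. ennreal (A t) \<partial>\<mu>) + ennreal e * ennreal m"
        by (subst nn_integral_add) (auto simp: m_def mu.emeasure_eq_measure)
      also have "\<dots> \<le> ennreal L + ennreal (e * m)"
        using AL e by (intro add_mono) (auto simp: ennreal_mult m_def)
      also have "\<dots> = ennreal (L + e * m)"
        using AL e by (subst ennreal_plus) (auto simp: m_def)
      also have "\<dots> \<le> ennreal L'" using e by (intro ennreal_leI) (auto simp: L'_def algebra_simps)
      finally show ?thesis .
    qed
    have point: "ennreal (g x powr q) \<le> ennreal (L' powr (q - 1)) * (\<integral>\<^sup>+t. ennreal (k x t powr q * A' t powr (1 - q)) \<partial>\<mu>)"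
      if x: "x \<in> space S" for x
    proof -
      let ?I = "(\<integral>\<^sup>+t. ennreal (k x t powr q * A' t powr (1 - q)) \<partial>\<mu>)"
      have [measurable]: "(\<lambda>t. k x t) \<in> borel_measurable \<mu>"
        using measurable_compose[OF measurable_Pair1'[OF x] km] by simp
      show ?thesis
      proof (cases "?I = \<infinity>")
        case True
        then show ?thesis using L' q by (simp add: ennreal_mult_eq_top_iff ennreal_mult_top)
      next
        case False
        then obtain I where I: "?I = ennreal I" "0 \<le> I" by (cases ?I) auto
        have "ennreal (g x) \<le> (\<integral>\<^sup>+t. ennreal (k x t) \<partial>\<mu>)" by (rule g(2)[OF x])
        also have "\<dots> = (\<integral>\<^sup>+t. ennreal ((k x t * A' t powr (- (1/q'))) * A' t powr (1/q')) \<partial>\<mu>)"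
          using A'pos by (intro nn_integral_cong) (auto simp: mult.assoc powr_add[symmetric] dest: A'pos)
        also have "\<dots> \<le> ennreal (I powr (1/q) * L' powr (1/q'))"
        proof (rule holder_nn_integral[OF q q'])
          have "(\<integral>\<^sup>+t. ennreal ((k x t * A' t powr - (1 / q')) powr q) \<partial>\<mu>) = ?I"
          proof (intro nn_integral_cong)
            fix t assume t: "t \<in> space \<mu>"
            have "- (1/q') * q = 1 - q" using q by (simp add: q'_def field_simps)
            then show "ennreal ((k x t * A' t powr - (1 / q')) powr q) = ennreal (k x t powr q * A' t powr (1 - q))"
              using knn[OF x t] by (simp add: powr_mult powr_powr)
          qed
          then show "(\<integral>\<^sup>+t. ennreal ((k x t * A' t powr - (1 / q')) powr q) \<partial>\<mu>) \<le> ennreal I" using I by simp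
          have "(\<integral>\<^sup>+t. ennreal ((A' t powr (1 / q')) powr q') \<partial>\<mu>) = (\<integral>\<^sup>+t. ennreal (A' t) \<partial>\<mu>)"
            using q' by (intro nn_integral_cong) (auto simp: powr_powr dest: A'pos)
          then show "(\<integral>\<^sup>+t. ennreal ((A' t powr (1 / q')) powr q') \<partial>\<mu>) \<le> ennreal L'" using A'L by simp
        qed (use knn[OF x] I L' in auto)
        finally have "g x \<le> I powr (1/q) * L' powr (1/q')" by (simp add: ennreal_le_iff)
        then have "g x powr q \<le> (I powr (1/q) * L' powr (1/q')) powr q"
          using g(1)[OF x] q by (intro powr_mono2) auto
        also have "\<dots> = L' powr (q - 1) * I"
          using q I by (simp add: powr_mult powr_powr q'_def)
        finally show ?thesis using I by (simp add: ennreal_mult[symmetric] ennreal_leI)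
      qed
    qed
    have "(\<integral>\<^sup>+x. ennreal (g x powr q) \<partial>S) \<le> (\<integral>\<^sup>+x. ennreal (L' powr (q - 1)) * (\<integral>\<^sup>+t. ennreal (k x t powr q * A' t powr (1 - q)) \<partial>\<mu>) \<partial>S)"
      by (intro nn_integral_mono point)
    also have "\<dots> = ennreal (L' powr (q - 1)) * (\<integral>\<^sup>+x. (\<integral>\<^sup>+t. ennreal (k x t powr q * A' t powr (1 - q)) \<partial>\<mu>) \<partial>S)"
      by (intro nn_integral_cmult) measurable
    also have "(\<integral>\<^sup>+x. (\<integral>\<^sup>+t. ennreal (k x t powr q * A' t powr (1 - q)) \<partial>\<mu>) \<partial>S)
       = (\<integral>\<^sup>+t. (\<integral>\<^sup>+x. ennreal (k x t powr q * A' t powr (1 - q)) \<partial>S) \<partial>\<mu>)"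
      by (rule Fubini'[symmetric]) measurable
    also have "\<dots> \<le> (\<integral>\<^sup>+t. ennreal (A' t) \<partial>\<mu>)"
    proof (intro nn_integral_mono)
      fix t assume t: "t \<in> space \<mu>"
      have [measurable]: "(\<lambda>x. k x t) \<in> borel_measurable S"
        using measurable_compose[OF measurable_Pair2'[OF t] km] by simp
      have "(\<integral>\<^sup>+x. ennreal (k x t powr q * A' t powr (1 - q)) \<partial>S) = (\<integral>\<^sup>+x. ennreal (k x t powr q) \<partial>S) * ennreal (A' t powr (1 - q))"
        by (simp add: ennreal_mult nn_integral_multc)
      also have "\<dots> \<le> ennreal (A t powr q) * ennreal (A' t powr (1 - q))"
        by (intro mult_right_mono kA t) auto
      also have "\<dots> \<le> ennreal (A' t powr q) * ennreal (A' t powr (1 - q))"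
        using Ann[OF t] e q by (intro mult_right_mono ennreal_leI powr_mono2) (auto simp: A'_def)
      also have "\<dots> = ennreal (A' t)" using A'pos[OF t] by (simp add: ennreal_mult[symmetric] powr_add[symmetric])
      finally show "(\<integral>\<^sup>+x. ennreal (k x t powr q * A' t powr (1 - q)) \<partial>S) \<le> ennreal (A' t)" .
    qed
    also have "\<dots> \<le> ennreal L'" by (rule A'L)
    finally have "(\<integral>\<^sup>+x. ennreal (g x powr q) \<partial>S) \<le> ennreal (L' powr (q - 1)) * ennreal L'"
      by (simp add: mult_left_mono)
    also have "\<dots> = ennreal (L' powr q)" using L' by (simp add: ennreal_mult[symmetric] powr_mult_base mult.commute)
    finally show ?thesis by (simp add: L'_def)
  qed
  have "((\<lambda>e. ennreal ((L + e * (m + 1)) powr q)) \<longlongrightarrow> ennreal ((L + 0 * (m + 1)) powr q)) (at_right 0)"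
    using q AL
    by (intro tendsto_ennrealI tendsto_powr' tendsto_intros)
       (auto simp: eventually_at_filter m_def intro!: always_eventually add_nonneg_nonneg mult_nonneg_nonneg)
  moreover have "\<forall>\<^sub>F e in at_right 0. (\<integral>\<^sup>+x. ennreal (g x powr q) \<partial>S) \<le> ennreal ((L + e * (m + 1)) powr q)"
    using eventually_at_right_less by (rule eventually_mono) (rule approx)
  ultimately show ?thesis
    using tendsto_lowerbound[of _ _ "at_right (0::real)"] by fastforce
qed

section \<open>Polar coordinates\<close>

text \<open>Both orders of integration are needed because a shear is a translation only in the inner
  variable, and there is one shear for each coordinate.\<close>

lemma nn_integral_complex_lborel:
  fixes F :: "complex \<Rightarrow> ennreal"
  assumes [measurable]: "F \<in> borel_measurable borel"
  shows "(\<integral>\<^sup>+z. F z \<partial>lborel) = (\<integral>\<^sup>+x. (\<integral>\<^sup>+y. F (Complex x y) \<partial>lborel) \<partial>lborel)"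
    and "(\<integral>\<^sup>+z. F z \<partial>lborel) = (\<integral>\<^sup>+y. (\<integral>\<^sup>+x. F (Complex x y) \<partial>lborel) \<partial>lborel)"
proof -
  define h where "h = (\<lambda>(x, y). Complex x y)"
  have "continuous_on UNIV (\<lambda>p. complex_of_real (fst p) + \<i> * complex_of_real (snd p))"
    by (intro continuous_intros)
  also have "(\<lambda>p. complex_of_real (fst p) + \<i> * complex_of_real (snd p)) = h"
    by (auto simp: h_def complex_eq_iff fun_eq_iff)
  finally have "h \<in> borel_measurable borel" by (rule borel_measurable_continuous_onI)
  then have hm[measurable]: "h \<in> borel_measurable (lborel \<Otimes>\<^sub>M lborel)"
    by (simp add: lborel_prod)
  have eq: "lborel = distr (lborel \<Otimes>\<^sub>M lborel) borel h"
  proof (rule lborel_eqI)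
    fix l u :: complex assume lu: "\<And>b. b \<in> Basis \<Longrightarrow> l \<bullet> b \<le> u \<bullet> b"
    have "h -` box l u \<inter> space (lborel \<Otimes>\<^sub>M lborel) = box (Re l) (Re u) \<times> box (Im l) (Im u)"
      by (auto simp: h_def box_def Basis_complex_def inner_complex_def space_pair_measure)
    then have "emeasure (distr (lborel \<Otimes>\<^sub>M lborel) borel h) (box l u) = emeasure lborel (box (Re l) (Re u)) * emeasure lborel (box (Im l) (Im u))"
      by (subst emeasure_distr) (auto simp: lborel.emeasure_pair_measure_Times)
    also have "\<dots> = (\<Prod>b\<in>Basis. (u - l) \<bullet> b)"
      using lu[of 1] lu[of \<i>] by (auto simp: Basis_complex_def ennreal_mult[symmetric] inner_complex_def)
    finally show "emeasure (distr (lborel \<Otimes>\<^sub>M lborel) borel h) (box l u) = (\<Prod>b\<in>Basis. (u - l) \<bullet> b)" .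
  qed simp
  have "(\<integral>\<^sup>+z. F z \<partial>lborel) = (\<integral>\<^sup>+p. F (h p) \<partial>(lborel \<Otimes>\<^sub>M lborel))"
    by (subst eq) (simp add: nn_integral_distr)
  moreover have "(\<lambda>p. F (h p)) = (\<lambda>(x, y). F (Complex x y))" by (auto simp: h_def)
  moreover have "(\<lambda>p. F (h p)) \<in> borel_measurable (lborel \<Otimes>\<^sub>M lborel)" by measurable
  ultimately have *: "(\<integral>\<^sup>+z. F z \<partial>lborel) = (\<integral>\<^sup>+p. (case p of (x, y) \<Rightarrow> F (Complex x y)) \<partial>(lborel \<Otimes>\<^sub>M lborel))"
    and m: "(\<lambda>(x, y). F (Complex x y)) \<in> borel_measurable (lborel \<Otimes>\<^sub>M lborel)"
    by simp_all
  show "(\<integral>\<^sup>+z. F z \<partial>lborel) = (\<integral>\<^sup>+x. (\<integral>\<^sup>+y. F (Complex x y) \<partial>lborel) \<partial>lborel)"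
    using lborel.nn_integral_fst[OF m] * by simp
  show "(\<integral>\<^sup>+z. F z \<partial>lborel) = (\<integral>\<^sup>+y. (\<integral>\<^sup>+x. F (Complex x y) \<partial>lborel) \<partial>lborel)"
    using lborel_pair.nn_integral_snd[OF m] * by simp
qed

lemma nn_integral_lborel_translation:
  fixes f :: "real \<Rightarrow> ennreal"
  assumes "f \<in> borel_measurable borel"
  shows "(\<integral>\<^sup>+x. f (x + c) \<partial>lborel) = (\<integral>\<^sup>+x. f x \<partial>lborel)"
  using nn_integral_real_affine[OF assms, of 1 c] by (simp add: add.commute)

lemma measurable_Complex [measurable (raw)]:
  assumes "f \<in> borel_measurable M" "g \<in> borel_measurable M"
  shows "(\<lambda>x. Complex (f x) (g x)) \<in> borel_measurable M"
proof -
  have "(\<lambda>x. complex_of_real (f x) + \<i> * complex_of_real (g x)) \<in> borel_measurable M"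
    using assms by measurable
  then show ?thesis by (simp add: Complex_eq)
qed

lemma nn_integral_shear:
  fixes F :: "complex \<Rightarrow> ennreal"
  assumes F[measurable]: "F \<in> borel_measurable borel"
  shows "(\<integral>\<^sup>+z. F (z + of_real (t * Im z)) \<partial>lborel) = (\<integral>\<^sup>+z. F z \<partial>lborel)"
    and "(\<integral>\<^sup>+z. F (z + \<i> * of_real (t * Re z)) \<partial>lborel) = (\<integral>\<^sup>+z. F z \<partial>lborel)"
proof -
  have 1: "Complex x y + of_real (t * y) = Complex (x + t * y) y" for x y by (simp add: complex_eq_iff)
  have "(\<integral>\<^sup>+z. F (z + of_real (t * Im z)) \<partial>lborel) = (\<integral>\<^sup>+y. (\<integral>\<^sup>+x. F (Complex (x + t * y) y) \<partial>lborel) \<partial>lborel)"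
    by (subst nn_integral_complex_lborel(2)) (auto simp: 1 simp del: of_real_mult)
  also have "\<dots> = (\<integral>\<^sup>+y. (\<integral>\<^sup>+x. F (Complex x y) \<partial>lborel) \<partial>lborel)"
    by (intro nn_integral_cong nn_integral_lborel_translation[where f = "\<lambda>x. F (Complex x _)"]) measurable
  finally show "(\<integral>\<^sup>+z. F (z + of_real (t * Im z)) \<partial>lborel) = (\<integral>\<^sup>+z. F z \<partial>lborel)"
    by (simp add: nn_integral_complex_lborel(2))
  have 2: "Complex x y + \<i> * of_real (t * x) = Complex x (y + t * x)" for x y by (simp add: complex_eq_iff)
  have "(\<integral>\<^sup>+z. F (z + \<i> * of_real (t * Re z)) \<partial>lborel) = (\<integral>\<^sup>+x. (\<integral>\<^sup>+y. F (Complex x (y + t * x)) \<partial>lborel) \<partial>lborel)"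
    by (subst nn_integral_complex_lborel(1)) (auto simp: 2 simp del: of_real_mult)
  also have "\<dots> = (\<integral>\<^sup>+x. (\<integral>\<^sup>+y. F (Complex x y) \<partial>lborel) \<partial>lborel)"
    by (intro nn_integral_cong nn_integral_lborel_translation[where f = "\<lambda>y. F (Complex _ y)"]) measurable
  finally show "(\<integral>\<^sup>+z. F (z + \<i> * of_real (t * Re z)) \<partial>lborel) = (\<integral>\<^sup>+z. F z \<partial>lborel)"
    by (simp add: nn_integral_complex_lborel(1))
qed

text \<open>A rotation by an angle other than \<open>\<pi>\<close> is a product of three shears.\<close>

lemma nn_integral_rotation:
  fixes F :: "complex \<Rightarrow> ennreal"
  assumes F[measurable]: "F \<in> borel_measurable borel" and c: "norm c = 1"
  shows "(\<integral>\<^sup>+z. F (c * z) \<partial>lborel) = (\<integral>\<^sup>+z. F z \<partial>lborel)"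
proof -
  have *: "(\<integral>\<^sup>+z. G (c * z) \<partial>lborel) = (\<integral>\<^sup>+z. G z \<partial>lborel)"
    if [measurable]: "G \<in> borel_measurable borel" and c: "norm c = 1" "Re c \<noteq> - 1" for G :: "complex \<Rightarrow> ennreal" and c
  proof -
    \<comment> \<open>For c = cis \<phi> this is -tan(\<phi>/2): the rotation is the horizontal
      shear by t, the vertical shear by Im c = sin \<phi>, and the horizontal shear by t again. The
      half-angle tangent is what excludes c = -1.\<close>
    define t where "t = - Im c / (1 + Re c)"
    have nz: "1 + Re c \<noteq> 0" using c by auto
    have n1: "Re c ^ 2 + Im c ^ 2 = 1" using c by (simp add: cmod_def)
    have st: "1 + Im c * t = Re c"
    proof -
      have "Im c * Im c = (1 - Re c) * (1 + Re c)"
        using n1 by (simp add: power2_eq_square algebra_simps)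
      then have "Im c * t = - (1 - Re c)"
        using nz by (simp add: t_def)
      then show ?thesis by simp
    qed
    have "(1 + Re c) * t = - Im c" using nz by (simp add: t_def)
    then have tc: "t + Re c * t = - Im c" by (simp add: algebra_simps)
    define S1 where "S1 z = z + complex_of_real (t * Im z)" for z
    define S2 where "S2 z = z + \<i> * complex_of_real (Im c * Re z)" for z
    have [measurable]: "S1 \<in> borel_measurable borel" "S2 \<in> borel_measurable borel"
      unfolding S1_def S2_def by measurable
    have "S1 (S2 (S1 z)) = c * z" for z
    proof -
      have 1: "Im (S2 (S1 z)) = Im c * Re z + (1 + Im c * t) * Im z"
        by (simp add: S1_def S2_def algebra_simps)
      have "Re (S1 (S2 (S1 z))) = Re z + t * Im z + t * Im (S2 (S1 z))"
        by (simp add: S1_def S2_def)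
      also have "\<dots> = Re z + t * Im z + t * (Im c * Re z + Re c * Im z)"
        unfolding 1 st ..
      also have "\<dots> = (1 + Im c * t) * Re z + (t + Re c * t) * Im z" by (simp add: algebra_simps)
      finally have 2: "Re (S1 (S2 (S1 z))) = Re c * Re z - Im c * Im z" unfolding st tc by simp
      have "Im (S1 (S2 (S1 z))) = Im (S2 (S1 z))" by (simp add: S1_def)
      then show ?thesis using 1[unfolded st] 2 by (simp add: complex_eq_iff algebra_simps)
    qed
    then have "(\<integral>\<^sup>+z. G (c * z) \<partial>lborel) = (\<integral>\<^sup>+z. (\<lambda>w. G (S1 (S2 w))) (z + of_real (t * Im z)) \<partial>lborel)"
      by (simp add: S1_def)
    also have "\<dots> = (\<integral>\<^sup>+z. G (S1 (S2 z)) \<partial>lborel)"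
      by (rule nn_integral_shear) measurable
    also have "\<dots> = (\<integral>\<^sup>+z. (\<lambda>w. G (S1 w)) (z + \<i> * of_real (Im c * Re z)) \<partial>lborel)"
      by (simp add: S2_def)
    also have "\<dots> = (\<integral>\<^sup>+z. G (S1 z) \<partial>lborel)"
      by (rule nn_integral_shear) measurable
    also have "\<dots> = (\<integral>\<^sup>+z. G z \<partial>lborel)"
      unfolding S1_def by (rule nn_integral_shear) measurable
    finally show ?thesis .
  qed
  show ?thesis
  proof (cases "Re c = - 1")
    case False
    then show ?thesis using * c by simp
  next
    case True
    with c have "Im c = 0" by (simp add: cmod_def)
    \<comment> \<open>The remaining rotation, by \<pi>, is done as two quarter turns.\<close>
    with True have "c = \<i> * \<i>" by (simp add: complex_eq_iff)
    then show ?thesis using *[of "\<lambda>z. F (\<i> * z)" \<i>] *[of F \<i>] by (simp add: mult.assoc)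
  qed
qed

text \<open>Normalized arc length, kept as a Borel measure on the whole plane so that it pairs with
  Borel functions there. The endpoints of [0, 1] give the same point, which has measure 0.\<close>

definition circle_measure :: "complex measure" where
  "circle_measure = distr (restrict_space lborel {0..1::real}) borel (\<lambda>t. cis (2 * pi * t))"

lemma measurable_cis_turn [measurable]: "(\<lambda>t. cis (2 * pi * t)) \<in> borel_measurable borel"
  by (intro borel_measurable_continuous_onI continuous_intros)

lemma sets_circle_measure [simp, measurable_cong]: "sets circle_measure = sets borel"
  by (simp add: circle_measure_def)

lemma space_circle_measure [simp]: "space circle_measure = UNIV"
  by (simp add: circle_measure_def)

lemma nn_integral_circle_measure:
  fixes F :: "complex \<Rightarrow> ennreal"
  assumes [measurable]: "F \<in> borel_measurable borel"
  shows "(\<integral>\<^sup>+\<zeta>. F \<zeta> \<partial>circle_measure) = (\<integral>\<^sup>+t. F (cis (2 * pi * t)) * indicator {0..1} t \<partial>lborel)"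
  unfolding circle_measure_def
  by (subst nn_integral_distr) (auto intro: measurable_restrict_space1 simp: nn_integral_restrict_space)

lemma emeasure_circle_measure_UNIV [simp]: "emeasure circle_measure UNIV = 1"
  using nn_integral_circle_measure[of "\<lambda>_. 1"] by simp

lemma finite_measure_circle: "finite_measure circle_measure"
  by (rule finite_measureI) simp

lemma AE_circle_norm: "AE \<zeta> in circle_measure. norm \<zeta> = 1"
  unfolding circle_measure_def by (subst AE_distr_iff) (auto intro: measurable_restrict_space1)

text \<open>The angle parameter has period 1: the shifted interval [a, 1 + a] is cut at 1 and its
  right part moved back by one period.\<close>

lemma nn_integral_circle_rotation:
  fixes F :: "complex \<Rightarrow> ennreal"
  assumes F[measurable]: "F \<in> borel_measurable borel" and c: "norm c = 1"
  shows "(\<integral>\<^sup>+\<zeta>. F (c * \<zeta>) \<partial>circle_measure) = (\<integral>\<^sup>+\<zeta>. F \<zeta> \<partial>circle_measure)"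
proof -
  obtain \<phi> where phi: "0 \<le> \<phi>" "\<phi> < 2 * pi" "c = cis \<phi>"
    using c Arg2pi[of c] by (auto simp: is_Arg_def cis_conv_exp)
  define a where "a = \<phi> / (2 * pi)"
  have a: "0 \<le> a" "a < 1" and ca: "c = cis (2 * pi * a)" using phi by (auto simp: a_def)
  define H where "H t = F (cis (2 * pi * t))" for t
  have [measurable]: "H \<in> borel_measurable borel" unfolding H_def by measurable
  have per: "H (t + 1) = H t" for t by (simp add: H_def ring_distribs cis_mult[symmetric])
  have "(\<integral>\<^sup>+\<zeta>. F (c * \<zeta>) \<partial>circle_measure) = (\<integral>\<^sup>+t. H (t + a) * indicator {0..1} t \<partial>lborel)"
    by (subst nn_integral_circle_measure) (auto simp: H_def ca cis_mult ring_distribs add.commute)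
  also have "\<dots> = (\<integral>\<^sup>+t. (\<lambda>u. H u * indicator {a..1+a} u) (t + a) \<partial>lborel)"
    by (intro nn_integral_cong) (auto split: split_indicator)
  also have "\<dots> = (\<integral>\<^sup>+u. H u * indicator {a..1+a} u \<partial>lborel)"
    by (rule nn_integral_lborel_translation) measurable
  also have "\<dots> = (\<integral>\<^sup>+u. H u * indicator {a..1} u + H u * indicator {1<..1+a} u \<partial>lborel)"
    using a by (intro nn_integral_cong) (auto split: split_indicator)
  also have "\<dots> = (\<integral>\<^sup>+u. H u * indicator {a..1} u \<partial>lborel) + (\<integral>\<^sup>+u. H u * indicator {1<..1+a} u \<partial>lborel)"
    by (rule nn_integral_add) measurable
  also have "(\<integral>\<^sup>+u. H u * indicator {1<..1+a} u \<partial>lborel) = (\<integral>\<^sup>+u. H (u + 1) * indicator {1<..1+a} (u + 1) \<partial>lborel)"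
    by (rule nn_integral_lborel_translation[symmetric, where f = "\<lambda>u. H u * indicator {1<..1+a} u"]) measurable
  also have "\<dots> = (\<integral>\<^sup>+u. H u * indicator {0<..a} u \<partial>lborel)"
    unfolding per by (intro nn_integral_cong) (auto split: split_indicator)
  also have "(\<integral>\<^sup>+u. H u * indicator {a..1} u \<partial>lborel) + (\<integral>\<^sup>+u. H u * indicator {0<..a} u \<partial>lborel)
     = (\<integral>\<^sup>+u. H u * indicator {a..1} u + H u * indicator {0<..a} u \<partial>lborel)"
    by (rule nn_integral_add[symmetric]) measurable
  also have "\<dots> = (\<integral>\<^sup>+u. H u * indicator {0..1} u \<partial>lborel)"
  proof (rule nn_integral_cong_AE)
    \<comment> \<open>The pieces [a, 1] and (0, a] overlap at a and omit 0.\<close>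
    have "AE u in lborel. u \<notin> {0, a}" by (intro AE_not_in) (auto simp: finite_imp_null_set_lborel)
    then show "AE u in lborel. H u * indicator {a..1} u + H u * indicator {0<..a} u = H u * indicator {0..1} u"
      by eventually_elim (use a in \<open>auto split: split_indicator\<close>)
  qed
  also have "\<dots> = (\<integral>\<^sup>+\<zeta>. F \<zeta> \<partial>circle_measure)"
    by (subst nn_integral_circle_measure) (auto simp: H_def)
  finally show ?thesis .
qed

lemma emeasure_annulus:
  assumes "0 \<le> x" "x < 1"
  shows "emeasure lborel {z::complex. norm z < 1 \<and> x < norm z} = ennreal (pi - pi * x\<^sup>2)"
proof -
  have "{z::complex. norm z < 1 \<and> x < norm z} = ball 0 1 - cball 0 x" by auto
  also have "emeasure lborel (ball 0 1 - cball 0 x :: complex set) = emeasure lborel (ball 0 1 :: complex set) - emeasure lborel (cball 0 x :: complex set)"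
    using assms by (intro emeasure_Diff) (auto simp: emeasure_cball)
  also have "\<dots> = ennreal (pi - pi * x\<^sup>2)"
    using assms by (simp add: emeasure_cball emeasure_ball unit_ball_vol_2 ennreal_minus)
  finally show ?thesis .
qed

text \<open>The law of |z| on the disc is compared with the density 2 \<pi> r on the half-lines
  beyond x, where both give the area of an annulus; finite measures on the line are determined by
  these values.\<close>

lemma nn_integral_radial:
  fixes g :: "real \<Rightarrow> ennreal"
  assumes [measurable]: "g \<in> borel_measurable borel"
  shows "(\<integral>\<^sup>+z. g (norm z) * indicator (ball 0 1) z \<partial>(lborel :: complex measure))
     = (\<integral>\<^sup>+r. g r * ennreal (2 * pi * r) * indicator {0..<1} r \<partial>lborel)"
proof -
  define M where "M = distr (restrict_space lborel (ball 0 1 :: complex set)) borel norm"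
  define N where "N = density lborel (\<lambda>r. ennreal (2 * pi * r) * indicator {0..<1} r)"
  have nm: "norm \<in> borel_measurable (restrict_space lborel (ball 0 1 :: complex set))"
    by (rule measurable_restrict_space1) simp
  have Mx: "emeasure M {x<..} = emeasure lborel {z::complex. norm z < 1 \<and> x < norm z}" for x
    unfolding M_def using nm
    by (subst emeasure_distr) (auto simp: emeasure_restrict_space space_restrict_space intro!: arg_cong[where f = "emeasure lborel"])
  \<comment> \<open>The interval is closed at 1 and truncated at 0 so that the fundamental theorem
    of calculus applies on a compact interval, for negative x as well.\<close>
  have Nx: "emeasure N {x<..} = (\<integral>\<^sup>+r. ennreal (2 * pi * r) * indicator {max 0 x..1} r \<partial>lborel)" for x
  proof -
    have "AE u in lborel. u \<notin> {x, 1}" by (intro AE_not_in) (auto simp: finite_imp_null_set_lborel)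
    then have "AE u in lborel. ennreal (2 * pi * u) * indicator {0..<1} u * indicator {x<..} u = ennreal (2 * pi * u) * indicator {max 0 x..1} u"
      by eventually_elim (auto split: split_indicator)
    then show ?thesis unfolding N_def
      by (subst emeasure_density) (auto intro!: nn_integral_cong_AE)
  qed
  have "M = N"
  proof (rule measure_eqI_lessThan)
    show "emeasure M {x<..} < \<infinity>" for x
    proof -
      have "emeasure M {x<..} \<le> emeasure lborel (ball 0 1 :: complex set)"
        unfolding Mx by (intro emeasure_mono) auto
      also have "\<dots> < \<infinity>" by (simp add: emeasure_ball)
      finally show ?thesis .
    qed
    show "emeasure M {x<..} = emeasure N {x<..}" for x
    proof (cases "x < 1")
      case False
      then have "{z::complex. norm z < 1 \<and> x < norm z} = {}" by auto
      moreover have "(\<integral>\<^sup>+r. ennreal (2 * pi * r) * indicator {max 0 x..1} r \<partial>lborel) = 0"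
      proof -
        have "AE u in lborel. u \<notin> {1::real}" by (intro AE_not_in) (auto simp: finite_imp_null_set_lborel)
        then have "AE r in lborel. ennreal (2 * pi * r) * indicator {max 0 x..1} r = 0"
          by eventually_elim (use False in \<open>auto split: split_indicator\<close>)
        then have "(\<integral>\<^sup>+r. ennreal (2 * pi * r) * indicator {max 0 x..1} r \<partial>lborel) = (\<integral>\<^sup>+(r::real). 0 \<partial>lborel)"
          by (rule nn_integral_cong_AE)
        then show ?thesis by simp
      qed
      ultimately show ?thesis by (simp only: Mx Nx) simp
    next
      case True
      have "(\<integral>\<^sup>+r. ennreal (2 * pi * r) * indicator {max 0 x..1} r \<partial>lborel) = ennreal (pi * 1\<^sup>2 - pi * (max 0 x)\<^sup>2)"
        using True by (intro nn_integral_FTC_Icc) (auto intro!: derivative_eq_intros)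
      moreover have "emeasure lborel {z::complex. norm z < 1 \<and> x < norm z} = ennreal (pi - pi * (max 0 x)\<^sup>2)"
      proof (cases "x < 0")
        case True
        then have "{z::complex. norm z < 1 \<and> x < norm z} = ball 0 1"
          by (auto intro: less_le_trans)
        then show ?thesis using True by (simp add: emeasure_ball unit_ball_vol_2)
      next
        case False
        then show ?thesis using \<open>x < 1\<close> by (simp add: emeasure_annulus)
      qed
      ultimately show ?thesis by (simp only: Mx Nx) simp
    qed
  qed (auto simp: M_def N_def)
  have "(\<integral>\<^sup>+z. g (norm z) * indicator (ball 0 1) z \<partial>(lborel :: complex measure)) = (\<integral>\<^sup>+r. g r \<partial>M)"
    unfolding M_def using nm by (simp add: nn_integral_distr nn_integral_restrict_space)
  also have "\<dots> = (\<integral>\<^sup>+r. g r * ennreal (2 * pi * r) * indicator {0..<1} r \<partial>lborel)"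
    unfolding \<open>M = N\<close> N_def by (subst nn_integral_density) (auto simp: ac_simps)
  finally show ?thesis .
qed

text \<open>Averaging over all rotations of the disc leaves the integral unchanged. After exchanging
  the integrals the inner one is a circle mean, which depends only on |z|, and the radial case
  applies.\<close>

lemma nn_integral_polar:
  fixes F :: "complex \<Rightarrow> ennreal"
  assumes F[measurable]: "F \<in> borel_measurable borel"
  shows "(\<integral>\<^sup>+z. F z * indicator (ball 0 1) z \<partial>lborel)
     = (\<integral>\<^sup>+r. (\<integral>\<^sup>+\<zeta>. F (of_real r * \<zeta>) \<partial>circle_measure) * ennreal (2 * pi * r) * indicator {0..<1} r \<partial>lborel)"
proof -
  interpret circ: finite_measure circle_measure by (rule finite_measure_circle)
  interpret P: pair_sigma_finite circle_measure "lborel :: complex measure" ..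
  have [measurable]: "ball 0 1 \<in> sets (borel :: complex measure)" by simp
  have "(\<integral>\<^sup>+z. F z * indicator (ball 0 1) z \<partial>lborel)
      = (\<integral>\<^sup>+\<zeta>. (\<integral>\<^sup>+z. F z * indicator (ball 0 1) z \<partial>lborel) \<partial>circle_measure)"
    by simp
  also have "\<dots> = (\<integral>\<^sup>+\<zeta>. (\<integral>\<^sup>+z. F (\<zeta> * z) * indicator (ball 0 1) z \<partial>lborel) \<partial>circle_measure)"
  proof (rule nn_integral_cong_AE, rule eventually_mono[OF AE_circle_norm])
    fix \<zeta> :: complex assume \<zeta>: "norm \<zeta> = 1"
    have "(\<integral>\<^sup>+z. F z * indicator (ball 0 1) z \<partial>lborel) = (\<integral>\<^sup>+z. F (\<zeta> * z) * indicator (ball 0 1) (\<zeta> * z) \<partial>lborel)"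
      using nn_integral_rotation[OF _ \<zeta>, of "\<lambda>z. F z * indicator (ball 0 1) z"] by simp
    then show "(\<integral>\<^sup>+z. F z * indicator (ball 0 1) z \<partial>lborel) = (\<integral>\<^sup>+z. F (\<zeta> * z) * indicator (ball 0 1) z \<partial>lborel)"
      using \<zeta> by (simp add: indicator_def norm_mult)
  qed
  also have "\<dots> = (\<integral>\<^sup>+z. (\<integral>\<^sup>+\<zeta>. F (\<zeta> * z) * indicator (ball 0 1) z \<partial>circle_measure) \<partial>lborel)"
    by (rule P.Fubini'[symmetric]) measurable
  also have "\<dots> = (\<integral>\<^sup>+z. (\<integral>\<^sup>+\<zeta>. F (of_real (norm z) * \<zeta>) \<partial>circle_measure) * indicator (ball 0 1) z \<partial>(lborel :: complex measure))"
  proof (intro nn_integral_cong)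
    fix z :: complex
    \<comment> \<open>c is the phase of z, to be absorbed by the rotation invariance of the circle
      measure; z = 0 takes c = 1.\<close>
    obtain c where c: "norm c = 1" "z = c * of_real (norm z)"
    proof (cases "z = 0")
      case True then show ?thesis by (intro that[of 1]) auto
    next
      case False then show ?thesis by (intro that[of "z / of_real (norm z)"]) (auto simp: norm_divide)
    qed
    have "(\<integral>\<^sup>+\<zeta>. F (\<zeta> * z) * indicator (ball 0 1) z \<partial>circle_measure) = (\<integral>\<^sup>+\<zeta>. F (\<zeta> * z) \<partial>circle_measure) * indicator (ball 0 1) z"
      by (rule nn_integral_multc) measurable
    also have "(\<integral>\<^sup>+\<zeta>. F (\<zeta> * z) \<partial>circle_measure) = (\<integral>\<^sup>+\<zeta>. (\<lambda>\<zeta>. F (of_real (norm z) * \<zeta>)) (c * \<zeta>) \<partial>circle_measure)"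
      by (subst c(2)) (simp add: ac_simps)
    also have "\<dots> = (\<integral>\<^sup>+\<zeta>. F (of_real (norm z) * \<zeta>) \<partial>circle_measure)"
      by (rule nn_integral_circle_rotation) (use c in auto)
    finally show "(\<integral>\<^sup>+\<zeta>. F (\<zeta> * z) * indicator (ball 0 1) z \<partial>circle_measure)
      = (\<integral>\<^sup>+\<zeta>. F (of_real (norm z) * \<zeta>) \<partial>circle_measure) * indicator (ball 0 1) z" .
  qed
  also have "\<dots> = (\<integral>\<^sup>+r. (\<integral>\<^sup>+\<zeta>. F (of_real r * \<zeta>) \<partial>circle_measure) * ennreal (2 * pi * r) * indicator {0..<1} r \<partial>lborel)"
    by (rule nn_integral_radial) measurable
  finally show ?thesis .
qed

section \<open>Radial weights as measures on the unit interval\<close>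

text \<open>The common format for the weights and for \<mu>. The measure lives on all of
  \<open>borel\<close>, although it is carried by [0, 1), so that it combines with Borel functions
  on the line.\<close>

definition unit_interval_measure :: "real measure \<Rightarrow> bool" where
  "unit_interval_measure N \<longleftrightarrow> finite_measure N \<and> sets N = sets borel \<and> (AE r in N. r \<in> {0..<1})"

text \<open>
  \<open>N\<close> is \<open>\<nu>(r) dr\<close> on \<open>[0, 1)\<close>, with \<open>\<nu>\<close> replaced by a Borel version: the weights are only
  Lebesgue measurable, and only as functions on the disc.
\<close>

definition weight_measure :: "(complex \<Rightarrow> real) \<Rightarrow> real measure \<Rightarrow> bool" where
  "weight_measure \<nu> N \<longleftrightarrow> unit_interval_measure N \<and>
     (\<forall>r\<ge>0. weight_tail \<nu> r = emeasure N {r..<1}) \<and>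
     (\<forall>n. weight_moment \<nu> n = (\<integral>r. r ^ n \<partial>N)) \<and>
     (\<forall>F :: complex \<Rightarrow> real. (\<forall>z. 0 \<le> F z) \<longrightarrow> F \<in> borel_measurable borel \<longrightarrow>
        (\<lambda>z. indicator (ball 0 1) z * (F z * \<nu> z)) \<in> borel_measurable lebesgue \<and>
        (\<integral>\<^sup>+z. ennreal (indicator (ball 0 1) z * (F z * \<nu> z)) \<partial>lebesgue)
          = (\<integral>\<^sup>+r. (\<integral>\<^sup>+\<zeta>. ennreal (F (of_real r * \<zeta>)) \<partial>circle_measure) * ennreal (2 * pi * r) \<partial>N))"

lemma radial_weight_eq:
  assumes "radial_weight \<nu>" "z \<in> ball 0 1"
  shows "\<nu> z = \<nu> (of_real (norm z))"
  using assms unfolding radial_weight_def by blast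

lemma radial_weight_nonneg:
  assumes "radial_weight \<nu>" "0 \<le> r" "r < 1"
  shows "0 \<le> \<nu> (of_real r)"
proof -
  have "\<forall>z\<in>ball 0 1. 0 \<le> \<nu> z" using assms unfolding radial_weight_def weight_def by blast
  moreover have "of_real r \<in> ball (0::complex) 1" using assms by simp
  ultimately show ?thesis by blast
qed

text \<open>The radius is a null set of the plane, so an a.e. version of \<nu> says nothing about
  \<nu> there. Radiality helps: for almost every r the value \<nu>(r) equals the circle mean at
  radius r, and the circle mean of a Borel version is a Borel function of r.\<close>

lemma radial_weight_borel_profile:
  assumes rw: "radial_weight \<nu>"
  obtains v :: "real \<Rightarrow> real" where "v \<in> borel_measurable borel" "\<And>r. 0 \<le> v r"
    "AE r in lborel. r \<in> {0..<1} \<longrightarrow> \<nu> (of_real r) = v r"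
    "AE z in lborel. z \<in> ball 0 1 \<longrightarrow> \<nu> z = v (norm z)"
proof -
  have [measurable]: "ball 0 1 \<in> sets (borel :: complex measure)" by simp
  define w where "w z = indicator (ball 0 1) z * \<nu> z" for z :: complex
  have wm: "w \<in> borel_measurable lebesgue"
  proof -
    have "integrable lebesgue w"
      using rw unfolding radial_weight_def weight_def set_integrable_def w_def[abs_def] real_scaleR_def by blast
    then show ?thesis by (rule borel_measurable_integrable)
  qed
  from completion_ex_borel_measurable_real[OF wm]
  obtain g where g[measurable]: "g \<in> borel_measurable borel" and wg: "AE z in lborel. w z = g z" by auto
  from AE_E[OF wg] obtain N0 where N0: "{z \<in> space lborel. \<not> w z = g z} \<subseteq> N0" "emeasure lborel N0 = 0" "N0 \<in> sets lborel" .
  have wgN0: "w z = g z" if "z \<notin> N0" for z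
  proof (rule ccontr)
    assume "w z \<noteq> g z"
    then have "z \<in> N0" by (intro subsetD[OF N0(1)]) simp
    with that show False ..
  qed
  have [measurable]: "N0 \<in> sets borel" using N0 by simp
  define v where "v r = enn2real (\<integral>\<^sup>+\<zeta>. ennreal (g (of_real r * \<zeta>)) \<partial>circle_measure)" for r
  interpret circ: finite_measure circle_measure by (rule finite_measure_circle)
  have vm[measurable]: "v \<in> borel_measurable borel" unfolding v_def by measurable
  have "(\<integral>\<^sup>+r. (\<integral>\<^sup>+\<zeta>. indicator N0 (of_real r * \<zeta>) \<partial>circle_measure) * ennreal (2 * pi * r) * indicator {0..<1} r \<partial>lborel)
      = (\<integral>\<^sup>+z. indicator N0 z * indicator (ball 0 1) z \<partial>lborel)"
    by (rule nn_integral_polar[symmetric]) measurable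
  also have "\<dots> \<le> (\<integral>\<^sup>+z. indicator N0 z \<partial>lborel)"
    by (intro nn_integral_mono) (auto split: split_indicator)
  also have "\<dots> = 0" using N0 by simp
  \<comment> \<open>The exceptional null set of the plane meets almost every circle in a null set.
    The factor 2 \<pi> r vanishes at 0, hence r = 0 is discarded next.\<close>
  finally have "AE r in lborel. (\<integral>\<^sup>+\<zeta>. indicator N0 (of_real r * \<zeta>) \<partial>circle_measure) * ennreal (2 * pi * r) * indicator {0..<1} r = 0"
    by (subst nn_integral_0_iff_AE[symmetric]) auto
  moreover have "AE r in lborel. r \<noteq> (0::real)" by (rule AE_lborel_singleton)
  ultimately have v1: "AE r in lborel. r \<in> {0..<1} \<longrightarrow> \<nu> (of_real r) = v r"
  proof eventually_elim
    case (elim r)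
    show ?case
    proof
      assume r: "r \<in> {0..<1}"
      with elim have "(\<integral>\<^sup>+\<zeta>. indicator N0 (of_real r * \<zeta>) \<partial>circle_measure) = 0" by auto
      then have "AE \<zeta> in circle_measure. (indicator N0 (of_real r * \<zeta>) :: ennreal) = 0"
        by (subst (asm) nn_integral_0_iff_AE) auto
      then have "AE \<zeta> in circle_measure. ennreal (g (of_real r * \<zeta>)) = ennreal (\<nu> (of_real r))"
        using AE_circle_norm
      proof eventually_elim
        case (elim \<zeta>)
        then have "of_real r * \<zeta> \<notin> N0" by (simp split: split_indicator_asm)
        then have "g (of_real r * \<zeta>) = w (of_real r * \<zeta>)" using wgN0 by simp
        also have "\<dots> = \<nu> (of_real r * \<zeta>)" using elim r by (simp add: w_def norm_mult)
        also have "\<dots> = \<nu> (of_real (norm (of_real r * \<zeta>)))"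
          by (rule radial_weight_eq[OF rw]) (use elim r in \<open>simp add: norm_mult\<close>)
        finally show ?case using elim r by (simp add: norm_mult)
      qed
      then have "(\<integral>\<^sup>+\<zeta>. ennreal (g (of_real r * \<zeta>)) \<partial>circle_measure) = (\<integral>\<^sup>+\<zeta>. ennreal (\<nu> (of_real r)) \<partial>circle_measure)"
        by (rule nn_integral_cong_AE)
      then show "\<nu> (of_real r) = v r"
        using radial_weight_nonneg[OF rw, of r] r by (simp add: v_def)
    qed
  qed
  from AE_E[OF v1] obtain N1 where N1: "{r \<in> space lborel. \<not> (r \<in> {0..<1} \<longrightarrow> \<nu> (of_real r) = v r)} \<subseteq> N1" "emeasure lborel N1 = 0" "N1 \<in> sets lborel" .
  have vN1: "\<nu> (of_real r) = v r" if "r \<in> {0..<1}" "r \<notin> N1" for r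
  proof (rule ccontr)
    assume "\<nu> (of_real r) \<noteq> v r"
    then have "r \<in> N1" using that by (intro subsetD[OF N1(1)]) simp
    with that show False by simp
  qed
  have [measurable]: "N1 \<in> sets borel" using N1 by simp
  have "AE r in lborel. r \<notin> N1" using N1 by (intro AE_not_in) auto
  then have "AE r in lborel. indicator N1 r * ennreal (2 * pi * r) * indicator {0..<1} r = (0::ennreal)"
    by eventually_elim simp
  then have "(\<integral>\<^sup>+r. indicator N1 r * ennreal (2 * pi * r) * indicator {0..<1} r \<partial>lborel) = (\<integral>\<^sup>+(r::real). 0 \<partial>lborel)"
    by (rule nn_integral_cong_AE)
  \<comment> \<open>Conversely, the circles whose radii lie in the null set N1 form a null set of
    the plane.\<close>
  moreover have "(\<integral>\<^sup>+z. indicator N1 (norm z) * indicator (ball 0 1) z \<partial>(lborel :: complex measure))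
      = (\<integral>\<^sup>+r. indicator N1 r * ennreal (2 * pi * r) * indicator {0..<1} r \<partial>lborel)"
    by (rule nn_integral_radial) measurable
  ultimately have "(\<integral>\<^sup>+z. indicator N1 (norm z) * indicator (ball 0 1) z \<partial>(lborel :: complex measure)) = 0"
    by simp
  then have "AE z in (lborel :: complex measure). indicator N1 (norm z) * indicator (ball 0 1) z = (0::ennreal)"
    by (subst (asm) nn_integral_0_iff_AE) auto
  then have "AE z in lborel. z \<in> ball 0 1 \<longrightarrow> \<nu> z = v (norm z)"
  proof eventually_elim
    case (elim z)
    show ?case
    proof
      assume z: "z \<in> ball (0::complex) 1"
      with elim have "norm z \<notin> N1" by (auto split: split_indicator_asm)
      then have "\<nu> (of_real (norm z)) = v (norm z)" using z by (intro vN1) auto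
      then show "\<nu> z = v (norm z)" using radial_weight_eq[OF rw z] by simp
    qed
  qed
  then show ?thesis using that[OF vm _ v1] by (auto simp: v_def)
qed

text \<open>The finite tail at 0 makes the density v on [0, 1) a finite measure. Tails, moments and
  area integrals of \<nu> agree with those of v, since the two differ only on a null set of the line
  or of the disc.\<close>

lemma radial_weight_measure_exists:
  assumes rw: "radial_weight \<nu>" and fin: "weight_tail \<nu> 0 < \<infinity>"
  shows "\<exists>N. weight_measure \<nu> N"
proof -
  have [measurable]: "ball 0 1 \<in> sets (borel :: complex measure)" by simp
  obtain v where vm[measurable]: "v \<in> borel_measurable borel" and vnn: "\<And>r. 0 \<le> v r"
    and v1: "AE r in lborel. r \<in> {0..<1} \<longrightarrow> \<nu> (of_real r) = v r"
    and v2: "AE z in lborel. z \<in> ball 0 1 \<longrightarrow> \<nu> z = v (norm z)"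
    using radial_weight_borel_profile[OF rw] by blast
  define N where "N = density lborel (\<lambda>r. ennreal (v r) * indicator {0..<1} r)"
  have [measurable_cong, simp]: "sets N = sets borel" by (simp add: N_def)
  have [simp]: "space N = UNIV" by (simp add: N_def)
  have tail: "weight_tail \<nu> r = emeasure N {r..<1}" if "0 \<le> r" for r
  proof -
    have "weight_tail \<nu> r = (\<integral>\<^sup>+s. ennreal (\<nu> (of_real s)) * indicator {r..<1} s \<partial>lborel)"
      unfolding weight_tail_def by (rule nn_integral_completion)
    also have "\<dots> = (\<integral>\<^sup>+s. ennreal (v s) * indicator {0..<1} s * indicator {r..<1} s \<partial>lborel)"
      using v1 that by (intro nn_integral_cong_AE) (auto elim!: eventually_mono split: split_indicator)
    also have "\<dots> = emeasure N {r..<1}" unfolding N_def by (subst emeasure_density) auto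
    finally show ?thesis .
  qed
  have AEN: "AE r in N. r \<in> {0..<1}" unfolding N_def
    by (subst AE_density) (auto split: split_indicator)
  have "emeasure N (space N) = emeasure N {0..<1}"
    using AEN by (intro emeasure_eq_AE) auto
  also have "\<dots> < \<infinity>" using tail[of 0] fin by simp
  finally have "finite_measure N" by (intro finite_measureI) auto
  with AEN have uN: "unit_interval_measure N" by (simp add: unit_interval_measure_def)
  have moment: "weight_moment \<nu> n = (\<integral>r. r ^ n \<partial>N)" for n
  proof -
    have ae: "AE s in lborel. indicator {0..<1} s * (s ^ n * v s) = indicator {0..<1} s * (s ^ n * \<nu> (of_real s))"
      using v1 by eventually_elim (auto split: split_indicator)
    have m1: "(\<lambda>s. indicator {0..<1} s * (s ^ n * v s)) \<in> borel_measurable lborel" by measurable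
    then have m2: "(\<lambda>s. indicator {0..<1} s * (s ^ n * v s)) \<in> borel_measurable lebesgue" by (rule measurable_completion)
    have m3: "(\<lambda>s. indicator {0..<1} s * (s ^ n * \<nu> (of_real s))) \<in> borel_measurable lebesgue"
      by (rule borel_measurable_AE[OF m2 AE_completion[OF ae]])
    have "weight_moment \<nu> n = (\<integral>s. indicator {0..<1} s * (s ^ n * \<nu> (of_real s)) \<partial>lebesgue)"
      by (simp add: weight_moment_def set_lebesgue_integral_def)
    also have "\<dots> = (\<integral>s. indicator {0..<1} s * (s ^ n * v s) \<partial>lebesgue)"
      by (rule integral_cong_AE[OF m2 m3, symmetric]) (rule AE_completion[OF ae])
    also have "\<dots> = (\<integral>s. indicator {0..<1} s * (s ^ n * v s) \<partial>lborel)"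
      using m1 by (rule integral_completion)
    also have "\<dots> = (\<integral>s. (v s * indicator {0..<1} s) *\<^sub>R s ^ n \<partial>lborel)"
      by (intro Bochner_Integration.integral_cong) (auto simp: ac_simps)
    also have "\<dots> = (\<integral>r. r ^ n \<partial>density lborel (\<lambda>r. ennreal (v r * indicator {0..<1} r)))"
      by (rule integral_density[symmetric]) (auto simp: vnn)
    also have "(\<lambda>r. ennreal (v r * indicator {0..<1} r)) = (\<lambda>r. ennreal (v r) * indicator {0..<1} r)"
      by (auto split: split_indicator)
    finally show ?thesis by (simp add: N_def)
  qed
  have area: "(\<lambda>z. indicator (ball 0 1) z * (F z * \<nu> z)) \<in> borel_measurable lebesgue \<and>
        (\<integral>\<^sup>+z. ennreal (indicator (ball 0 1) z * (F z * \<nu> z)) \<partial>lebesgue)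
          = (\<integral>\<^sup>+r. (\<integral>\<^sup>+\<zeta>. ennreal (F (of_real r * \<zeta>)) \<partial>circle_measure) * ennreal (2 * pi * r) \<partial>N)"
    if Fnn: "\<And>z. 0 \<le> F z" and [measurable]: "F \<in> borel_measurable borel" for F :: "complex \<Rightarrow> real"
  proof
    interpret circ: finite_measure circle_measure by (rule finite_measure_circle)
    have ae: "AE z in lborel. indicator (ball 0 1) z * (F z * v (norm z)) = indicator (ball 0 1) z * (F z * \<nu> z)"
      using v2 by eventually_elim (auto split: split_indicator)
    have "(\<lambda>z. indicator (ball 0 1) z * (F z * v (norm z))) \<in> borel_measurable lborel" by measurable
    then have m2: "(\<lambda>z. indicator (ball 0 1) z * (F z * v (norm z))) \<in> borel_measurable lebesgue" by (rule measurable_completion)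
    show "(\<lambda>z. indicator (ball 0 1) z * (F z * \<nu> z)) \<in> borel_measurable lebesgue"
      by (rule borel_measurable_AE[OF m2 AE_completion[OF ae]])
    have "(\<integral>\<^sup>+z. ennreal (indicator (ball 0 1) z * (F z * \<nu> z)) \<partial>lebesgue)
        = (\<integral>\<^sup>+z. ennreal (indicator (ball 0 1) z * (F z * \<nu> z)) \<partial>lborel)"
      by (rule nn_integral_completion)
    also have "\<dots> = (\<integral>\<^sup>+z. ennreal (F z * v (norm z)) * indicator (ball 0 1) z \<partial>lborel)"
      using ae by (intro nn_integral_cong_AE) (auto elim!: eventually_mono split: split_indicator)
    also have "\<dots> = (\<integral>\<^sup>+r. (\<integral>\<^sup>+\<zeta>. ennreal (F (of_real r * \<zeta>) * v (norm (of_real r * \<zeta>))) \<partial>circle_measure) * ennreal (2 * pi * r) * indicator {0..<1} r \<partial>lborel)"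
      by (rule nn_integral_polar) measurable
    also have "\<dots> = (\<integral>\<^sup>+r. (ennreal (v r) * indicator {0..<1} r) * ((\<integral>\<^sup>+\<zeta>. ennreal (F (of_real r * \<zeta>)) \<partial>circle_measure) * ennreal (2 * pi * r)) \<partial>lborel)"
    proof (intro nn_integral_cong)
      fix r :: real
      show "(\<integral>\<^sup>+\<zeta>. ennreal (F (of_real r * \<zeta>) * v (norm (of_real r * \<zeta>))) \<partial>circle_measure) * ennreal (2 * pi * r) * indicator {0..<1} r
        = (ennreal (v r) * indicator {0..<1} r) * ((\<integral>\<^sup>+\<zeta>. ennreal (F (of_real r * \<zeta>)) \<partial>circle_measure) * ennreal (2 * pi * r))"
      proof (cases "r \<in> {0..<1}")
        case True
        have "(\<integral>\<^sup>+\<zeta>. ennreal (F (of_real r * \<zeta>) * v (norm (of_real r * \<zeta>))) \<partial>circle_measure)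
          = (\<integral>\<^sup>+\<zeta>. ennreal (v r) * ennreal (F (of_real r * \<zeta>)) \<partial>circle_measure)"
          using AE_circle_norm True Fnn vnn
          by (intro nn_integral_cong_AE) (auto elim!: eventually_mono simp: norm_mult ennreal_mult mult.commute)
        also have "\<dots> = ennreal (v r) * (\<integral>\<^sup>+\<zeta>. ennreal (F (of_real r * \<zeta>)) \<partial>circle_measure)"
          by (rule nn_integral_cmult) measurable
        finally show ?thesis using True by (simp add: ac_simps)
      qed auto
    qed
    also have "\<dots> = (\<integral>\<^sup>+r. (\<integral>\<^sup>+\<zeta>. ennreal (F (of_real r * \<zeta>)) \<partial>circle_measure) * ennreal (2 * pi * r) \<partial>N)"
      unfolding N_def by (rule nn_integral_density[symmetric]) measurable
    finally show "(\<integral>\<^sup>+z. ennreal (indicator (ball 0 1) z * (F z * \<nu> z)) \<partial>lebesgue)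
          = (\<integral>\<^sup>+r. (\<integral>\<^sup>+\<zeta>. ennreal (F (of_real r * \<zeta>)) \<partial>circle_measure) * ennreal (2 * pi * r) \<partial>N)" .
  qed
  have "weight_measure \<nu> N"
    unfolding weight_measure_def by (intro conjI allI impI uN tail moment area[THEN conjunct1] area[THEN conjunct2]) auto
  then show ?thesis ..
qed

section \<open>Circle means of holomorphic functions\<close>

text \<open>
  The values outside the disc are irrelevant, but measurability on the whole plane makes the
  circle means measurable in the radius.
\<close>

definition disc_holomorphic :: "(complex \<Rightarrow> complex) \<Rightarrow> bool" where
  "disc_holomorphic f \<longleftrightarrow> f holomorphic_on ball 0 1 \<and> f \<in> borel_measurable borel"

definition circle_mean :: "real \<Rightarrow> (complex \<Rightarrow> complex) \<Rightarrow> real \<Rightarrow> real" where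
  "circle_mean p f r = (\<integral>\<zeta>. norm (f (of_real r * \<zeta>)) powr p \<partial>circle_measure)"

lemma disc_holomorphic_bounded:
  assumes "disc_holomorphic f" "r < 1"
  obtains B where "0 \<le> B" "\<And>z. norm z \<le> r \<Longrightarrow> norm (f z) \<le> B"
proof -
  have "continuous_on (cball 0 r) f"
    using assms by (intro holomorphic_on_imp_continuous_on) (auto simp: disc_holomorphic_def intro: holomorphic_on_subset)
  then have "bounded (f ` cball 0 r)"
    by (intro compact_imp_bounded compact_continuous_image) auto
  then obtain B where "0 < B" "\<And>z. z \<in> cball 0 r \<Longrightarrow> norm (f z) \<le> B"
    unfolding bounded_pos by auto
  then show ?thesis using that[of B] by auto
qed

lemma AE_circle_bounded:
  assumes "disc_holomorphic f" "0 \<le> r" "r < 1"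
  obtains B where "0 \<le> B" "AE \<zeta> in circle_measure. norm (f (of_real r * \<zeta>)) \<le> B"
proof -
  obtain B where B: "0 \<le> B" "\<And>z. norm z \<le> r \<Longrightarrow> norm (f z) \<le> B"
    using disc_holomorphic_bounded[OF assms(1,3)] by blast
  then have "AE \<zeta> in circle_measure. norm (f (of_real r * \<zeta>)) \<le> B"
    using AE_circle_norm assms by (auto elim!: eventually_mono simp: norm_mult)
  then show ?thesis using that B by blast
qed

lemma integrable_circle_powr:
  assumes f: "disc_holomorphic f" and r: "0 \<le> r" "r < 1" and p: "0 \<le> p"
  shows "integrable circle_measure (\<lambda>\<zeta>. norm (f (of_real r * \<zeta>)) powr p)"
proof -
  interpret finite_measure circle_measure by (rule finite_measure_circle)
  have [measurable]: "f \<in> borel_measurable borel" using f by (simp add: disc_holomorphic_def)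
  obtain B where B: "0 \<le> B" "AE \<zeta> in circle_measure. norm (f (of_real r * \<zeta>)) \<le> B"
    using AE_circle_bounded[OF f r] by blast
  show ?thesis
    by (rule integrable_const_bound[where B = "B powr p"])
       (use B p in \<open>auto elim!: eventually_mono intro!: powr_mono2\<close>)
qed

lemma circle_mean_nonneg [simp]: "0 \<le> circle_mean p f r"
  unfolding circle_mean_def by (rule integral_nonneg_AE) auto

lemma nn_integral_circle_mean:
  assumes f: "disc_holomorphic f" and r: "0 \<le> r" "r < 1" and p: "0 \<le> p"
  shows "(\<integral>\<^sup>+\<zeta>. ennreal (norm (f (of_real r * \<zeta>)) powr p) \<partial>circle_measure) = ennreal (circle_mean p f r)"
  unfolding circle_mean_def
  by (rule nn_integral_eq_integral[OF integrable_circle_powr[OF assms]]) auto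

lemma circle_mean_rotate:
  assumes f: "disc_holomorphic f" and r: "0 \<le> r" "r < 1" and p: "0 \<le> p" and c: "norm c = 1"
  shows "(\<integral>\<^sup>+\<zeta>. ennreal (norm (f (of_real r * (c * \<zeta>))) powr p) \<partial>circle_measure) = ennreal (circle_mean p f r)"
proof -
  have [measurable]: "f \<in> borel_measurable borel" using f by (simp add: disc_holomorphic_def)
  have "(\<integral>\<^sup>+\<zeta>. ennreal (norm (f (of_real r * (c * \<zeta>))) powr p) \<partial>circle_measure)
      = (\<integral>\<^sup>+\<zeta>. ennreal (norm (f (of_real r * \<zeta>)) powr p) \<partial>circle_measure)"
    using nn_integral_circle_rotation[OF _ c, of "\<lambda>\<zeta>. ennreal (norm (f (of_real r * \<zeta>)) powr p)"] by simp
  then show ?thesis by (simp add: nn_integral_circle_mean[OF f r p])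
qed

lemma norm_integral_le_nn_integral:
  fixes f :: "'a \<Rightarrow> 'b::{banach, second_countable_topology}"
  shows "ennreal (norm (\<integral>x. f x \<partial>M)) \<le> (\<integral>\<^sup>+x. ennreal (norm (f x)) \<partial>M)"
  by (cases "integrable M f") (auto simp: integral_norm_bound_ennreal not_integrable_integral_eq)

text \<open>The power series of h is integrated term by term; bounded \<psi> and |\<phi>| <= 1 keep
  it absolutely convergent. It is used with \<phi> the point of the circle and \<psi> a conjugate
  phase, and with \<phi> = t and \<psi> = 1.\<close>

lemma holomorphic_dilation_integral:
  fixes \<phi> \<psi> :: "'a \<Rightarrow> complex"
  assumes M: "finite_measure M" and h: "disc_holomorphic h"
    and [measurable]: "\<phi> \<in> borel_measurable M" "\<psi> \<in> borel_measurable M"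
    and phi: "AE x in M. norm (\<phi> x) \<le> 1" and psi: "AE x in M. norm (\<psi> x) \<le> B"
  shows "(\<lambda>z. \<integral>x. h (z * \<phi> x) * \<psi> x \<partial>M) holomorphic_on ball 0 1"
proof (rule power_series_holomorphic)
  fix z :: complex assume z: "z \<in> ball 0 1"
  interpret finite_measure M by fact
  define a where "a n = (deriv ^^ n) h 0 / fact n" for n
  have sums: "(\<lambda>n. a n * w ^ n) sums h w" if "norm w < 1" for w
    using holomorphic_power_series[of h 0 1 w] h that by (simp add: a_def disc_holomorphic_def)
  obtain y where y: "norm z < y" "y < 1" using z dense[of "norm z" 1] by auto
  then have "0 < y" using norm_ge_zero[of z] by linarith
  have "summable (\<lambda>n. a n * of_real y ^ n)" using sums[of "of_real y"] y \<open>0 < y\<close> by (auto simp: sums_iff)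
  from powser_insidea[OF this, of z] have summ: "summable (\<lambda>n. norm (a n * z ^ n))"
    using y \<open>0 < y\<close> by simp
  let ?f = "\<lambda>n x. a n * (z * \<phi> x) ^ n * \<psi> x"
  have bound: "AE x in M. norm (?f n x) \<le> norm (a n * z ^ n) * \<bar>B\<bar>" for n
    using phi psi
  proof eventually_elim
    case (elim x)
    have "norm (\<phi> x) ^ n \<le> 1" using elim by (intro power_le_one) auto
    then have "norm (a n * z ^ n) * norm (\<phi> x) ^ n * norm (\<psi> x) \<le> norm (a n * z ^ n) * 1 * \<bar>B\<bar>"
      using elim by (intro mult_mono) auto
    then show ?case by (simp add: norm_mult norm_power power_mult_distrib mult_ac)
  qed
  have int: "integrable M (?f n)" for n
    by (rule integrable_const_bound[OF bound]) measurable
  have allbound: "AE x in M. \<forall>n. norm (?f n x) \<le> norm (a n * z ^ n) * \<bar>B\<bar>"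
    unfolding AE_all_countable using bound by blast
  have "(\<lambda>n. \<integral>x. ?f n x \<partial>M) sums (\<integral>x. (\<Sum>n. ?f n x) \<partial>M)"
  proof (rule sums_integral[OF int])
    show "AE x in M. summable (\<lambda>n. norm (?f n x))"
      using allbound
    proof eventually_elim
      case (elim x)
      show ?case
        by (rule summable_comparison_test'[OF summable_mult2[OF summ, of "\<bar>B\<bar>"], of 0]) (use elim in simp)
    qed
    show "summable (\<lambda>n. \<integral>x. norm (?f n x) \<partial>M)"
    proof (rule summable_comparison_test'[where g = "\<lambda>n. norm (a n * z ^ n) * (\<bar>B\<bar> * measure M (space M))"])
      show "summable (\<lambda>n. norm (a n * z ^ n) * (\<bar>B\<bar> * measure M (space M)))"
        by (rule summable_mult2[OF summ])
      fix n
      have "(\<integral>x. norm (?f n x) \<partial>M) \<le> (\<integral>x. norm (a n * z ^ n) * \<bar>B\<bar> \<partial>M)"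
        by (rule integral_mono_AE[OF integrable_norm[OF int] integrable_const bound])
      moreover have "(\<integral>x. norm (a n * z ^ n) * \<bar>B\<bar> \<partial>M) = norm (a n * z ^ n) * (\<bar>B\<bar> * measure M (space M))"
        by simp
      moreover have "0 \<le> (\<integral>x. norm (?f n x) \<partial>M)" by (rule integral_nonneg_AE) auto
      ultimately show "norm (\<integral>x. norm (?f n x) \<partial>M) \<le> norm (a n * z ^ n) * (\<bar>B\<bar> * measure M (space M))"
        by (simp only: real_norm_def abs_of_nonneg)
    qed
  qed
  also have "(\<integral>x. (\<Sum>n. ?f n x) \<partial>M) = (\<integral>x. h (z * \<phi> x) * \<psi> x \<partial>M)"
  proof (rule integral_cong_AE)
    have hm[measurable]: "h \<in> borel_measurable borel" using h by (simp add: disc_holomorphic_def)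
    show "(\<lambda>x. h (z * \<phi> x) * \<psi> x) \<in> borel_measurable M" by measurable
    show "(\<lambda>x. \<Sum>n. ?f n x) \<in> borel_measurable M" by measurable
    show "AE x in M. (\<Sum>n. ?f n x) = h (z * \<phi> x) * \<psi> x"
      using phi
    proof eventually_elim
      case (elim x)
      have "norm (z * \<phi> x) \<le> norm z * 1" unfolding norm_mult using elim by (intro mult_left_mono) auto
      then have "norm (z * \<phi> x) < 1" using y by simp
      from sums_mult2[OF sums[OF this]] show ?case by (rule sums_unique[symmetric])
    qed
  qed
  also have "(\<lambda>n. \<integral>x. ?f n x \<partial>M) = (\<lambda>n. (a n * (\<integral>x. \<phi> x ^ n * \<psi> x \<partial>M)) * (z - 0) ^ n)"
  proof
    fix n
    have "(\<integral>x. ?f n x \<partial>M) = (\<integral>x. (a n * z ^ n) * (\<phi> x ^ n * \<psi> x) \<partial>M)"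
      by (simp add: power_mult_distrib mult.assoc)
    also have "\<dots> = (a n * z ^ n) * (\<integral>x. \<phi> x ^ n * \<psi> x \<partial>M)"
      by (rule integral_mult_right_zero)
    finally show "(\<integral>x. ?f n x \<partial>M) = (a n * (\<integral>x. \<phi> x ^ n * \<psi> x \<partial>M)) * (z - 0) ^ n"
      by (simp add: mult_ac)
  qed
  finally show "(\<lambda>n. (a n * (\<integral>x. \<phi> x ^ n * \<psi> x \<partial>M)) * (z - 0) ^ n) sums (\<integral>x. h (z * \<phi> x) * \<psi> x \<partial>M)" .
qed

text \<open>
  By duality: testing \<open>f\<close> on the circle of radius \<open>r\<close> against its own conjugate phase gives a
  holomorphic function of the radius, to which the maximum modulus principle applies.
\<close>

lemma circle_mean_mono:
  assumes f: "disc_holomorphic f" and r: "0 \<le> r" "r \<le> R" "R < 1" and p: "1 < p"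
  shows "circle_mean p f r \<le> circle_mean p f R"
proof (cases "r = R \<or> circle_mean p f r = 0")
  case True
  then show ?thesis by auto
next
  case False
  then have rR: "r < R" using r by auto
  have m: "0 < circle_mean p f r"
    using False circle_mean_nonneg[of p f r] by (metis less_eq_real_def)
  interpret finite_measure circle_measure by (rule finite_measure_circle)
  have [measurable]: "f \<in> borel_measurable borel" using f by (simp add: disc_holomorphic_def)
  define p' where "p' = p / (p - 1)"
  have p': "1 < p'" "1/p + 1/p' = 1" using p by (auto simp: p'_def field_simps)
  \<comment> \<open>The extremal function of the duality: f \<psi> = |f|^p and |\<psi>|^p' = |f|^p
    on the circle of radius r.\<close>
  define \<psi> where "\<psi> \<zeta> = of_real (norm (f (of_real r * \<zeta>)) powr (p - 1)) * cnj (sgn (f (of_real r * \<zeta>)))" for \<zeta>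
  have [measurable]: "cnj \<in> borel_measurable borel"
    by (intro borel_measurable_continuous_onI continuous_intros)
  have [measurable]: "\<psi> \<in> borel_measurable borel"
    unfolding \<psi>_def sgn_div_norm by measurable
  have npsi: "norm (\<psi> \<zeta>) = norm (f (of_real r * \<zeta>)) powr (p - 1)" for \<zeta>
  proof (cases "f (of_real r * \<zeta>) = 0")
    case True
    then show ?thesis by (simp add: \<psi>_def)
  next
    case False
    then have "norm (sgn (f (of_real r * \<zeta>))) = 1" by (simp add: norm_sgn)
    then show ?thesis by (simp add: \<psi>_def norm_mult)
  qed
  obtain B where B: "0 \<le> B" "AE \<zeta> in circle_measure. norm (f (of_real r * \<zeta>)) \<le> B"
  proof (rule AE_circle_bounded[OF f])
    show "0 \<le> r" "r < 1" using r by auto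
  qed
  define F where "F z = (\<integral>\<zeta>. f (z * \<zeta>) * \<psi> \<zeta> \<partial>circle_measure)" for z
  have F: "F holomorphic_on ball 0 1" unfolding F_def
  proof (rule holomorphic_dilation_integral[OF finite_measure_circle f, where B = "B powr (p - 1)"])
    show "AE \<zeta> in circle_measure. norm \<zeta> \<le> 1" using AE_circle_norm by eventually_elim simp
    show "AE \<zeta> in circle_measure. norm (\<psi> \<zeta>) \<le> B powr (p - 1)"
      using B(2) by eventually_elim (use p in \<open>auto simp: npsi intro!: powr_mono2\<close>)
  qed measurable
  have Fr: "F (of_real r) = of_real (circle_mean p f r)"
  proof -
    have "f w * (of_real (norm (f w) powr (p - 1)) * cnj (sgn (f w))) = of_real (norm (f w) powr p)" for w
    proof (cases "f w = 0")
      case False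
      have "f w * cnj (f w) = of_real ((norm (f w))^2)" by (rule complex_norm_square[symmetric])
      moreover have "cnj (sgn (f w)) = cnj (f w) / of_real (norm (f w))"
        by (simp add: sgn_eq)
      ultimately have "f w * cnj (sgn (f w)) = of_real (norm (f w))"
        using False by (simp add: power2_eq_square)
      then have "of_real (norm (f w) powr (p - 1)) * (f w * cnj (sgn (f w))) = complex_of_real (norm (f w) powr (p - 1) * norm (f w))"
        by simp
      then have "f w * (of_real (norm (f w) powr (p - 1)) * cnj (sgn (f w))) = complex_of_real (norm (f w) powr (p - 1) * norm (f w))"
        by (simp only: mult.left_commute)
      also have "norm (f w) powr (p - 1) * norm (f w) = norm (f w) powr p"
        using False powr_add[of "norm (f w)" "p - 1" 1] by simp
      finally show ?thesis .
    qed auto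
    then show ?thesis unfolding F_def \<psi>_def circle_mean_def by simp
  qed
  \<comment> \<open>Write z = R c with |c| = 1; the rotation by c does not change the circle mean,
    so the bound is uniform on |z| = R.\<close>
  have FR: "norm (F z) \<le> circle_mean p f R powr (1/p) * circle_mean p f r powr (1/p')" if z: "norm z = R" for z
  proof -
    define c where "c = z / of_real R"
    have R0: "R > 0" using rR r by simp
    have c: "norm c = 1" "z = of_real R * c" using z R0 by (auto simp: c_def norm_divide)
    have "ennreal (norm (F z)) \<le> (\<integral>\<^sup>+\<zeta>. ennreal (norm (f (z * \<zeta>) * \<psi> \<zeta>)) \<partial>circle_measure)"
      unfolding F_def by (rule norm_integral_le_nn_integral)
    also have "\<dots> = (\<integral>\<^sup>+\<zeta>. ennreal (norm (f (of_real R * (c * \<zeta>))) * norm (f (of_real r * \<zeta>)) powr (p - 1)) \<partial>circle_measure)"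
      by (simp add: norm_mult npsi c mult.assoc)
    also have "\<dots> \<le> ennreal (circle_mean p f R powr (1/p) * circle_mean p f r powr (1/p'))"
    proof (rule holder_nn_integral[OF p p'])
      show "(\<integral>\<^sup>+\<zeta>. ennreal (norm (f (of_real R * (c * \<zeta>))) powr p) \<partial>circle_measure) \<le> ennreal (circle_mean p f R)"
        using circle_mean_rotate[OF f, of R p c] r p c(1) by simp
      have "(\<integral>\<^sup>+\<zeta>. ennreal ((norm (f (of_real r * \<zeta>)) powr (p - 1)) powr p') \<partial>circle_measure)
        = (\<integral>\<^sup>+\<zeta>. ennreal (norm (f (of_real r * \<zeta>)) powr p) \<partial>circle_measure)"
        using p by (simp add: powr_powr p'_def)
      then show "(\<integral>\<^sup>+\<zeta>. ennreal ((norm (f (of_real r * \<zeta>)) powr (p - 1)) powr p') \<partial>circle_measure) \<le> ennreal (circle_mean p f r)"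
        using f r p by (simp add: nn_integral_circle_mean)
    qed auto
    finally show ?thesis by (simp add: ennreal_le_iff)
  qed
  have "norm (F (of_real r)) \<le> circle_mean p f R powr (1/p) * circle_mean p f r powr (1/p')"
  proof (rule maximum_modulus_frontier[of F "cball 0 R"])
    show "F holomorphic_on interior (cball 0 R)"
      using F r by (rule_tac holomorphic_on_subset) auto
    show "continuous_on (closure (cball 0 R)) F"
      using F r by (intro holomorphic_on_imp_continuous_on) (rule holomorphic_on_subset, auto)
    show "norm (F z) \<le> circle_mean p f R powr (1/p) * circle_mean p f r powr (1/p')" if "z \<in> frontier (cball 0 R)" for z
      using that rR r by (intro FR) (auto simp: frontier_cball)
  qed (use rR r in auto)
  then have "circle_mean p f r \<le> circle_mean p f R powr (1/p) * circle_mean p f r powr (1/p')"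
    by (simp add: Fr)
  moreover have "circle_mean p f r = circle_mean p f r powr (1/p) * circle_mean p f r powr (1/p')"
    using m p' by (simp add: powr_add[symmetric])
  ultimately have "circle_mean p f r powr (1/p) * circle_mean p f r powr (1/p') \<le> circle_mean p f R powr (1/p) * circle_mean p f r powr (1/p')"
    by linarith
  then have "circle_mean p f r powr (1/p) \<le> circle_mean p f R powr (1/p)" using m by simp
  then have "(circle_mean p f r powr (1/p)) powr p \<le> (circle_mean p f R powr (1/p)) powr p"
    using p by (rule_tac powr_mono2) simp_all
  moreover have "(circle_mean p f t powr (1/p)) powr p = circle_mean p f t" for t
    using p by (simp add: powr_powr)
  ultimately show ?thesis by (simp only:)
qed

section \<open>Powers of the Cauchy kernel on circles, and point evaluation\<close>

lemma sin_pi_lower_bound: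
  assumes "0 \<le> t" "t \<le> 1/2"
  shows "2 * t \<le> sin (pi * t)"
proof -
  have "convex_on {0..1/2} (\<lambda>t. - sin (pi * t))"
  proof (rule f''_ge0_imp_convex[where f' = "\<lambda>t. - (pi * cos (pi * t))" and f'' = "\<lambda>t. pi * (pi * sin (pi * t))"])
    show "0 \<le> pi * (pi * sin (pi * x))" if "x \<in> {0..1/2}" for x
      using that by (intro mult_nonneg_nonneg sin_ge_zero) auto
  qed (auto intro!: derivative_eq_intros)
  from convex_onD[OF this, of "2 * t" 0 "1/2"] assms show ?thesis by simp
qed

text \<open>The identity |1 - x e^(2 \<pi> i t)|^2 = (1 - x)^2 + 4 x sin(\<pi> t)^2 bounds the
  modulus below by 1 - x, and for x >= 1/4 also by twice the distance min t (1 - t). For x < 1/4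
  that distance, at most 1/2, is already below 1 - x.\<close>

lemma norm_one_minus_cis_lower_bound:
  assumes x: "0 \<le> x" "x < 1" and t: "0 \<le> t" "t \<le> 1"
  shows "(1 - x + min t (1 - t)) / 2 \<le> norm (1 - of_real x * cis (2 * pi * t))"
proof -
  let ?m = "min t (1 - t)" and ?n = "norm (1 - of_real x * cis (2 * pi * t))"
  have m: "0 \<le> ?m" "?m \<le> 1/2" using t by (auto simp: min_def)
  have "norm (of_real x * cis (2 * pi * t)) = x" using x by (simp add: norm_mult)
  then have n1: "1 - x \<le> ?n" using norm_triangle_ineq2[of 1 "of_real x * cis (2 * pi * t)"] by simp
  show ?thesis
  proof (cases "x < 1/4")
    case True
    have "(1 - x + a) / 2 \<le> b" if "1 - x \<le> b" "a \<le> 1/2" for a b using that True by (simp add: field_simps)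
    from this[OF n1 m(2)] show ?thesis .
  next
    case False
    have s: "sin (pi * t) = sin (pi * ?m)"
      by (auto simp: min_def algebra_simps sin_diff)
    have "?n\<^sup>2 = (1 - x * cos (2 * pi * t))\<^sup>2 + (x * sin (2 * pi * t))\<^sup>2"
      by (simp add: cmod_power2)
    also have "\<dots> = 1 - 2 * x * cos (2 * pi * t) + x\<^sup>2 * ((cos (2 * pi * t))\<^sup>2 + (sin (2 * pi * t))\<^sup>2)"
      unfolding power2_eq_square ring_distribs by simp
    also have "\<dots> = 1 - 2 * x * cos (2 * pi * t) + x\<^sup>2" by simp
    also have "cos (2 * pi * t) = 1 - 2 * (sin (pi * t))\<^sup>2"
      using cos_double_sin[of "pi * t"] by (simp add: mult.assoc)
    finally have n2: "?n\<^sup>2 = (1 - x)\<^sup>2 + 4 * x * (sin (pi * ?m))\<^sup>2"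
      unfolding s[symmetric] by (simp add: power2_eq_square algebra_simps)
    have "(2 * ?m)\<^sup>2 \<le> (sin (pi * ?m))\<^sup>2"
      using sin_pi_lower_bound[of ?m] m by (intro power_mono) auto
    also have "\<dots> \<le> 4 * x * (sin (pi * ?m))\<^sup>2"
      using False by (intro mult_right_mono[of 1 "4 * x", simplified]) auto
    also have "\<dots> \<le> ?n\<^sup>2" unfolding n2 by simp
    finally have n3: "2 * ?m \<le> ?n" by (rule power2_le_imp_le) simp
    have "(1 - x + a) / 2 \<le> b" if "1 - x \<le> b" "2 * a \<le> b" "0 \<le> a" for a b using that by (simp add: field_simps)
    from this[OF n1 n3 m(1)] show ?thesis .
  qed
qed

text \<open>By the preceding bound the integrand is at most 2^s (1 - x + min t (1 - t))^(-s). The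
  minimum is replaced by the sum of the two endpoint contributions, each of which integrates to at
  most (1 - x)^(1-s)/(s - 1).\<close>

lemma circle_kernel_bound:
  fixes s :: real
  assumes s: "1 < s"
  obtains C where "0 < C"
    "\<And>x. 0 \<le> x \<Longrightarrow> x < 1 \<Longrightarrow>
       (\<integral>\<^sup>+\<zeta>. ennreal (norm (1 - of_real x * \<zeta>) powr (- s)) \<partial>circle_measure) \<le> ennreal (C * (1 - x) powr (1 - s))"
proof -
  define C where "C = 2 powr s * (2 / (s - 1))"
  have "C > 0" using s by (simp add: C_def)
  moreover have "(\<integral>\<^sup>+\<zeta>. ennreal (norm (1 - of_real x * \<zeta>) powr (- s)) \<partial>circle_measure) \<le> ennreal (C * (1 - x) powr (1 - s))"
    if x: "0 \<le> x" "x < 1" for x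
  proof -
    define d where "d = 1 - x"
    have d: "d > 0" using x by (simp add: d_def)
    have "(\<integral>\<^sup>+\<zeta>. ennreal (norm (1 - of_real x * \<zeta>) powr (- s)) \<partial>circle_measure)
        = (\<integral>\<^sup>+t. ennreal (norm (1 - of_real x * cis (2 * pi * t)) powr (- s)) * indicator {0..1} t \<partial>lborel)"
      by (rule nn_integral_circle_measure) measurable
    also have "\<dots> \<le> (\<integral>\<^sup>+t. ennreal (2 powr s) * (ennreal ((d + t) powr (- s)) * indicator {0..1} t + ennreal ((d + 1 - t) powr (- s)) * indicator {0..1} t) \<partial>lborel)"
    proof (intro nn_integral_mono)
      fix t :: real
      show "ennreal (norm (1 - of_real x * cis (2 * pi * t)) powr (- s)) * indicator {0..1} t
        \<le> ennreal (2 powr s) * (ennreal ((d + t) powr (- s)) * indicator {0..1} t + ennreal ((d + 1 - t) powr (- s)) * indicator {0..1} t)"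
      proof (cases "t \<in> {0..1}")
        case t: True
        let ?m = "min t (1 - t)"
        have "norm (1 - of_real x * cis (2 * pi * t)) powr (- s) \<le> ((d + ?m) / 2) powr (- s)"
          using norm_one_minus_cis_lower_bound[OF x, of t] t d s by (intro powr_mono2') (auto simp: d_def)
        also have "\<dots> = 2 powr s * (d + ?m) powr (- s)"
          using d t by (simp add: powr_divide powr_minus_divide)
        also have "\<dots> \<le> 2 powr s * ((d + t) powr (- s) + (d + 1 - t) powr (- s))"
          by (intro mult_left_mono) (auto simp: min_def add_diff_eq)
        finally have "ennreal (norm (1 - of_real x * cis (2 * pi * t)) powr (- s))
            \<le> ennreal (2 powr s * ((d + t) powr (- s) + (d + 1 - t) powr (- s)))"
          by (rule ennreal_leI)
        also have "\<dots> = ennreal (2 powr s) * (ennreal ((d + t) powr (- s)) + ennreal ((d + 1 - t) powr (- s)))"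
          by (simp add: ennreal_mult ennreal_plus)
        finally show ?thesis using t by simp
      qed simp
    qed
    also have "\<dots> = ennreal (2 powr s) * ((\<integral>\<^sup>+t. ennreal ((d + t) powr (- s)) * indicator {0..1} t \<partial>lborel)
        + (\<integral>\<^sup>+t. ennreal ((d + 1 - t) powr (- s)) * indicator {0..1} t \<partial>lborel))"
      by (simp add: nn_integral_cmult nn_integral_add)
    also have "(\<integral>\<^sup>+t. ennreal ((d + t) powr (- s)) * indicator {0..1} t \<partial>lborel)
        = ennreal ((d + 1) powr (1 - s) / (1 - s) - (d + 0) powr (1 - s) / (1 - s))"
      by (rule nn_integral_FTC_Icc[where F = "\<lambda>t. (d + t) powr (1 - s) / (1 - s)"])
         (use d s in \<open>auto intro!: derivative_eq_intros\<close>)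
    also have "(\<integral>\<^sup>+t. ennreal ((d + 1 - t) powr (- s)) * indicator {0..1} t \<partial>lborel)
        = ennreal (- ((d + 1 - 1) powr (1 - s) / (1 - s)) - - ((d + 1 - 0) powr (1 - s) / (1 - s)))"
      by (rule nn_integral_FTC_Icc[where F = "\<lambda>t. - ((d + 1 - t) powr (1 - s) / (1 - s))"])
         (use d s in \<open>auto intro!: derivative_eq_intros\<close>)
    also have "ennreal (2 powr s) * (ennreal ((d + 1) powr (1 - s) / (1 - s) - (d + 0) powr (1 - s) / (1 - s))
        + ennreal (- ((d + 1 - 1) powr (1 - s) / (1 - s)) - - ((d + 1 - 0) powr (1 - s) / (1 - s))))
       \<le> ennreal (2 powr s) * (ennreal (d powr (1 - s) / (s - 1)) + ennreal (d powr (1 - s) / (s - 1)))"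
    proof -
      have 1: "a / (1 - s) - b / (1 - s) \<le> b / (s - 1)" if "0 \<le> a" for a b :: real
      proof -
        have "a / (1 - s) - b / (1 - s) = (b - a) / (s - 1)"
          using s by (simp add: divide_simps) (simp add: algebra_simps)
        also have "\<dots> \<le> b / (s - 1)" using s that by (intro divide_right_mono) auto
        finally show ?thesis .
      qed
      show ?thesis
        using 1[of "(d + 1) powr (1 - s)" "d powr (1 - s)"]
        by (intro mult_left_mono add_mono ennreal_leI) auto
    qed
    also have "\<dots> = ennreal (C * (1 - x) powr (1 - s))"
      using s by (simp add: C_def d_def ennreal_mult[symmetric] ennreal_plus[symmetric] del: ennreal_plus)
    finally show ?thesis .
  qed
  ultimately show ?thesis using that by blast
qed

text \<open>Cauchy's integral formula on the circle of radius R. For |e| = 1 the difference R e - x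
  equals R e times the conjugate of 1 - (x/R) e, which puts the kernel into the form estimated
  above.\<close>

lemma disc_point_evaluation:
  assumes f: "disc_holomorphic f" and x: "0 \<le> x" "x < R" "R < 1"
  shows "ennreal (norm (f (of_real x))) \<le> (\<integral>\<^sup>+\<zeta>. ennreal (norm (f (of_real R * \<zeta>)) * norm (1 - of_real (x / R) * \<zeta>) powr (- 1)) \<partial>circle_measure)"
proof -
  have [measurable]: "f \<in> borel_measurable borel" using f by (simp add: disc_holomorphic_def)
  have R: "R > 0" using x by simp
  define e where "e t = exp (2 * of_real pi * \<i> * of_real t)" for t :: real
  have ecis: "e t = cis (2 * pi * t)" for t by (simp add: e_def cis_conv_exp mult_ac)
  have "((\<lambda>u. f u / (u - of_real x)) has_contour_integral (2 * of_real pi * \<i> * f (of_real x))) (circlepath 0 R)"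
    using f x by (intro Cauchy_integral_circlepath_simple) (auto simp: disc_holomorphic_def intro: holomorphic_on_subset)
  then have "((\<lambda>t. f (circlepath 0 R t) / (circlepath 0 R t - of_real x) * vector_derivative (circlepath 0 R) (at t within {0..1}))
      has_integral (2 * of_real pi * \<i> * f (of_real x))) {0..1}"
    unfolding has_contour_integral_def .
  moreover have "f (circlepath 0 R t) / (circlepath 0 R t - of_real x) * vector_derivative (circlepath 0 R) (at t within {0..1})
      = (2 * of_real pi * \<i>) * (f (of_real R * e t) * (of_real R * e t / (of_real R * e t - of_real x)))" if "t \<in> {0..1}" for t
  proof -
    have vd: "vector_derivative (circlepath 0 R) (at t within {0..1}) = 2 * pi * \<i> * R * exp (2 * of_real pi * \<i> * t)"
      using that by (simp add: vector_derivative_circlepath01)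
    show ?thesis by (subst vd) (simp add: circlepath e_def)
  qed
  ultimately have "((\<lambda>t. (2 * of_real pi * \<i>) * (f (of_real R * e t) * (of_real R * e t / (of_real R * e t - of_real x))))
      has_integral (2 * of_real pi * \<i> * f (of_real x))) {0..1}"
    by (rule has_integral_eq[rotated])
  from has_integral_mult_right[OF this, of "1 / (2 * of_real pi * \<i>)"]
  have hi: "((\<lambda>t. f (of_real R * e t) * (of_real R * e t / (of_real R * e t - of_real x))) has_integral f (of_real x)) {0..1}"
    by simp
  have nrm: "norm (of_real R * e t / (of_real R * e t - of_real x)) = norm (1 - of_real (x / R) * e t) powr (- 1)" for t
  proof -
    have ne: "norm (e t) = 1" "e t \<noteq> 0" by (simp_all add: ecis)
    have "cnj (e t) * e t = 1" using complex_norm_square[of "e t"] ne by (simp add: mult.commute)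
    then have "of_real R * e t - of_real x = of_real R * e t * cnj (1 - of_real (x / R) * e t)"
      using R by (simp add: algebra_simps)
    then have "norm (of_real R * e t - of_real x) = R * norm (1 - of_real (x / R) * e t)"
      using R ne by (simp add: norm_mult del: complex_cnj_diff complex_cnj_mult)
    then show ?thesis using R ne by (simp add: norm_divide norm_mult powr_minus_divide)
  qed
  let ?g = "\<lambda>t. norm (f (of_real R * e t)) * norm (1 - of_real (x / R) * e t) powr (- 1)"
  have cont: "continuous_on {0..1} ?g"
  proof (intro continuous_intros)
    show "continuous_on {0..1} (\<lambda>t. f (of_real R * e t))"
    proof (rule continuous_on_compose2[of "cball 0 R" f])
      show "continuous_on (cball 0 R) f"
        using f x by (intro holomorphic_on_imp_continuous_on) (auto simp: disc_holomorphic_def intro: holomorphic_on_subset)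
      show "continuous_on {0..1} (\<lambda>t. of_real R * e t)" unfolding e_def by (intro continuous_intros)
    qed (use R in \<open>auto simp: norm_mult ecis\<close>)
    show "continuous_on {0..1} e" unfolding e_def by (intro continuous_intros)
    show "\<forall>t\<in>{0..1}. norm (1 - of_real (x / R) * e t) \<noteq> 0"
    proof
      fix t :: real
      have "norm (of_real (x / R) * e t) < 1"
        unfolding norm_mult norm_of_real ecis norm_cis using x R by simp
      then show "norm (1 - of_real (x / R) * e t) \<noteq> 0" by auto
    qed
  qed
  then have gi: "?g integrable_on {0..1}" by (rule integrable_continuous_real)
  have "norm (integral {0..1} (\<lambda>t. f (of_real R * e t) * (of_real R * e t / (of_real R * e t - of_real x)))) \<le> integral {0..1} ?g"
  proof (rule integral_norm_bound_integral[OF _ gi])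
    show "(\<lambda>t. f (of_real R * e t) * (of_real R * e t / (of_real R * e t - of_real x))) integrable_on {0..1}"
      using hi by blast
    show "norm (f (of_real R * e t) * (of_real R * e t / (of_real R * e t - of_real x))) \<le> ?g t" for t
      unfolding norm_mult nrm[symmetric] by simp
  qed
  then have "norm (f (of_real x)) \<le> integral {0..1} ?g" using hi by (simp add: integral_unique)
  then have "ennreal (norm (f (of_real x))) \<le> ennreal (integral {0..1} ?g)" by (rule ennreal_leI)
  also have "\<dots> = (\<integral>\<^sup>+t. ennreal (indicator {0..1} t * ?g t) \<partial>lborel)"
    using nn_integral_has_integral_lebesgue[of "{0..1}" ?g, OF _ integrable_integral[OF gi]] by simp
  also have "\<dots> = (\<integral>\<^sup>+t. ennreal (norm (f (of_real R * cis (2 * pi * t))) * norm (1 - of_real (x / R) * cis (2 * pi * t)) powr (- 1)) * indicator {0..1} t \<partial>lborel)"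
    by (intro nn_integral_cong) (auto simp: ecis split: split_indicator)
  also have "\<dots> = (\<integral>\<^sup>+\<zeta>. ennreal (norm (f (of_real R * \<zeta>)) * norm (1 - of_real (x / R) * \<zeta>) powr (- 1)) \<partial>circle_measure)"
    by (rule nn_integral_circle_measure[symmetric]) measurable
  finally show ?thesis .
qed

text \<open>Hoelder's inequality in Cauchy's formula: the q'-norm of the kernel, raised to the power
  q, contributes (1 - x/R)^(-1), because (1 - q') q/q' = -1.\<close>

lemma disc_point_growth:
  assumes q: "1 < q"
  obtains C where "0 < C"
    "\<And>f x R. disc_holomorphic f \<Longrightarrow> 0 \<le> x \<Longrightarrow> x < R \<Longrightarrow> R < 1 \<Longrightarrow>
       norm (f (of_real x)) powr q * (1 - x / R) \<le> C * circle_mean q f R"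
proof -
  define q' where "q' = q / (q - 1)"
  have q': "1 < q'" "1/q + 1/q' = 1" using q by (auto simp: q'_def field_simps)
  obtain C where C: "0 < C" "\<And>x. 0 \<le> x \<Longrightarrow> x < 1 \<Longrightarrow>
       (\<integral>\<^sup>+\<zeta>. ennreal (norm (1 - of_real x * \<zeta>) powr (- q')) \<partial>circle_measure) \<le> ennreal (C * (1 - x) powr (1 - q'))"
    using circle_kernel_bound[OF q'(1)] by blast
  have "norm (f (of_real x)) powr q * (1 - x / R) \<le> C powr (q / q') * circle_mean q f R"
    if f: "disc_holomorphic f" and x: "0 \<le> x" "x < R" "R < 1" for f x R
  proof -
    have [measurable]: "f \<in> borel_measurable borel" using f by (simp add: disc_holomorphic_def)
    have y: "0 \<le> x / R" "x / R < 1" using x by auto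
    let ?K = "C * (1 - x / R) powr (1 - q')"
    have K: "0 \<le> ?K" using C by simp
    have eq: "(a powr (- 1)) powr q' = a powr (- q')" for a :: real
      unfolding powr_powr by simp
    have "ennreal (norm (f (of_real x))) \<le> (\<integral>\<^sup>+\<zeta>. ennreal (norm (f (of_real R * \<zeta>)) * norm (1 - of_real (x / R) * \<zeta>) powr (- 1)) \<partial>circle_measure)"
      by (rule disc_point_evaluation[OF f x])
    also have "\<dots> \<le> ennreal (circle_mean q f R powr (1/q) * ?K powr (1/q'))"
    proof (rule holder_nn_integral[OF q q'])
      show "(\<integral>\<^sup>+\<zeta>. ennreal (norm (f (of_real R * \<zeta>)) powr q) \<partial>circle_measure) \<le> ennreal (circle_mean q f R)"
        using nn_integral_circle_mean[OF f, of R q] x q by simp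
      show "(\<integral>\<^sup>+\<zeta>. ennreal ((norm (1 - of_real (x / R) * \<zeta>) powr (- 1)) powr q') \<partial>circle_measure) \<le> ennreal ?K"
        unfolding eq by (rule C(2)[OF y])
    qed (use K in auto)
    finally have "norm (f (of_real x)) \<le> circle_mean q f R powr (1/q) * ?K powr (1/q')" by (simp add: ennreal_le_iff)
    then have "norm (f (of_real x)) powr q \<le> (circle_mean q f R powr (1/q) * ?K powr (1/q')) powr q"
      using q by (intro powr_mono2) auto
    also have "\<dots> = circle_mean q f R * ?K powr (q / q')"
      using q by (simp add: powr_mult powr_powr)
    also have "?K powr (q / q') = C powr (q / q') * (1 - x / R) powr ((1 - q') * (q / q'))"
      using C y by (simp add: powr_mult powr_powr)
    also have "(1 - q') * (q / q') = - 1" using q by (simp add: q'_def field_simps)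
    finally have "norm (f (of_real x)) powr q * (1 - x / R) \<le> circle_mean q f R * (C powr (q / q') * (1 - x / R) powr (- 1)) * (1 - x / R)"
      using y by (intro mult_right_mono) auto
    also have "\<dots> = C powr (q / q') * circle_mean q f R * ((1 - x / R) powr (- 1) * (1 - x / R))" by (simp only: mult_ac)
    also have "(1 - x / R) powr (- 1) * (1 - x / R) = 1"
    proof -
      have "u powr (- 1) * u = 1" if "u > 0" for u :: real using that by (simp add: powr_minus_divide)
      moreover have "1 - x / R > 0" using y by linarith
      ultimately show ?thesis by blast
    qed
    also have "C powr (q / q') * circle_mean q f R * 1 = C powr (q / q') * circle_mean q f R" by simp
    finally show ?thesis .
  qed
  then show ?thesis using that[of "C powr (q / q')"] C by simp
qed

section \<open>Dyadic decomposition of the unit interval\<close>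

definition dyadic_radius :: "nat \<Rightarrow> real" where
  "dyadic_radius k = 1 - (1/2) ^ k"

definition dyadic_tail :: "real measure \<Rightarrow> nat \<Rightarrow> real" where
  "dyadic_tail N k = measure N {dyadic_radius k..<1}"

text \<open>The shift by one puts \<open>n = 0\<close> into block \<open>0\<close>, whose radius is \<open>0\<close>.\<close>

definition dyadic_block :: "nat \<Rightarrow> nat set" where
  "dyadic_block k = {2 ^ k - 1..<2 ^ Suc k - 1}"

lemma dyadic_radius_0 [simp]: "dyadic_radius 0 = 0"
  by (simp add: dyadic_radius_def)

lemma dyadic_radius_Suc: "dyadic_radius (Suc k) = (1 + dyadic_radius k) / 2"
  by (simp add: dyadic_radius_def field_simps)

lemma dyadic_radius_bounds [simp]: "0 \<le> dyadic_radius k" "dyadic_radius k < 1"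
  by (auto simp: dyadic_radius_def power_le_one)

lemma dyadic_radius_mono: "j \<le> k \<Longrightarrow> dyadic_radius j \<le> dyadic_radius k"
  by (auto simp: dyadic_radius_def intro: power_decreasing)

lemma dyadic_radius_less_iff [simp]: "dyadic_radius j < dyadic_radius k \<longleftrightarrow> j < k"
  unfolding dyadic_radius_def by (simp add: power_strict_decreasing_iff)

lemma dyadic_radius_exceeds:
  assumes "r < 1"
  shows "\<exists>k. r < dyadic_radius k"
proof -
  obtain k where "(1/2::real) ^ k < 1 - r" using real_arch_pow_inv[of "1 - r" "1/2"] assms by auto
  then show ?thesis unfolding dyadic_radius_def by (intro exI[of _ k]) linarith
qed

lemma dyadic_radius_cover:
  assumes "0 \<le> r" "r < 1"
  obtains k where "dyadic_radius k \<le> r" "r < dyadic_radius (Suc k)"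
proof -
  define j where "j = (LEAST j. r < dyadic_radius j)"
  have j: "r < dyadic_radius j" unfolding j_def by (rule LeastI_ex[OF dyadic_radius_exceeds[OF assms(2)]])
  with assms have "j \<noteq> 0" by (intro notI) simp
  then obtain k where k: "j = Suc k" by (cases j) auto
  have "\<not> r < dyadic_radius k" unfolding j_def using k not_less_Least[of k "\<lambda>j. r < dyadic_radius j"] by (simp add: j_def)
  then show ?thesis using that[of k] j k by simp
qed

lemma card_dyadic_block: "card (dyadic_block k) = 2 ^ k"
  by (simp add: dyadic_block_def)

lemma finite_dyadic_block [simp]: "finite (dyadic_block k)"
  by (simp add: dyadic_block_def)

lemma dyadic_block_iff: "n \<in> dyadic_block k \<longleftrightarrow> 2 ^ k \<le> n + 1 \<and> n + 1 < 2 ^ Suc k"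
  by (auto simp: dyadic_block_def)

lemma sum_dyadic_blocks:
  fixes f :: "nat \<Rightarrow> 'a::comm_monoid_add"
  shows "(\<Sum>n<2 ^ K - 1. f n) = (\<Sum>k<K. \<Sum>n\<in>dyadic_block k. f n)"
proof (induction K)
  case (Suc K)
  have "(\<Sum>n<2 ^ Suc K - 1. f n) = (\<Sum>n\<in>{0..<2 ^ K - 1}. f n) + (\<Sum>n\<in>{2 ^ K - 1..<2 ^ Suc K - 1}. f n)"
    unfolding lessThan_atLeast0 by (rule sum.atLeastLessThan_concat[symmetric]) auto
  then show ?case using Suc by (simp add: dyadic_block_def lessThan_atLeast0)
qed simp

text \<open>With n = 2^k - 1 the radius is 1/(1 + 1/n), and (1 + 1/n)^n <= e. The exponent 2^k - 1
  also covers k = 0, where the radius is 0 and 0^0 = 1.\<close>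

lemma dyadic_radius_power_lower: "exp (- 1) \<le> dyadic_radius k ^ (2 ^ k - 1)"
proof (cases k)
  case 0 then show ?thesis by simp
next
  case (Suc j)
  define n :: nat where "n = 2 ^ k - 1"
  have n: "n > 0" using Suc one_less_power[of "2::nat" k] by (simp add: n_def)
  have nk: "real n + 1 = 2 ^ k" by (simp add: n_def)
  have "dyadic_radius k = 1 - 1 / (real n + 1)" unfolding nk dyadic_radius_def by (simp add: power_divide)
  also have "\<dots> = 1 / (1 + 1 / real n)" using n by (simp add: field_simps)
  finally have d: "dyadic_radius k = 1 / (1 + 1 / real n)" .
  have "1 + 1 / real n \<le> exp (1 / real n)" by (rule exp_ge_add_one_self)
  then have "(1 + 1 / real n) ^ n \<le> exp (1 / real n) ^ n" by (intro power_mono) auto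
  also have "\<dots> = exp 1" using n by (simp add: exp_of_nat_mult[symmetric])
  finally have "1 / exp 1 \<le> 1 / (1 + 1 / real n) ^ n"
    by (intro divide_left_mono) (auto intro!: mult_pos_pos zero_less_power add_pos_nonneg)
  then show ?thesis unfolding d n_def[symmetric] by (simp add: exp_minus power_divide inverse_eq_divide)
qed

lemma dyadic_radius_power_lower2:
  assumes "n + 1 < 2 ^ Suc k"
  shows "exp (- 2) \<le> dyadic_radius k ^ n"
proof -
  have "exp (- 2) = exp (- 1) * exp (- (1::real))" by (simp add: exp_add[symmetric])
  also have "\<dots> \<le> dyadic_radius k ^ (2 ^ k - 1) * dyadic_radius k ^ (2 ^ k - 1)"
    by (intro mult_mono dyadic_radius_power_lower) auto
  also have "\<dots> = dyadic_radius k ^ (2 * (2 ^ k - 1))" by (simp add: power_add[symmetric] mult_2)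
  also have "\<dots> \<le> dyadic_radius k ^ n" using assms by (intro power_decreasing) (auto simp: less_imp_le)
  finally show ?thesis .
qed

text \<open>From 1 - x <= e^(-x) with x = 2^(-j-1) and n >= 2^k - 1. The factor e pays for the 1
  missing in 2^k - 1.\<close>

lemma dyadic_radius_power_upper:
  assumes "2 ^ k \<le> n + 1"
  shows "dyadic_radius (Suc j) ^ n \<le> exp 1 * exp (- (1/2 * 2 ^ k / 2 ^ j))"
proof -
  have "dyadic_radius (Suc j) \<le> exp (- ((1/2) ^ Suc j))"
    using exp_ge_add_one_self[of "- ((1/2) ^ Suc j) :: real"] by (simp add: dyadic_radius_def)
  then have "dyadic_radius (Suc j) ^ n \<le> exp (- ((1/2) ^ Suc j)) ^ n" by (intro power_mono) auto
  also have "\<dots> = exp (- (real n * (1/2) ^ Suc j))" by (simp add: exp_of_nat_mult[symmetric])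
  also have "\<dots> \<le> exp (1 - 1/2 * 2 ^ k / 2 ^ j)"
  proof -
    have "(2 ^ k - 1) * (1/2) ^ Suc j \<le> real n * (1/2::real) ^ Suc j"
    proof (intro mult_right_mono)
      have "real (2 ^ k) \<le> real (n + 1)" using assms by (rule of_nat_mono)
      then show "2 ^ k - 1 \<le> real n" by simp
    qed simp
    moreover have "(2 ^ k - 1) * (1/2::real) ^ Suc j = 1/2 * 2 ^ k / 2 ^ j - (1/2) ^ Suc j"
      unfolding left_diff_distrib by (simp add: power_divide)
    moreover have "(1/2::real) ^ Suc j \<le> 1" by (rule power_le_one) auto
    ultimately show ?thesis by (subst exp_le_cancel_iff) linarith
  qed
  also have "\<dots> = exp 1 * exp (- (1/2 * 2 ^ k / 2 ^ j))" by (simp add: exp_add[symmetric])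
  finally show ?thesis .
qed

text \<open>One Taylor term of the exponential, of degree M with 2^M > C, gives a geometric
  majorant. In the applications C^i is the growth that doubling permits over i levels.\<close>

lemma summable_power_exp_dyadic:
  fixes C c :: real
  assumes c: "0 < c" and C: "0 \<le> C"
  shows "summable (\<lambda>i. C ^ i * exp (- (c * 2 ^ i)))"
proof -
  obtain M :: nat where M: "C < 2 ^ M" using real_arch_pow[of 2 C] by auto
  have "M > 0 \<or> C < 1" using M by (cases M) auto
  have "summable (\<lambda>i. fact M / c ^ M * (C / 2 ^ M) ^ i)"
    using M C by (intro summable_mult summable_geometric) auto
  then show ?thesis
  proof (rule summable_comparison_test'[where N = 0])
    fix i :: nat
    define x where "x = c * 2 ^ i"
    have x: "x > 0" using c by (simp add: x_def)
    have "x ^ M / fact M \<le> exp x"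
    proof -
      have "(\<Sum>n\<in>{M}. x ^ n /\<^sub>R fact n) \<le> (\<Sum>n. x ^ n /\<^sub>R fact n)"
        by (rule sum_le_suminf[OF summable_exp_generic]) (use x in auto)
      then show ?thesis by (simp add: exp_def divide_inverse mult.commute)
    qed
    then have "exp (- x) \<le> fact M / x ^ M"
      using x by (simp add: exp_minus field_simps)
    then have "C ^ i * exp (- x) \<le> C ^ i * (fact M / x ^ M)" using C by (intro mult_left_mono) auto
    also have "\<dots> = fact M / c ^ M * (C / 2 ^ M) ^ i"
      by (simp add: x_def power_mult_distrib power_divide power_mult[symmetric] mult.commute)
    finally show "norm (C ^ i * exp (- (c * 2 ^ i))) \<le> fact M / c ^ M * (C / 2 ^ M) ^ i"
      using C by (simp add: x_def)
  qed
qed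

section \<open>Tails and moments of measures on the unit interval\<close>

lemma dyadic_tail_antimono:
  assumes "unit_interval_measure N" "j \<le> k"
  shows "dyadic_tail N k \<le> dyadic_tail N j"
proof -
  interpret finite_measure N using assms by (simp add: unit_interval_measure_def)
  show ?thesis unfolding dyadic_tail_def
    using assms dyadic_radius_mono[OF assms(2)]
    by (intro finite_measure_mono) (auto simp: unit_interval_measure_def)
qed

lemma dyadic_tail_nonneg [simp]: "0 \<le> dyadic_tail N k"
  by (simp add: dyadic_tail_def)

lemma integrable_unit_interval_power:
  assumes "unit_interval_measure N"
  shows "integrable N (\<lambda>r. r ^ n)"
proof -
  interpret finite_measure N using assms by (simp add: unit_interval_measure_def)
  have [measurable_cong]: "sets N = sets borel" using assms by (simp add: unit_interval_measure_def)
  have "AE r in N. r \<in> {0..<1}" using assms by (simp add: unit_interval_measure_def)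
  then have "AE r in N. norm (r ^ n) \<le> 1"
    by eventually_elim (simp add: power_le_one)
  then show ?thesis by (rule integrable_const_bound) measurable
qed

lemma moment_antimono:
  assumes N: "unit_interval_measure N" and "m \<le> n"
  shows "(\<integral>r. r ^ n \<partial>N) \<le> (\<integral>r. r ^ m \<partial>N)"
proof (rule integral_mono_AE[OF integrable_unit_interval_power[OF N] integrable_unit_interval_power[OF N]])
  have "AE r in N. r \<in> {0..<1}" using N by (simp add: unit_interval_measure_def)
  then show "AE r in N. r ^ n \<le> r ^ m"
    by eventually_elim (use assms in \<open>auto intro!: power_decreasing\<close>)
qed

text \<open>On [r_k, 1) the power r^n is at least e^(-2) for all n up to the end of block k. This
  half of the comparison holds for \<mu> as well as for the weights.\<close>

lemma moment_lower_bound: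
  assumes N: "unit_interval_measure N" and n: "n + 1 < 2 ^ Suc k"
  shows "exp (- 2) * dyadic_tail N k \<le> (\<integral>r. r ^ n \<partial>N)"
proof -
  interpret finite_measure N using N by (simp add: unit_interval_measure_def)
  have [measurable_cong]: "sets N = sets borel" using N by (simp add: unit_interval_measure_def)
  have sp: "space N = UNIV" using sets_eq_imp_space_eq[of N borel] N by (simp add: unit_interval_measure_def)
  have "exp (- 2) * dyadic_tail N k = (\<integral>r. exp (- 2) * indicator {dyadic_radius k..<1} r \<partial>N)"
    by (simp add: dyadic_tail_def sp)
  also have "\<dots> \<le> (\<integral>r. r ^ n \<partial>N)"
  proof (rule integral_mono_AE[OF _ integrable_unit_interval_power[OF N]])
    show "integrable N (\<lambda>r. exp (- 2) * indicator {dyadic_radius k..<1} r :: real)"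
      by (intro integrable_mult_right integrable_real_indicator) (auto simp: less_top[symmetric])
    have "AE r in N. r \<in> {0..<1}" using N by (simp add: unit_interval_measure_def)
    then show "AE r in N. exp (- 2) * indicator {dyadic_radius k..<1} r \<le> r ^ n"
    proof eventually_elim
      case (elim r)
      show ?case
      proof (cases "dyadic_radius k \<le> r")
        case True
        have "exp (- 2) \<le> dyadic_radius k ^ n" by (rule dyadic_radius_power_lower2[OF n])
        also have "\<dots> \<le> r ^ n" using True by (intro power_mono) auto
        finally show ?thesis using True elim by simp
      qed (use elim in auto)
    qed
  qed
  finally show ?thesis .
qed

lemma dyadic_tail_doubling_iterate:
  assumes "\<And>k. \<tau> k \<le> C * \<tau> (Suc k)" "0 \<le> C"
  shows "\<tau> j \<le> C ^ i * (\<tau> (j + i) :: real)"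
proof (induction i)
  case (Suc i)
  have "C ^ i * \<tau> (j + i) \<le> C ^ i * (C * \<tau> (Suc (j + i)))"
    using assms by (intro mult_left_mono) auto
  with Suc show ?case by (simp add: mult_ac)
qed simp

text \<open>r^n is majorized by a step function: 1 beyond r_k, and on level j < k a bound that
  decays doubly exponentially in k - j. Its integral is a sum of tails; the factor C^(k-j) by which
  the tail at j may exceed the tail at k is beaten by that decay. D depends on C only.\<close>

lemma moment_upper_bound:
  fixes C :: real
  assumes C: "0 \<le> C"
  obtains D where "0 < D"
    "\<And>N n k. unit_interval_measure N \<Longrightarrow> (\<And>k. dyadic_tail N k \<le> C * dyadic_tail N (Suc k)) \<Longrightarrow> 2 ^ k \<le> n + 1 \<Longrightarrow>
       (\<integral>r. r ^ n \<partial>N) \<le> D * dyadic_tail N k"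
proof -
  define a where "a i = C ^ i * exp (- (1/2 * 2 ^ i))" for i
  have a: "summable a" "\<And>i. 0 \<le> a i"
    unfolding a_def using summable_power_exp_dyadic[of "1/2" C] C by auto
  define D where "D = 1 + exp 1 * suminf a"
  have "0 \<le> suminf a" using a by (intro suminf_nonneg) auto
  then have "D > 0" unfolding D_def by (intro add_pos_nonneg) auto
  moreover have "(\<integral>r. r ^ n \<partial>N) \<le> D * dyadic_tail N k"
    if N: "unit_interval_measure N" and d: "\<And>k. dyadic_tail N k \<le> C * dyadic_tail N (Suc k)" and n: "2 ^ k \<le> n + 1" for N n k
  proof -
    interpret finite_measure N using N by (simp add: unit_interval_measure_def)
    have [measurable_cong]: "sets N = sets borel" using N by (simp add: unit_interval_measure_def)
    have sp: "space N = UNIV" using sets_eq_imp_space_eq[of N borel] N by (simp add: unit_interval_measure_def)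
    let ?e = "\<lambda>j. exp 1 * exp (- (1/2 * 2 ^ k / 2 ^ j)) :: real"
    let ?g = "\<lambda>r. indicator {dyadic_radius k..<1} r + (\<Sum>j<k. ?e j * indicator {dyadic_radius j..<1} r) :: real"
    have int: "integrable N (indicator {dyadic_radius j..<1} :: real \<Rightarrow> real)" for j
      by (intro integrable_real_indicator) (auto simp: less_top[symmetric])
    have tail_int: "(\<integral>r. indicator {dyadic_radius j..<1} r \<partial>N) = dyadic_tail N j" for j
      by (simp add: dyadic_tail_def sp)
    have "(\<integral>r. r ^ n \<partial>N) \<le> (\<integral>r. ?g r \<partial>N)"
    proof (rule integral_mono_AE[OF integrable_unit_interval_power[OF N]])
      show "integrable N ?g"
        by (intro Bochner_Integration.integrable_add Bochner_Integration.integrable_sum integrable_mult_right int)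
      have "AE r in N. r \<in> {0..<1}" using N by (simp add: unit_interval_measure_def)
      then show "AE r in N. r ^ n \<le> ?g r"
      proof eventually_elim
        case (elim r)
        then obtain j where j: "dyadic_radius j \<le> r" "r < dyadic_radius (Suc j)"
          using dyadic_radius_cover[of r] by auto
        show ?case
        proof (cases "j < k")
          case True
          have "r ^ n \<le> dyadic_radius (Suc j) ^ n" using j elim by (intro power_mono) auto
          also have "\<dots> \<le> ?e j" by (rule dyadic_radius_power_upper[OF n])
          also have "\<dots> = ?e j * indicator {dyadic_radius j..<1} r" using j elim by simp
          also have "\<dots> \<le> (\<Sum>j<k. ?e j * indicator {dyadic_radius j..<1} r)"
            using True by (intro member_le_sum) auto
          also have "\<dots> \<le> ?g r" by simp
          finally show ?thesis .
        next
          case False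
          have "r ^ n \<le> 1" using elim by (intro power_le_one) auto
          also have "1 = (indicator {dyadic_radius k..<1} r :: real)"
            using False j elim dyadic_radius_mono[of k j] by simp
          also have "\<dots> \<le> ?g r" by (simp add: sum_nonneg)
          finally show ?thesis .
        qed
      qed
    qed
    also have "(\<integral>r. ?g r \<partial>N) = (\<integral>r. indicator {dyadic_radius k..<1} r \<partial>N) + (\<integral>r. (\<Sum>j<k. ?e j * indicator {dyadic_radius j..<1} r) \<partial>N)"
      by (intro Bochner_Integration.integral_add Bochner_Integration.integrable_sum integrable_mult_right int)
    also have "(\<integral>r. (\<Sum>j<k. ?e j * indicator {dyadic_radius j..<1} r) \<partial>N) = (\<Sum>j<k. \<integral>r. ?e j * indicator {dyadic_radius j..<1} r \<partial>N)"
      by (intro Bochner_Integration.integral_sum integrable_mult_right int)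
    also have "\<dots> = (\<Sum>j<k. ?e j * dyadic_tail N j)"
      unfolding integral_mult_right_zero by (simp only: tail_int)
    also have "(\<integral>r. indicator {dyadic_radius k..<1} r \<partial>N) = dyadic_tail N k"
      by (rule tail_int)
    also have "(\<Sum>j<k. ?e j * dyadic_tail N j) \<le> (\<Sum>j<k. exp 1 * (a (k - j) * dyadic_tail N k))"
    proof (intro sum_mono)
      fix j assume "j \<in> {..<k}"
      then have jk: "j \<le> k" by simp
      have "(2::real) ^ k / 2 ^ j = 2 ^ (k - j)" using jk by (simp add: power_diff)
      then have e: "?e j = exp 1 * exp (- (1/2 * 2 ^ (k - j)))" by simp
      have "dyadic_tail N j \<le> C ^ (k - j) * dyadic_tail N (j + (k - j))"
        by (rule dyadic_tail_doubling_iterate[where \<tau> = "dyadic_tail N", OF d C])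
      then have "?e j * dyadic_tail N j \<le> ?e j * (C ^ (k - j) * dyadic_tail N k)"
        using jk by (intro mult_left_mono) auto
      also have "\<dots> = exp 1 * (a (k - j) * dyadic_tail N k)" unfolding e a_def by (simp only: mult_ac)
      finally show "?e j * dyadic_tail N j \<le> exp 1 * (a (k - j) * dyadic_tail N k)" .
    qed
    also have "\<dots> = exp 1 * (\<Sum>j<k. a (k - j)) * dyadic_tail N k"
      by (simp add: sum_distrib_left sum_distrib_right mult_ac)
    also have "\<dots> \<le> exp 1 * suminf a * dyadic_tail N k"
    proof (intro mult_right_mono mult_left_mono)
      have "(\<Sum>j<k. a (k - j)) = (\<Sum>i\<in>(\<lambda>j. k - j) ` {..<k}. a i)"
        by (subst sum.reindex) (auto simp: inj_on_def)
      also have "\<dots> \<le> suminf a" using a by (intro sum_le_suminf) auto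
      finally show "(\<Sum>j<k. a (k - j)) \<le> suminf a" .
    qed auto
    finally show ?thesis by (simp add: D_def algebra_simps)
  qed
  ultimately show ?thesis using that by blast
qed

text \<open>By halving, the window of m levels starting at \<open>Suc k\<close> carries at least
  half of the tail at \<open>Suc k\<close>, and on it the increasing function h is at least its
  value at the left end. Each radius lies in at most m windows. The constant collects 2 from
  halving, C from the step k to k + 1, and m from the overlap; starting at \<open>Suc k\<close>
  ensures r >= 1/2, so that 2 r >= 1.\<close>

lemma dyadic_lower_sum:
  assumes N: "unit_interval_measure N" and C: "0 \<le> C" and dbl: "\<And>k. dyadic_tail N k \<le> C * dyadic_tail N (Suc k)"
    and m: "\<And>k. dyadic_tail N (k + m) \<le> dyadic_tail N k / 2"
    and h[measurable]: "h \<in> borel_measurable borel" and hnn: "\<And>r. 0 \<le> h r"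
    and hmono: "\<And>r s. 0 \<le> r \<Longrightarrow> r \<le> s \<Longrightarrow> s < 1 \<Longrightarrow> h r \<le> h s"
  shows "(\<Sum>k<K. ennreal (dyadic_tail N k * h (dyadic_radius (Suc k)))) \<le> ennreal (2 * C * real m) * (\<integral>\<^sup>+r. ennreal (2 * r * h r) \<partial>N)"
proof -
  interpret finite_measure N using N by (simp add: unit_interval_measure_def)
  have sN[measurable_cong]: "sets N = sets borel" using N by (simp add: unit_interval_measure_def)
  let ?J = "\<lambda>k. {dyadic_radius (Suc k)..<dyadic_radius (Suc k + m)}"
  have Jm[measurable]: "?J k \<in> sets N" for k by (simp add: sN)
  have each: "ennreal (dyadic_tail N k * h (dyadic_radius (Suc k))) \<le> ennreal (2 * C) * (\<integral>\<^sup>+r. ennreal (2 * r * h r) * indicator (?J k) r \<partial>N)" for k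
  proof -
    have "dyadic_tail N (Suc k) = measure N (?J k) + dyadic_tail N (Suc k + m)"
      unfolding dyadic_tail_def using dyadic_radius_mono[of "Suc k" "Suc k + m"] dyadic_radius_bounds(2)[of "Suc k + m"]
      by (subst finite_measure_Union[symmetric]) (auto simp: sN intro!: arg_cong[where f = "measure N"] simp del: dyadic_radius_bounds)
    then have "dyadic_tail N (Suc k) / 2 \<le> measure N (?J k)" using m[of "Suc k"] by linarith
    then have "dyadic_tail N (Suc k) \<le> 2 * measure N (?J k)" by simp
    then have "C * dyadic_tail N (Suc k) \<le> C * (2 * measure N (?J k))" using C by (rule mult_left_mono)
    with dbl[of k] have "dyadic_tail N k \<le> 2 * C * measure N (?J k)" by simp
    then have "ennreal (dyadic_tail N k * h (dyadic_radius (Suc k))) \<le> ennreal (2 * C * measure N (?J k) * h (dyadic_radius (Suc k)))"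
      by (intro ennreal_leI mult_right_mono hnn)
    also have "\<dots> = ennreal (2 * C) * (ennreal (h (dyadic_radius (Suc k))) * emeasure N (?J k))"
      using C hnn by (simp add: emeasure_eq_measure ennreal_mult[symmetric] mult_ac)
    also have "ennreal (h (dyadic_radius (Suc k))) * emeasure N (?J k) = (\<integral>\<^sup>+r. ennreal (h (dyadic_radius (Suc k))) * indicator (?J k) r \<partial>N)"
      by (rule nn_integral_cmult_indicator[symmetric]) simp
    also have "\<dots> \<le> (\<integral>\<^sup>+r. ennreal (2 * r * h r) * indicator (?J k) r \<partial>N)"
    proof (intro nn_integral_mono)
      fix r
      show "ennreal (h (dyadic_radius (Suc k))) * indicator (?J k) r \<le> ennreal (2 * r * h r) * indicator (?J k) r"
      proof (cases "r \<in> ?J k")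
        case True
        have "dyadic_radius 1 \<le> dyadic_radius (Suc k)" by (rule dyadic_radius_mono) simp
        moreover have "dyadic_radius 1 = 1/2" by (simp add: dyadic_radius_def)
        moreover have "dyadic_radius (Suc k) \<le> r" "r < dyadic_radius (Suc k + m)" using True by simp_all
        moreover have "dyadic_radius (Suc k + m) < 1" by (rule dyadic_radius_bounds)
        ultimately have r: "1/2 \<le> r" "r < 1" by linarith+
        have "h (dyadic_radius (Suc k)) \<le> h r" using True r by (intro hmono) auto
        also have "\<dots> \<le> 2 * r * h r" using r hnn[of r] by (intro mult_right_mono[of 1 "2 * r", simplified]) auto
        finally show ?thesis using True by (simp add: ennreal_leI)
      qed simp
    qed
    finally show ?thesis by (simp add: mult_left_mono)
  qed
  have "(\<Sum>k<K. ennreal (dyadic_tail N k * h (dyadic_radius (Suc k)))) \<le> (\<Sum>k<K. ennreal (2 * C) * (\<integral>\<^sup>+r. ennreal (2 * r * h r) * indicator (?J k) r \<partial>N))"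
    by (intro sum_mono each)
  also have "\<dots> = ennreal (2 * C) * (\<integral>\<^sup>+r. (\<Sum>k<K. ennreal (2 * r * h r) * indicator (?J k) r) \<partial>N)"
    by (subst nn_integral_sum) (auto simp: sum_distrib_left)
  also have "\<dots> \<le> ennreal (2 * C) * (\<integral>\<^sup>+r. ennreal (real m) * ennreal (2 * r * h r) \<partial>N)"
  proof (intro mult_left_mono nn_integral_mono)
    fix r
    let ?A = "{k. k < K \<and> r \<in> ?J k}"
    have card: "card ?A \<le> m"
    proof (cases "?A = {}")
      case False
      define k0 where "k0 = Min ?A"
      have k0: "k0 \<in> ?A" unfolding k0_def using False by (intro Min_in) auto
      have "?A \<subseteq> {k0..<k0 + m}"
      proof
        fix k assume k: "k \<in> ?A"
        have "k0 \<le> k" unfolding k0_def using k by (intro Min_le) auto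
        have "dyadic_radius (Suc k) \<le> r" "r < dyadic_radius (Suc k0 + m)" using k k0 by simp_all
        then have "dyadic_radius (Suc k) < dyadic_radius (Suc k0 + m)" by (rule le_less_trans)
        then have "Suc k < Suc k0 + m" by (simp only: dyadic_radius_less_iff)
        with \<open>k0 \<le> k\<close> show "k \<in> {k0..<k0 + m}" by simp
      qed
      then show ?thesis using card_mono[of "{k0..<k0 + m}" ?A] by simp
    qed (simp only: card.empty le0)
    have "(\<Sum>k<K. ennreal (2 * r * h r) * indicator (?J k) r) = ennreal (2 * r * h r) * (\<Sum>k<K. indicator (?J k) r)"
      by (simp add: sum_distrib_left)
    also have "(\<Sum>k<K. (indicator (?J k) r :: ennreal)) = of_nat (card ?A)"
      by (simp add: indicator_def sum.If_cases Int_def lessThan_def del: atLeastLessThan_iff)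
    also have "ennreal (2 * r * h r) * of_nat (card ?A) \<le> ennreal (2 * r * h r) * of_nat m"
      using card by (intro mult_left_mono) auto
    finally show "(\<Sum>k<K. ennreal (2 * r * h r) * indicator (?J k) r) \<le> ennreal (real m) * ennreal (2 * r * h r)"
      by (simp add: mult.commute ennreal_of_nat_eq_real_of_nat)
  qed simp
  also have "\<dots> = ennreal (2 * C * real m) * (\<integral>\<^sup>+r. ennreal (2 * r * h r) \<partial>N)"
    using C by (simp add: nn_integral_cmult ennreal_mult mult.assoc)
  finally show ?thesis .
qed

text \<open>Each level is charged with the whole tail instead of its own mass, which matches the
  tails in the lower estimate.\<close>

lemma dyadic_upper_sum:
  assumes N: "unit_interval_measure N"
    and h: "\<And>k r. dyadic_radius k \<le> r \<Longrightarrow> r < dyadic_radius (Suc k) \<Longrightarrow> h r \<le> H k" and H: "\<And>k. 0 \<le> H k"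
  shows "(\<integral>\<^sup>+r. ennreal (2 * r * h r) \<partial>N) \<le> (\<Sum>k. ennreal (2 * dyadic_tail N k * H k))"
proof -
  interpret finite_measure N using N by (simp add: unit_interval_measure_def)
  have sN[measurable_cong]: "sets N = sets borel" using N by (simp add: unit_interval_measure_def)
  have "(\<integral>\<^sup>+r. ennreal (2 * r * h r) \<partial>N) \<le> (\<integral>\<^sup>+r. (\<Sum>k. ennreal (2 * H k) * indicator {dyadic_radius k..<1} r) \<partial>N)"
  proof (rule nn_integral_mono_AE)
    have "AE r in N. r \<in> {0..<1}" using N by (simp add: unit_interval_measure_def)
    then show "AE r in N. ennreal (2 * r * h r) \<le> (\<Sum>k. ennreal (2 * H k) * indicator {dyadic_radius k..<1} r)"
    proof eventually_elim
      case (elim r)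
      then obtain k where k: "dyadic_radius k \<le> r" "r < dyadic_radius (Suc k)"
        using dyadic_radius_cover[of r] by auto
      have "2 * r * h r \<le> 2 * 1 * H k"
      proof (cases "0 \<le> h r")
        case True
        then show ?thesis using elim h[OF k] by (intro mult_mono) auto
      next
        case False
        then have "2 * r * h r \<le> 0" using elim by (intro mult_nonneg_nonpos) auto
        then show ?thesis using H[of k] by linarith
      qed
      define u where "u k = ennreal (2 * H k) * indicator {dyadic_radius k..<1} r" for k
      have "ennreal (2 * r * h r) \<le> u k"
        using k elim \<open>2 * r * h r \<le> 2 * 1 * H k\<close> by (simp add: ennreal_leI u_def)
      also have "\<dots> = (\<Sum>i\<in>{k}. u i)" by simp
      also have "\<dots> \<le> suminf u"
        by (rule sum_le_suminf) auto
      finally show ?case by (simp add: u_def[abs_def])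
    qed
  qed
  also have "\<dots> = (\<Sum>k. \<integral>\<^sup>+r. ennreal (2 * H k) * indicator {dyadic_radius k..<1} r \<partial>N)"
    by (rule nn_integral_suminf) measurable
  also have "\<dots> = (\<Sum>k. ennreal (2 * dyadic_tail N k * H k))"
  proof (rule suminf_cong)
    fix k
    have "(\<integral>\<^sup>+r. ennreal (2 * H k) * indicator {dyadic_radius k..<1} r \<partial>N) = ennreal (2 * H k) * emeasure N {dyadic_radius k..<1}"
      by (rule nn_integral_cmult_indicator) (simp add: sN)
    then show "(\<integral>\<^sup>+r. ennreal (2 * H k) * indicator {dyadic_radius k..<1} r \<partial>N) = ennreal (2 * dyadic_tail N k * H k)"
      using H by (simp add: emeasure_eq_measure dyadic_tail_def ennreal_mult[symmetric] mult_ac)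
  qed
  finally show ?thesis .
qed

text \<open>The weights are moved into the kernel: after multiplication by (\<tau>_k/\<tau>_j)^(1/q)
  it is dominated by A a^|k-j|, and convolution with a^|k-j| is bounded on l^q. This yields both
  Hardy's inequality and the norm bound for the test functions.\<close>

lemma weighted_schur_sum:
  fixes \<tau> X :: "nat \<Rightarrow> real" and \<kappa> :: "nat \<Rightarrow> nat \<Rightarrow> real"
  assumes q: "1 < q" and a: "0 < a" "a < 1" and A: "0 \<le> A" and \<tau>: "\<And>k. 0 \<le> \<tau> k" and X: "\<And>k. 0 \<le> X k" and \<kappa>: "\<And>k j. 0 \<le> \<kappa> k j"
    and dom: "\<And>k j. \<tau> k powr (1/q) * \<kappa> k j \<le> A * a ^ ((k - j) + (j - k)) * \<tau> j powr (1/q)"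
  shows "(\<Sum>k<K. \<tau> k * (\<Sum>j<K. \<kappa> k j * X j) powr q) \<le> (A * (2 / (1 - a))) powr q * (\<Sum>j<K. \<tau> j * X j powr q)"
proof -
  have "(\<Sum>k<K. \<tau> k * (\<Sum>j<K. \<kappa> k j * X j) powr q) \<le> (\<Sum>k<K. A powr q * (\<Sum>j<K. a ^ ((k - j) + (j - k)) * (\<tau> j powr (1/q) * X j)) powr q)"
  proof (intro sum_mono)
    fix k
    have "\<tau> k * (\<Sum>j<K. \<kappa> k j * X j) powr q = (\<tau> k powr (1/q) * (\<Sum>j<K. \<kappa> k j * X j)) powr q"
      using q \<tau> X \<kappa> by (simp add: powr_mult powr_powr sum_nonneg)
    also have "\<dots> \<le> (A * (\<Sum>j<K. a ^ ((k - j) + (j - k)) * (\<tau> j powr (1/q) * X j))) powr q"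
    proof (intro powr_mono2)
      have "\<tau> k powr (1/q) * (\<Sum>j<K. \<kappa> k j * X j) = (\<Sum>j<K. (\<tau> k powr (1/q) * \<kappa> k j) * X j)"
        by (simp add: sum_distrib_left mult_ac)
      also have "\<dots> \<le> (\<Sum>j<K. (A * a ^ ((k - j) + (j - k)) * \<tau> j powr (1/q)) * X j)"
        by (intro sum_mono mult_right_mono dom X)
      also have "\<dots> = A * (\<Sum>j<K. a ^ ((k - j) + (j - k)) * (\<tau> j powr (1/q) * X j))"
        by (simp add: sum_distrib_left mult_ac)
      finally show "\<tau> k powr (1/q) * (\<Sum>j<K. \<kappa> k j * X j) \<le> A * (\<Sum>j<K. a ^ ((k - j) + (j - k)) * (\<tau> j powr (1/q) * X j))" .
    qed (use q X \<kappa> in \<open>auto intro!: mult_nonneg_nonneg sum_nonneg\<close>)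
    also have "\<dots> = A powr q * (\<Sum>j<K. a ^ ((k - j) + (j - k)) * (\<tau> j powr (1/q) * X j)) powr q"
      using A a X by (intro powr_mult)
    finally show "\<tau> k * (\<Sum>j<K. \<kappa> k j * X j) powr q \<le> A powr q * (\<Sum>j<K. a ^ ((k - j) + (j - k)) * (\<tau> j powr (1/q) * X j)) powr q" .
  qed
  also have "\<dots> = A powr q * (\<Sum>k<K. (\<Sum>j<K. a ^ ((k - j) + (j - k)) * (\<tau> j powr (1/q) * X j)) powr q)"
    by (simp add: sum_distrib_left)
  also have "\<dots> \<le> A powr q * ((2 / (1 - a)) powr q * (\<Sum>j<K. (\<tau> j powr (1/q) * X j) powr q))"
    using q a X by (intro mult_left_mono young_convolution_geometric) auto
  also have "\<dots> = (A * (2 / (1 - a))) powr q * (\<Sum>j<K. \<tau> j * X j powr q)"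
  proof -
    have "(A * (2 / (1 - a))) powr q = A powr q * (2 / (1 - a)) powr q"
      using A a by (intro powr_mult)
    moreover have "(\<tau> j powr (1/q) * X j) powr q = \<tau> j * X j powr q" for j
      using q \<tau> X by (simp add: powr_mult powr_powr)
    ultimately show ?thesis by simp
  qed
  finally show ?thesis .
qed

text \<open>Halving every m levels means a rate of 2^(-1/m) per level; the factor 2 accounts for the
  incomplete last group of fewer than m levels.\<close>

lemma halving_geometric_decay:
  fixes \<tau> :: "nat \<Rightarrow> real"
  assumes m: "0 < m" and half: "\<And>k. \<tau> (k + m) \<le> \<tau> k / 2" and nn: "\<And>k. 0 \<le> \<tau> k"
    and mono: "\<And>j k. j \<le> k \<Longrightarrow> \<tau> k \<le> \<tau> j" and jk: "j \<le> k"
  shows "\<tau> k \<le> 2 * (2 powr (- 1 / real m)) ^ (k - j) * \<tau> j"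
proof -
  define a where "a = (k - j) div m"
  have it: "\<tau> (j + i * m) \<le> (1/2) ^ i * \<tau> j" for i
  proof (induction i)
    case (Suc i)
    have "\<tau> (j + Suc i * m) = \<tau> ((j + i * m) + m)" by (simp add: add_ac)
    also have "\<dots> \<le> \<tau> (j + i * m) / 2" by (rule half)
    finally show ?case using Suc by simp
  qed simp
  have am: "a * m \<le> k - j" by (simp add: a_def)
  have "k - j < (a + 1) * m" using m unfolding a_def by (simp add: dividend_less_div_times add.commute)
  then have "real (k - j) \<le> real ((a + 1) * m)" by (intro of_nat_mono) simp
  then have lt: "real (k - j) \<le> real (a + 1) * real m" by (simp only: of_nat_mult)
  have "\<tau> k \<le> \<tau> (j + a * m)" using am jk by (intro mono) linarith
  also have "\<dots> \<le> (1/2) ^ a * \<tau> j" by (rule it)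
  also have "(1/2) ^ a \<le> 2 * (2 powr (- 1 / real m)) ^ (k - j)"
  proof -
    have "(1/2::real) ^ (a + 1) = 2 powr (- real (a + 1))"
      by (simp only: powr_minus powr_realpow[OF zero_less_numeral] power_one_over inverse_eq_divide)
    also have "\<dots> \<le> 2 powr (- 1 / real m * real (k - j))"
      using lt m by (intro powr_mono) (auto simp: field_simps)
    also have "\<dots> = (2 powr (- 1 / real m)) powr real (k - j)" by (rule powr_powr[symmetric])
    also have "\<dots> = (2 powr (- 1 / real m)) ^ (k - j)" by (rule powr_realpow) simp
    finally show ?thesis by simp
  qed
  finally show ?thesis using nn by (simp add: mult_right_mono)
qed

section \<open>The kernel\<close>

text \<open>Everything is measured against 2^k/\<tau>_k, the size of block k. The bounds for blocks
  i <= k are smaller by (1/2)^(k-i), since \<tau> decreases; those for i > k grow at most like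
  (2C)^(i-k), which the doubly exponential decay of the powers outweighs. D depends on c and C
  only.\<close>

lemma dyadic_series_bound:
  fixes c C :: real
  assumes c: "0 \<le> c" and C: "1 \<le> C"
  obtains D where "0 < D"
    "\<And>lam \<tau> k. (\<And>n. 0 \<le> lam n) \<Longrightarrow> (\<And>k. 0 < \<tau> k) \<Longrightarrow> (\<And>j k. j \<le> k \<Longrightarrow> \<tau> k \<le> \<tau> j) \<Longrightarrow>
       (\<And>k. \<tau> k \<le> C * \<tau> (Suc k)) \<Longrightarrow> (\<And>k n. n \<in> dyadic_block k \<Longrightarrow> lam n \<le> c / \<tau> k) \<Longrightarrow>
       summable (\<lambda>n. lam n * dyadic_radius (Suc k) ^ n) \<and> (\<Sum>n. lam n * dyadic_radius (Suc k) ^ n) \<le> D * (2 ^ k / \<tau> k)"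
proof -
  define a where "a i = (2 * C) ^ i * exp (- (1/2 * 2 ^ i))" for i
  have a: "summable a" "\<And>i. 0 \<le> a i"
    unfolding a_def using summable_power_exp_dyadic[of "1/2" "2 * C"] C by auto
  have sa: "0 \<le> suminf a" using a by (intro suminf_nonneg) auto
  \<comment> \<open>2 sums the geometric series over the blocks up to k,
    \<open>exp 1 * suminf a\<close> the blocks from k on; the final 1 keeps D positive when c =
    0.\<close>
  define D where "D = c * (2 + exp 1 * suminf a) + 1"
  have D: "D > 0" using c sa unfolding D_def by (intro add_nonneg_pos mult_nonneg_nonneg add_nonneg_nonneg) auto
  moreover have "summable (\<lambda>n. lam n * dyadic_radius (Suc k) ^ n) \<and> (\<Sum>n. lam n * dyadic_radius (Suc k) ^ n) \<le> D * (2 ^ k / \<tau> k)"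
    if l: "\<And>n. 0 \<le> lam n" and tp: "\<And>k. 0 < \<tau> k" and tm: "\<And>j k. j \<le> k \<Longrightarrow> \<tau> k \<le> \<tau> j"
      and td: "\<And>k. \<tau> k \<le> C * \<tau> (Suc k)" and lt: "\<And>k n. n \<in> dyadic_block k \<Longrightarrow> lam n \<le> c / \<tau> k"
    for lam \<tau> :: "nat \<Rightarrow> real" and k
  proof -
    let ?\<rho> = "dyadic_radius (Suc k)" and ?B = "2 ^ k / \<tau> k"
    have B: "?B > 0" using tp by simp
    let ?t = "\<lambda>n. lam n * ?\<rho> ^ n"
    have block: "(\<Sum>n\<in>dyadic_block i. ?t n) \<le> c * ?B * ((if i \<le> k then (1/2) ^ (k - i) else 0) + (if k \<le> i then exp 1 * a (i - k) else 0))" for i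
    proof -
      let ?e = "min 1 (exp 1 * exp (- (1/2 * 2 ^ i / 2 ^ k))) :: real"
      have "(\<Sum>n\<in>dyadic_block i. ?t n) \<le> (\<Sum>n\<in>dyadic_block i. c / \<tau> i * ?e)"
      proof (intro sum_mono mult_mono lt)
        fix n assume n: "n \<in> dyadic_block i"
        then show "?\<rho> ^ n \<le> ?e"
          using dyadic_radius_power_upper[of i n k] by (auto simp: dyadic_block_iff less_imp_le intro: power_le_one)
      qed (use c tp in \<open>auto intro!: divide_nonneg_pos\<close>)
      also have "\<dots> = c * (2 ^ i / \<tau> i) * ?e" by (simp add: card_dyadic_block)
      also have "\<dots> \<le> c * ?B * ((if i \<le> k then (1/2) ^ (k - i) else 0) + (if k \<le> i then exp 1 * a (i - k) else 0))"
      proof (cases "i \<le> k")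
        case True
        have "c * (2 ^ i / \<tau> i) * ?e \<le> c * (2 ^ i / \<tau> k) * 1"
          using c tp tm[OF True] by (intro mult_mono divide_left_mono) (auto intro!: mult_nonneg_nonneg divide_nonneg_pos mult_pos_pos)
        also have "2 ^ i / \<tau> k = ?B * (1/2) ^ (k - i)"
          using True by (simp add: power_diff power_divide)
        also have "c * (?B * (1/2) ^ (k - i)) * 1 \<le> c * ?B * ((1/2) ^ (k - i) + (if k \<le> i then exp 1 * a (i - k) else 0))"
          unfolding mult_1_right mult.assoc using c B a by (intro mult_left_mono) auto
        finally show ?thesis using True by simp
      next
        case False
        then have ki: "k \<le> i" by simp
        have "\<tau> k \<le> C ^ (i - k) * \<tau> (k + (i - k))"
          using C by (intro dyadic_tail_doubling_iterate td) auto
        then have tk: "\<tau> k \<le> C ^ (i - k) * \<tau> i" using ki by simp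
        have "2 ^ i / \<tau> i \<le> 2 ^ i * C ^ (i - k) / \<tau> k"
          using tk tp[of k] tp[of i] by (simp add: field_simps)
        also have "2 ^ i * C ^ (i - k) / \<tau> k = ?B * (2 * C) ^ (i - k)"
        proof -
          have "(2::real) ^ i = 2 ^ k * 2 ^ (i - k)" using ki by (simp add: power_add[symmetric])
          then show ?thesis by (simp add: power_mult_distrib mult_ac)
        qed
        finally have 1: "2 ^ i / \<tau> i \<le> ?B * (2 * C) ^ (i - k)" .
        have e: "(2::real) ^ i / 2 ^ k = 2 ^ (i - k)" using ki by (simp add: power_diff)
        have "c * (2 ^ i / \<tau> i) * ?e \<le> c * (?B * (2 * C) ^ (i - k)) * (exp 1 * exp (- (1/2 * 2 ^ (i - k))))"
        proof (intro mult_mono)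
          have "1/2 * 2 ^ i / 2 ^ k = 1/2 * (2::real) ^ (i - k)" unfolding e[symmetric] by simp
          then show "?e \<le> exp 1 * exp (- (1/2 * 2 ^ (i - k)))" by (simp only: min.cobounded2)
          show "0 \<le> 2 ^ i / \<tau> i" using tp[of i] by simp
          have "0 \<le> ?B * (2 * C) ^ (i - k)" using B C by (intro mult_nonneg_nonneg zero_le_power) auto
          with c show "0 \<le> c * (?B * (2 * C) ^ (i - k))" by (rule mult_nonneg_nonneg)
        qed (use c 1 in auto)
        also have "\<dots> = c * ?B * (exp 1 * a (i - k))" unfolding a_def by (simp only: mult_ac)
        finally show ?thesis using False ki by simp
      qed
      finally show ?thesis .
    qed
    have partial: "(\<Sum>n<J. ?t n) \<le> D * ?B" for J
    proof -
      have "(\<Sum>n<J. ?t n) \<le> (\<Sum>n<2 ^ Suc J - 1. ?t n)"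
      proof (rule sum_mono2)
        have "J < 2 ^ J" by (rule less_exp)
        then have "J \<le> 2 ^ Suc J - 1" unfolding power_Suc by linarith
        then show "{..<J} \<subseteq> {..<2 ^ Suc J - 1}" by simp
      qed (use l in \<open>auto intro!: mult_nonneg_nonneg\<close>)
      also have "\<dots> \<le> (\<Sum>i<Suc J. c * ?B * ((if i \<le> k then (1/2) ^ (k - i) else 0) + (if k \<le> i then exp 1 * a (i - k) else 0)))"
        unfolding sum_dyadic_blocks by (intro sum_mono block)
      also have "\<dots> = c * ?B * ((\<Sum>i<Suc J. if i \<le> k then (1/2) ^ (k - i) else 0) + (\<Sum>i<Suc J. if k \<le> i then exp 1 * a (i - k) else 0))"
        unfolding sum_distrib_left[symmetric] sum.distrib ..
      also have "\<dots> \<le> c * ?B * (2 + exp 1 * suminf a)"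
      proof (intro mult_left_mono add_mono)
        have "(\<Sum>i<Suc J. if i \<le> k then (1/2) ^ (k - i) else 0) = (\<Sum>i\<in>{i. i < Suc J \<and> i \<le> k}. (1/2::real) ^ (k - i))"
          by (simp add: sum.If_cases Collect_conj_eq lessThan_def del: sum.lessThan_Suc)
        also have "\<dots> = (\<Sum>i\<in>(\<lambda>i. k - i) ` {i. i < Suc J \<and> i \<le> k}. (1/2) ^ i)"
          by (subst sum.reindex) (auto simp: inj_on_def)
        also have "\<dots> \<le> (\<Sum>i. (1/2::real) ^ i)" by (intro sum_le_suminf summable_geometric) auto
        also have "\<dots> = 2" by (subst suminf_geometric) auto
        finally show "(\<Sum>i<Suc J. if i \<le> k then (1/2) ^ (k - i) else 0) \<le> (2::real)" .
        have "(\<Sum>i<Suc J. if k \<le> i then exp 1 * a (i - k) else 0) = (\<Sum>i\<in>{i. i < Suc J \<and> k \<le> i}. exp 1 * a (i - k))"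
          by (simp add: sum.If_cases Collect_conj_eq lessThan_def del: sum.lessThan_Suc)
        also have "\<dots> = exp 1 * (\<Sum>i\<in>{i. i < Suc J \<and> k \<le> i}. a (i - k))" by (simp add: sum_distrib_left)
        also have "(\<Sum>i\<in>{i. i < Suc J \<and> k \<le> i}. a (i - k)) = (\<Sum>i\<in>(\<lambda>i. i - k) ` {i. i < Suc J \<and> k \<le> i}. a i)"
          by (subst sum.reindex) (auto simp: inj_on_def)
        also have "\<dots> \<le> suminf a" using a by (intro sum_le_suminf) auto
        finally show "(\<Sum>i<Suc J. if k \<le> i then exp 1 * a (i - k) else 0) \<le> exp 1 * suminf a" by simp
      qed (rule mult_nonneg_nonneg[OF c less_imp_le[OF B]])
      also have "\<dots> = (c * (2 + exp 1 * suminf a)) * ?B" by (simp only: mult_ac)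
      also have "\<dots> \<le> D * ?B" unfolding D_def using B by (intro mult_right_mono) auto
      finally show ?thesis .
    qed
    have sm: "summable ?t"
    proof (rule bounded_imp_summable)
      show "0 \<le> ?t n" for n using l by simp
      show "(\<Sum>n\<le>J. ?t n) \<le> D * ?B" for J unfolding lessThan_Suc_atMost[symmetric] by (rule partial)
    qed
    then show ?thesis using suminf_le_const[OF sm partial] by simp
  qed
  ultimately show ?thesis using that by blast
qed

text \<open>\<open>B_kernel \<omega> t z\<close> depends on t and z only through the product t z;
  for lam n = 1/(2 \<open>weight_moment \<omega> (2 * n + 1)\<close>) this is that function of one
  variable. The value 0 outside the disc makes it Borel on the plane.\<close>

definition kernel_fun :: "(nat \<Rightarrow> real) \<Rightarrow> complex \<Rightarrow> complex" where
  "kernel_fun lam z = (if norm z < 1 then (\<Sum>n. of_real (lam n) * z ^ n) else 0)"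

lemma disc_holomorphic_truncate:
  assumes "f holomorphic_on ball 0 1"
  shows "disc_holomorphic (\<lambda>z. if norm z < 1 then f z else 0)"
proof -
  have "(\<lambda>z. indicator (ball 0 1) z *\<^sub>R f z) \<in> borel_measurable borel"
    using assms by (intro borel_measurable_continuous_on_indicator holomorphic_on_imp_continuous_on) auto
  also have "(\<lambda>z. indicator (ball 0 1) z *\<^sub>R f z) = (\<lambda>z. if norm z < 1 then f z else 0)"
    by (auto simp: fun_eq_iff indicator_def)
  finally have "(\<lambda>z. if norm z < 1 then f z else 0) \<in> borel_measurable borel" .
  moreover have "(\<lambda>z. if norm z < 1 then f z else 0) holomorphic_on ball 0 1"
    by (rule holomorphic_transform[OF assms]) auto
  ultimately show ?thesis by (simp add: disc_holomorphic_def)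
qed

lemma summable_kernel:
  fixes z :: complex
  assumes s: "\<And>k. summable (\<lambda>n. lam n * dyadic_radius k ^ n)" and z: "norm z < 1"
  shows "summable (\<lambda>n. norm (of_real (lam n) * z ^ n))"
proof -
  obtain k where k: "norm z < dyadic_radius k" using dyadic_radius_exceeds[OF z] by blast
  have "summable (\<lambda>n. norm (lam n * norm z ^ n))"
    by (rule powser_insidea[OF s[of k]]) (use k in simp)
  then show ?thesis by (simp add: norm_mult norm_power abs_mult)
qed

lemma disc_holomorphic_kernel:
  assumes s: "\<And>k. summable (\<lambda>n. lam n * dyadic_radius k ^ n)"
  shows "disc_holomorphic (kernel_fun lam)"
  unfolding kernel_fun_def
proof (rule disc_holomorphic_truncate, rule power_series_holomorphic)
  fix w :: complex assume "w \<in> ball 0 1"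
  then have "norm w < 1" by simp
  then have "summable (\<lambda>n. of_real (lam n) * w ^ n)"
    by (rule summable_norm_cancel[OF summable_kernel[where lam = lam, OF s]])
  then show "(\<lambda>n. of_real (lam n) * (w - 0) ^ n) sums (\<Sum>n. of_real (lam n) * w ^ n)"
    by (simp add: summable_sums)
qed

lemma kernel_fun_of_real:
  assumes s: "\<And>k. summable (\<lambda>n. lam n * dyadic_radius k ^ n)" and x: "0 \<le> x" "x < 1"
  shows "summable (\<lambda>n. lam n * x ^ n)" "kernel_fun lam (of_real x) = of_real (\<Sum>n. lam n * x ^ n)"
proof -
  have "summable (\<lambda>n. norm (of_real (lam n) * (of_real x :: complex) ^ n))"
    by (rule summable_kernel[where lam = lam, OF s]) (use x in simp)
  then have "summable (\<lambda>n. norm (lam n * x ^ n))" by (simp add: norm_mult norm_power abs_mult power_abs)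
  then show sm: "summable (\<lambda>n. lam n * x ^ n)" by (rule summable_norm_cancel)
  show "kernel_fun lam (of_real x) = of_real (\<Sum>n. lam n * x ^ n)"
    using x suminf_of_real[OF sm, where 'a = complex] by (simp add: kernel_fun_def)
qed

text \<open>Summation by parts: \<open>(1 - z) K z\<close> has nonnegative coefficients when \<open>\<lambda>\<close> is increasing.\<close>

lemma kernel_fun_bound:
  assumes s: "\<And>k. summable (\<lambda>n. lam n * dyadic_radius k ^ n)" and nn: "\<And>n. 0 \<le> lam n" and inc: "\<And>n. lam n \<le> lam (Suc n)"
    and z: "norm z < 1"
  shows "norm (1 - z) * norm (kernel_fun lam z) \<le> (1 - norm z) * (\<Sum>n. lam n * norm z ^ n)"
proof -
  have parts: "(\<lambda>n. (of_real (lam (Suc n)) - of_real (lam n)) * w ^ Suc n) sums ((1 - w) * (\<Sum>n. of_real (lam n) * w ^ n) - of_real (lam 0))"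
    if w: "norm w < 1" for w :: complex
  proof -
    have sw: "summable (\<lambda>n. of_real (lam n) * w ^ n)" by (rule summable_norm_cancel[OF summable_kernel[where lam = lam, OF s w]])
    have "(\<lambda>n. of_real (lam (Suc n)) * w ^ Suc n) sums ((\<Sum>n. of_real (lam n) * w ^ n) - of_real (lam 0))"
      using summable_sums[OF sw] by (subst sums_Suc_iff) simp
    moreover have "(\<lambda>n. w * (of_real (lam n) * w ^ n)) sums (w * (\<Sum>n. of_real (lam n) * w ^ n))"
      by (rule sums_mult[OF summable_sums[OF sw]])
    ultimately have "(\<lambda>n. of_real (lam (Suc n)) * w ^ Suc n - w * (of_real (lam n) * w ^ n)) sums
       ((\<Sum>n. of_real (lam n) * w ^ n) - of_real (lam 0) - w * (\<Sum>n. of_real (lam n) * w ^ n))"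
      by (rule sums_diff)
    then show ?thesis by (simp add: algebra_simps)
  qed
  let ?\<rho> = "norm z"
  \<comment> \<open>The same expansion at |z|: its terms are nonnegative, and they are the moduli of
    the terms of the expansion at z.\<close>
  have r: "(\<lambda>n. (lam (Suc n) - lam n) * ?\<rho> ^ Suc n) sums ((1 - ?\<rho>) * (\<Sum>n. lam n * ?\<rho> ^ n) - lam 0)"
  proof -
    have sr: "summable (\<lambda>n. lam n * ?\<rho> ^ n)" by (rule kernel_fun_of_real[where lam = lam, OF s]) (use z in auto)
    have "complex_of_real ((1 - ?\<rho>) * (\<Sum>n. lam n * ?\<rho> ^ n) - lam 0) = (1 - of_real ?\<rho>) * (\<Sum>n. of_real (lam n) * of_real ?\<rho> ^ n) - of_real (lam 0)"
      using suminf_of_real[OF sr, where 'a = complex] by simp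
    moreover have "(\<lambda>n. (of_real (lam (Suc n)) - of_real (lam n)) * of_real ?\<rho> ^ Suc n) = (\<lambda>n. complex_of_real ((lam (Suc n) - lam n) * ?\<rho> ^ Suc n))"
      by simp
    moreover have "norm (complex_of_real ?\<rho>) < 1" using z by simp
    ultimately have "(\<lambda>n. complex_of_real ((lam (Suc n) - lam n) * ?\<rho> ^ Suc n)) sums complex_of_real ((1 - ?\<rho>) * (\<Sum>n. lam n * ?\<rho> ^ n) - lam 0)"
      using parts[of "of_real ?\<rho>"] by (simp only:)
    then show ?thesis by (simp only: sums_of_real_iff)
  qed
  have c: "(\<lambda>n. (of_real (lam (Suc n)) - of_real (lam n)) * z ^ Suc n) sums ((1 - z) * kernel_fun lam z - of_real (lam 0))"
    using parts[OF z] z by (simp add: kernel_fun_def)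
  have nrm: "norm ((of_real (lam (Suc n)) - of_real (lam n)) * z ^ Suc n) = (lam (Suc n) - lam n) * ?\<rho> ^ Suc n" for n
  proof -
    have "norm (of_real (lam (Suc n)) - of_real (lam n) :: complex) = norm (complex_of_real (lam (Suc n) - lam n))" by simp
    also have "\<dots> = lam (Suc n) - lam n" unfolding norm_of_real using inc[of n] by simp
    finally show ?thesis by (simp add: norm_mult norm_power)
  qed
  have "norm ((1 - z) * kernel_fun lam z - of_real (lam 0)) \<le> (1 - ?\<rho>) * (\<Sum>n. lam n * ?\<rho> ^ n) - lam 0"
  proof -
    have "norm (\<Sum>n. (of_real (lam (Suc n)) - of_real (lam n)) * z ^ Suc n) \<le> (\<Sum>n. norm ((of_real (lam (Suc n)) - of_real (lam n)) * z ^ Suc n))"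
      by (rule summable_norm) (unfold nrm, rule sums_summable[OF r])
    then show ?thesis unfolding nrm sums_unique[OF c, symmetric] sums_unique[OF r, symmetric] .
  qed
  \<comment> \<open>The constant term lam 0, left out of both expansions, is added back by the
    triangle inequality.\<close>
  moreover have "norm ((1 - z) * kernel_fun lam z) \<le> norm ((1 - z) * kernel_fun lam z - of_real (lam 0)) + norm (complex_of_real (lam 0))"
    using norm_triangle_ineq[of "(1 - z) * kernel_fun lam z - of_real (lam 0)" "of_real (lam 0)"] by (simp del: norm_of_real)
  moreover have "norm (complex_of_real (lam 0)) = lam 0" using nn[of 0] by simp
  ultimately show ?thesis by (simp add: norm_mult)
qed

text \<open>The pointwise bound (1 - r) L/|1 - z|, with L the series at r, is raised to the power s
  and integrated: ((1 - r) L)^s (1 - r)^(1-s) = L^s (1 - r).\<close>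

lemma kernel_fun_mean_bound:
  assumes s: "1 < s"
  obtains C where "0 < C"
    "\<And>lam r. (\<And>k. summable (\<lambda>n. lam n * dyadic_radius k ^ n)) \<Longrightarrow> (\<And>n. 0 \<le> lam n) \<Longrightarrow> (\<And>n. lam n \<le> lam (Suc n)) \<Longrightarrow> 0 \<le> r \<Longrightarrow> r < 1 \<Longrightarrow>
       circle_mean s (kernel_fun lam) r \<le> C * (\<Sum>n. lam n * r ^ n) powr s * (1 - r)"
proof -
  obtain C where C: "0 < C" "\<And>x. 0 \<le> x \<Longrightarrow> x < 1 \<Longrightarrow>
       (\<integral>\<^sup>+\<zeta>. ennreal (norm (1 - of_real x * \<zeta>) powr (- s)) \<partial>circle_measure) \<le> ennreal (C * (1 - x) powr (1 - s))"
    using circle_kernel_bound[OF s] by blast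
  have "circle_mean s (kernel_fun lam) r \<le> C * (\<Sum>n. lam n * r ^ n) powr s * (1 - r)"
    if sm: "\<And>k. summable (\<lambda>n. lam n * dyadic_radius k ^ n)" and nn: "\<And>n. 0 \<le> lam n" and inc: "\<And>n. lam n \<le> lam (Suc n)"
      and r: "0 \<le> r" "r < 1" for lam r
  proof -
    let ?L = "\<Sum>n. lam n * r ^ n"
    have L: "0 \<le> ?L" using kernel_fun_of_real(1)[where lam = lam, OF sm r] nn r by (intro suminf_nonneg) auto
    have d: "0 < 1 - r" using r by simp
    have "ennreal (circle_mean s (kernel_fun lam) r) = (\<integral>\<^sup>+\<zeta>. ennreal (norm (kernel_fun lam (of_real r * \<zeta>)) powr s) \<partial>circle_measure)"
      using nn_integral_circle_mean[OF disc_holomorphic_kernel[where lam = lam, OF sm] r, of s] s by simp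
    also have "\<dots> \<le> (\<integral>\<^sup>+\<zeta>. ennreal (((1 - r) * ?L) powr s) * ennreal (norm (1 - of_real r * \<zeta>) powr (- s)) \<partial>circle_measure)"
    proof (rule nn_integral_mono_AE, rule eventually_mono[OF AE_circle_norm])
      fix \<zeta> :: complex assume z: "norm \<zeta> = 1"
      let ?z = "of_real r * \<zeta>"
      have nz: "norm ?z = r" using z r by (simp add: norm_mult)
      have pos: "0 < norm (1 - ?z)" using nz r by auto
      have "norm (1 - ?z) * norm (kernel_fun lam ?z) \<le> (1 - r) * ?L"
        using kernel_fun_bound[where lam = lam, OF sm nn inc, of ?z] nz r by simp
      then have "norm (kernel_fun lam ?z) \<le> (1 - r) * ?L / norm (1 - ?z)"
        using pos by (simp only: pos_le_divide_eq mult.commute)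
      then have "norm (kernel_fun lam ?z) \<le> (1 - r) * ?L * norm (1 - ?z) powr (- 1)"
        using pos by (simp add: powr_minus_divide)
      then have "norm (kernel_fun lam ?z) powr s \<le> ((1 - r) * ?L * norm (1 - ?z) powr (- 1)) powr s"
        using s by (intro powr_mono2) auto
      also have "\<dots> = ((1 - r) * ?L) powr s * norm (1 - ?z) powr (- s)"
      proof -
        have "((1 - r) * ?L * norm (1 - ?z) powr (- 1)) powr s = ((1 - r) * ?L) powr s * (norm (1 - ?z) powr (- 1)) powr s"
          by (rule powr_mult)
        then show ?thesis unfolding powr_powr by simp
      qed
      finally show "ennreal (norm (kernel_fun lam ?z) powr s) \<le> ennreal (((1 - r) * ?L) powr s) * ennreal (norm (1 - ?z) powr (- s))"
        by (simp add: ennreal_mult[symmetric] ennreal_leI)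
    qed
    also have "\<dots> = ennreal (((1 - r) * ?L) powr s) * (\<integral>\<^sup>+\<zeta>. ennreal (norm (1 - of_real r * \<zeta>) powr (- s)) \<partial>circle_measure)"
      by (rule nn_integral_cmult) measurable
    also have "\<dots> \<le> ennreal (((1 - r) * ?L) powr s) * ennreal (C * (1 - r) powr (1 - s))"
      by (intro mult_left_mono C(2) r) auto
    also have "\<dots> = ennreal (C * ?L powr s * (1 - r))"
    proof -
      have "((1 - r) * ?L) powr s * (C * (1 - r) powr (1 - s)) = C * ?L powr s * ((1 - r) powr s * (1 - r) powr (1 - s))"
        using L d by (simp add: powr_mult)
      also have "(1 - r) powr s * (1 - r) powr (1 - s) = 1 - r" using d by (simp add: powr_add[symmetric])
      finally have "((1 - r) * ?L) powr s * (C * (1 - r) powr (1 - s)) = C * ?L powr s * (1 - r)" .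
      moreover have "ennreal (((1 - r) * ?L) powr s) * ennreal (C * (1 - r) powr (1 - s)) = ennreal (((1 - r) * ?L) powr s * (C * (1 - r) powr (1 - s)))"
        using C by (intro ennreal_mult[symmetric]) auto
      ultimately show ?thesis by (simp only:)
    qed
    finally show ?thesis using C d L by (subst (asm) ennreal_le_iff) (auto intro!: mult_nonneg_nonneg)
  qed
  then show ?thesis using that C by blast
qed

lemma disc_holomorphic_mult:
  assumes "disc_holomorphic f" "disc_holomorphic g"
  shows "disc_holomorphic (\<lambda>z. f z * g z)"
  using assms unfolding disc_holomorphic_def by (auto intro!: holomorphic_intros borel_measurable_times)

lemma disc_holomorphic_dilation_average:
  assumes \<mu>: "unit_interval_measure \<mu>" and h: "disc_holomorphic h"
  shows "disc_holomorphic (\<lambda>z. \<integral>t. h (of_real t * z) \<partial>\<mu>)"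
proof -
  interpret finite_measure \<mu> using \<mu> by (simp add: unit_interval_measure_def)
  have [measurable_cong]: "sets \<mu> = sets borel" using \<mu> by (simp add: unit_interval_measure_def)
  have [measurable]: "h \<in> borel_measurable borel" using h by (simp add: disc_holomorphic_def)
  have "(\<lambda>z. \<integral>t. h (z * of_real t) * 1 \<partial>\<mu>) holomorphic_on ball 0 1"
  proof (rule holomorphic_dilation_integral[OF _ h, where B = 1])
    have "AE t in \<mu>. t \<in> {0..<1}" using \<mu> by (simp add: unit_interval_measure_def)
    then show "AE t in \<mu>. norm (complex_of_real t) \<le> 1" by eventually_elim simp
  qed (auto intro: finite_measure_axioms)
  moreover have "(\<lambda>z. \<integral>t. h (of_real t * z) \<partial>\<mu>) \<in> borel_measurable borel" by measurable
  ultimately show ?thesis by (simp add: disc_holomorphic_def mult.commute)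
qed

section \<open>Sufficiency\<close>

lemma circle_mean_mult_le:
  assumes f: "disc_holomorphic f" and g: "disc_holomorphic g" and r: "0 \<le> r" "r < 1"
    and q: "0 < q" and p: "q < p" and s: "q < s" and pqs: "1/q = 1/p + 1/s"
  shows "(\<integral>\<^sup>+\<zeta>. ennreal ((norm (f (of_real r * \<zeta>)) * norm (g (of_real r * \<zeta>))) powr q) \<partial>circle_measure)
    \<le> ennreal ((circle_mean p f r powr (1/p) * circle_mean s g r powr (1/s)) powr q)"
proof -
  have [measurable]: "f \<in> borel_measurable borel" "g \<in> borel_measurable borel"
    using f g by (auto simp: disc_holomorphic_def)
  have "q * (1/q) = q * (1/p + 1/s)" using pqs by simp
  then have e: "1 < p/q" "1 < s/q" "1/(p/q) + 1/(s/q) = 1"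
    using q p s by (auto simp: algebra_simps)
  have "(\<integral>\<^sup>+\<zeta>. ennreal ((norm (f (of_real r * \<zeta>)) * norm (g (of_real r * \<zeta>))) powr q) \<partial>circle_measure)
     = (\<integral>\<^sup>+\<zeta>. ennreal (norm (f (of_real r * \<zeta>)) powr q * norm (g (of_real r * \<zeta>)) powr q) \<partial>circle_measure)"
    by (simp add: powr_mult)
  also have "\<dots> \<le> ennreal (circle_mean p f r powr (1/(p/q)) * circle_mean s g r powr (1/(s/q)))"
  proof (rule holder_nn_integral[OF e])
    show "(\<integral>\<^sup>+\<zeta>. ennreal ((norm (f (of_real r * \<zeta>)) powr q) powr (p/q)) \<partial>circle_measure) \<le> ennreal (circle_mean p f r)"
      using nn_integral_circle_mean[OF f r, of p] q p by (simp add: powr_powr)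
    show "(\<integral>\<^sup>+\<zeta>. ennreal ((norm (g (of_real r * \<zeta>)) powr q) powr (s/q)) \<partial>circle_measure) \<le> ennreal (circle_mean s g r)"
      using nn_integral_circle_mean[OF g r, of s] q s by (simp add: powr_powr)
  qed auto
  also have "circle_mean p f r powr (1/(p/q)) * circle_mean s g r powr (1/(s/q)) = (circle_mean p f r powr (1/p) * circle_mean s g r powr (1/s)) powr q"
    by (simp add: powr_mult powr_powr)
  finally show ?thesis .
qed

text \<open>If t lies on level i and |z| = r < r_(k+1), then |t z| < r_(min(i,k)+1), so monotonicity
  bounds the norm of the dilated product by X at level min(i, k). The staircase A dominates this
  bound, and Minkowski's inequality integrates it to a sum of tails of \<mu>.\<close>

lemma circle_mean_dilation_average:
  assumes \<mu>: "unit_interval_measure \<mu>" and f: "disc_holomorphic f" and g: "disc_holomorphic g"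
    and q: "1 < q" and p: "q < p" and s: "q < s" and pqs: "1/q = 1/p + 1/s"
    and r: "0 \<le> r" "r < dyadic_radius (Suc k)"
  shows "circle_mean q (\<lambda>z. \<integral>t. f (of_real t * z) * g (of_real t * z) \<partial>\<mu>) r
    \<le> (\<Sum>j\<le>k. dyadic_tail \<mu> j * (circle_mean p f (dyadic_radius (Suc j)) powr (1/p) * circle_mean s g (dyadic_radius (Suc j)) powr (1/s))) powr q"
proof -
  interpret mu: finite_measure \<mu> using \<mu> by (simp add: unit_interval_measure_def)
  interpret circ: finite_measure circle_measure by (rule finite_measure_circle)
  have smu[measurable_cong]: "sets \<mu> = sets borel" using \<mu> by (simp add: unit_interval_measure_def)
  have [measurable]: "f \<in> borel_measurable borel" "g \<in> borel_measurable borel"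
    using f g by (auto simp: disc_holomorphic_def)
  have r1: "r < 1" using r(2) dyadic_radius_bounds(2)[of "Suc k"] by linarith
  let ?h = "\<lambda>z. \<integral>t. f (of_real t * z) * g (of_real t * z) \<partial>\<mu>"
  have h: "disc_holomorphic ?h"
    using disc_holomorphic_dilation_average[OF \<mu> disc_holomorphic_mult[OF f g]] by simp
  have [measurable]: "?h \<in> borel_measurable borel" using h by (simp add: disc_holomorphic_def)
  define X where "X j = circle_mean p f (dyadic_radius (Suc j)) powr (1/p) * circle_mean s g (dyadic_radius (Suc j)) powr (1/s)" for j
  have X: "0 \<le> X j" for j by (simp add: X_def)
  \<comment> \<open>The indicator removes the t outside [0, 1), where f and g are not controlled;
    \<mu> does not charge them.\<close>
  define \<kappa> where "\<kappa> \<zeta> t = indicator {0..<1} t * (norm (f (of_real t * (of_real r * \<zeta>))) * norm (g (of_real t * (of_real r * \<zeta>))))" for \<zeta> :: complex and t :: real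
  define A where "A t = (\<Sum>j\<le>k. X j * indicator {dyadic_radius j..<1} t)" for t :: real
  have An: "0 \<le> A t" for t using X by (auto simp: A_def intro!: sum_nonneg mult_nonneg_nonneg)
  let ?L = "\<Sum>j\<le>k. dyadic_tail \<mu> j * X j"
  have "(\<integral>\<^sup>+\<zeta>. ennreal (norm (?h (of_real r * \<zeta>)) powr q) \<partial>circle_measure) \<le> ennreal (?L powr q)"
  proof (rule minkowski_nn_integral[where k = \<kappa> and A = A and \<mu> = \<mu>])
    show "sigma_finite_measure circle_measure" by unfold_locales
    show "finite_measure \<mu>" by unfold_locales
    show "(\<lambda>(x, t). \<kappa> x t) \<in> borel_measurable (circle_measure \<Otimes>\<^sub>M \<mu>)"
      unfolding \<kappa>_def by measurable
    show "A \<in> borel_measurable \<mu>" unfolding A_def by measurable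
    show "(\<lambda>\<zeta>. norm (?h (of_real r * \<zeta>))) \<in> borel_measurable circle_measure" by measurable
    show "0 \<le> \<kappa> \<zeta> t" for \<zeta> t by (simp add: \<kappa>_def)
    show "0 \<le> A t" for t by (rule An)
    show "0 \<le> ?L" using X by (auto intro!: sum_nonneg mult_nonneg_nonneg)
    show "(\<integral>\<^sup>+\<zeta>. ennreal (\<kappa> \<zeta> t powr q) \<partial>circle_measure) \<le> ennreal (A t powr q)" for t
    proof (cases "t \<in> {0..<1}")
      case False
      then have "\<kappa> \<zeta> t = 0" for \<zeta> by (simp add: \<kappa>_def)
      then show ?thesis by simp
    next
      case True
      then obtain i where i: "dyadic_radius i \<le> t" "t < dyadic_radius (Suc i)"
        using dyadic_radius_cover[of t] by auto
      define j where "j = min i k"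
      have jt: "dyadic_radius j \<le> t" using i(1) dyadic_radius_mono[of j i] by (simp add: j_def)
      have tr: "0 \<le> t * r" "t * r < dyadic_radius (Suc j)" "t * r < 1"
      proof -
        show "0 \<le> t * r" using True r by simp
        have "t * r \<le> t * 1" using True r1 by (intro mult_left_mono) auto
        moreover have "t * r \<le> 1 * r" using True r by (intro mult_right_mono) auto
        ultimately show "t * r < dyadic_radius (Suc j)" "t * r < 1"
          using i(2) r(2) r1 unfolding j_def by (auto simp: min_def)
      qed
      have "(\<integral>\<^sup>+\<zeta>. ennreal (\<kappa> \<zeta> t powr q) \<partial>circle_measure)
        = (\<integral>\<^sup>+\<zeta>. ennreal ((norm (f (of_real (t * r) * \<zeta>)) * norm (g (of_real (t * r) * \<zeta>))) powr q) \<partial>circle_measure)"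
        using True by (simp add: \<kappa>_def mult.assoc)
      also have "\<dots> \<le> ennreal ((circle_mean p f (t * r) powr (1/p) * circle_mean s g (t * r) powr (1/s)) powr q)"
        using q by (intro circle_mean_mult_le f g tr p s pqs) auto
      also have "\<dots> \<le> ennreal (X j powr q)"
        unfolding X_def using q p s tr
        by (intro ennreal_leI powr_mono2 mult_mono circle_mean_mono f g) auto
      also have "\<dots> \<le> ennreal (A t powr q)"
      proof (intro ennreal_leI powr_mono2)
        have "X j = X j * indicator {dyadic_radius j..<1} t" using jt True by simp
        also have "\<dots> \<le> A t" unfolding A_def
          using X by (intro member_le_sum[where f = "\<lambda>j. X j * indicator {dyadic_radius j..<1} t"]) (auto simp: j_def)
        finally show "X j \<le> A t" .
      qed (use q X in auto)
      finally show ?thesis .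
    qed
    show "(\<integral>\<^sup>+t. ennreal (A t) \<partial>\<mu>) \<le> ennreal ?L"
    proof -
      have "(\<integral>\<^sup>+t. ennreal (A t) \<partial>\<mu>) = (\<integral>\<^sup>+t. (\<Sum>j\<le>k. ennreal (X j * indicator {dyadic_radius j..<1} t)) \<partial>\<mu>)"
        unfolding A_def using X by (intro nn_integral_cong sum_ennreal[symmetric]) auto
      also have "\<dots> = (\<Sum>j\<le>k. \<integral>\<^sup>+t. ennreal (X j * indicator {dyadic_radius j..<1} t) \<partial>\<mu>)"
        by (rule nn_integral_sum) measurable
      also have "\<dots> = (\<Sum>j\<le>k. ennreal (dyadic_tail \<mu> j * X j))"
      proof (rule sum.cong[OF refl])
        fix j
        have "(\<integral>\<^sup>+t. ennreal (X j * indicator {dyadic_radius j..<1} t) \<partial>\<mu>) = (\<integral>\<^sup>+t. ennreal (X j) * indicator {dyadic_radius j..<1} t \<partial>\<mu>)"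
          by (intro nn_integral_cong) (auto split: split_indicator)
        also have "\<dots> = ennreal (X j) * emeasure \<mu> {dyadic_radius j..<1}"
          by (rule nn_integral_cmult_indicator) (simp add: smu)
        also have "\<dots> = ennreal (dyadic_tail \<mu> j * X j)"
          using X by (simp add: mu.emeasure_eq_measure dyadic_tail_def ennreal_mult[symmetric] mult.commute)
        finally show "(\<integral>\<^sup>+t. ennreal (X j * indicator {dyadic_radius j..<1} t) \<partial>\<mu>) = ennreal (dyadic_tail \<mu> j * X j)" .
      qed
      also have "\<dots> = ennreal ?L" using X by (intro sum_ennreal) auto
      finally show ?thesis by simp
    qed
    show "ennreal (norm (?h (of_real r * \<zeta>))) \<le> (\<integral>\<^sup>+t. ennreal (\<kappa> \<zeta> t) \<partial>\<mu>)" for \<zeta>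
    proof -
      have "ennreal (norm (?h (of_real r * \<zeta>))) \<le> (\<integral>\<^sup>+t. ennreal (norm (f (of_real t * (of_real r * \<zeta>)) * g (of_real t * (of_real r * \<zeta>)))) \<partial>\<mu>)"
        by (rule norm_integral_le_nn_integral)
      also have "\<dots> = (\<integral>\<^sup>+t. ennreal (\<kappa> \<zeta> t) \<partial>\<mu>)"
      proof (rule nn_integral_cong_AE)
        have "AE t in \<mu>. t \<in> {0..<1}" using \<mu> by (simp add: unit_interval_measure_def)
        then show "AE t in \<mu>. ennreal (norm (f (of_real t * (of_real r * \<zeta>)) * g (of_real t * (of_real r * \<zeta>)))) = ennreal (\<kappa> \<zeta> t)"
          by eventually_elim (simp add: \<kappa>_def norm_mult)
      qed
      finally show ?thesis .
    qed
  qed (use q in auto)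
  then show ?thesis
    unfolding X_def[symmetric] using nn_integral_circle_mean[OF h r(1) r1, of q] q by (simp add: ennreal_le_iff)
qed

definition doubling_measure :: "real measure \<Rightarrow> real \<Rightarrow> bool" where
  "doubling_measure N C \<longleftrightarrow> unit_interval_measure N \<and> 1 \<le> C \<and> (\<forall>k. 0 < dyadic_tail N k) \<and>
     (\<forall>k. dyadic_tail N k \<le> C * dyadic_tail N (Suc k))"

text \<open>The dyadic form of \<open>D_check\<close>: its ratio C > 1 over a step of factor K is
  iterated to the ratio 2 over m levels.\<close>

definition halving_measure :: "real measure \<Rightarrow> nat \<Rightarrow> bool" where
  "halving_measure N m \<longleftrightarrow> 0 < m \<and> (\<forall>k. dyadic_tail N (k + m) \<le> dyadic_tail N k / 2)"

text \<open>The order of magnitude of the sum of \<open>N_term\<close> over block k: there are 2^k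
  terms with n + 1 about 2^k, which turns \<nu>_n/(n + 1)^2 into \<nu>_k/2^k.\<close>

definition dyadic_term :: "real \<Rightarrow> real \<Rightarrow> (nat \<Rightarrow> real) \<Rightarrow> (nat \<Rightarrow> real) \<Rightarrow> (nat \<Rightarrow> real) \<Rightarrow> (nat \<Rightarrow> real) \<Rightarrow> nat \<Rightarrow> real" where
  "dyadic_term q s \<omega> \<nu> \<eta> u k = (u k * (2 ^ k / \<omega> k) * (\<eta> k / \<nu> k) powr (1/q)) powr s * (\<nu> k / 2 ^ k)"

lemma circle_mean_measurable [measurable]:
  assumes [measurable]: "f \<in> borel_measurable borel"
  shows "circle_mean p f \<in> borel_measurable borel"
proof -
  interpret finite_measure circle_measure by (rule finite_measure_circle)
  show ?thesis unfolding circle_mean_def by measurable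
qed

lemma ennreal_suminf_le:
  fixes f :: "nat \<Rightarrow> ennreal"
  assumes "\<And>n. (\<Sum>i<n. f i) \<le> B"
  shows "suminf f \<le> B"
  using assms by (intro suminf_le_const) auto

text \<open>The dilation estimate bounds the q-mean at level k by the q-th power of the sum of Y_j
  over j <= k; Hardy's inequality reduces the level sum to that of Y_j^q. Hoelder's inequality with
  exponents p/q and s/q then separates the norm of f from the s-th powers that make up
  \<open>dyadic_term\<close>.\<close>

lemma dilation_average_sufficiency:
  assumes q: "1 < q" and p: "q < p" and s: "q < s" and pqs: "1/q = 1/p + 1/s"
    and nu: "doubling_measure \<nu> C\<nu>" "halving_measure \<nu> m\<nu>" and eta: "doubling_measure \<eta> C\<eta>" "halving_measure \<eta> m\<eta>"
    and g: "disc_holomorphic g" and \<omega>: "\<And>k. 0 < \<omega> k" and A: "0 < A"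
    and gA: "\<And>k. circle_mean s g (dyadic_radius (Suc k)) \<le> A * (2 ^ k / \<omega> k) powr s / 2 ^ k"
  obtains c where "0 < c"
    "\<And>\<mu> f F X. unit_interval_measure \<mu> \<Longrightarrow> disc_holomorphic f \<Longrightarrow> 0 \<le> F \<Longrightarrow> 0 \<le> X \<Longrightarrow>
       (\<integral>\<^sup>+r. ennreal (2 * r * circle_mean p f r) \<partial>\<nu>) \<le> ennreal F \<Longrightarrow>
       (\<And>J. (\<Sum>k<J. dyadic_term q s \<omega> (dyadic_tail \<nu>) (dyadic_tail \<eta>) (dyadic_tail \<mu>) k) \<le> X) \<Longrightarrow>
       (\<integral>\<^sup>+r. ennreal (2 * r * circle_mean q (\<lambda>z. \<integral>t. f (of_real t * z) * g (of_real t * z) \<partial>\<mu>) r) \<partial>\<eta>)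
         \<le> ennreal (c * X powr (q/s) * F powr (q/p))"
proof -
  let ?n = "dyadic_tail \<nu>" and ?e = "dyadic_tail \<eta>"
  have un: "unit_interval_measure \<nu>" "1 \<le> C\<nu>" "\<And>k. 0 < ?n k" "\<And>k. ?n k \<le> C\<nu> * ?n (Suc k)" "\<And>k. ?n (k + m\<nu>) \<le> ?n k / 2"
    using nu by (auto simp: doubling_measure_def halving_measure_def)
  have ue: "unit_interval_measure \<eta>" "\<And>k. 0 < ?e k" "0 < m\<eta>" "\<And>k. ?e (k + m\<eta>) \<le> ?e k / 2"
    using eta by (auto simp: doubling_measure_def halving_measure_def)
  \<comment> \<open>The decay rate of the tails of \<eta> per level, with a q-th root because the
    Schur bound works with \<tau>^(1/q).\<close>
  define a where "a = (2 powr (- 1 / real m\<eta>)) powr (1/q)"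
  have a: "0 < a" "a < 1"
  proof -
    have "2 powr (- 1 / real m\<eta>) < 2 powr 0" using ue(3) by (intro powr_less_mono) auto
    then have "2 powr (- 1 / real m\<eta>) < 1" by simp
    then have "(2 powr (- 1 / real m\<eta>)) powr (1/q) < 1 powr (1/q)" using q by (intro powr_less_mono2) auto
    then show "0 < a" "a < 1" by (auto simp: a_def)
  qed
  define S where "S = (2 powr (1/q) * (2 / (1 - a))) powr q"
  have S: "0 < S" using a by (auto simp: S_def)
  define c where "c = 2 * S * ((2 * C\<nu> * real m\<nu>) powr (q/p) * A powr (q/s)) + 1"
  have c: "0 < c" using S by (auto simp: c_def intro!: add_nonneg_pos mult_nonneg_nonneg)
  have "(\<integral>\<^sup>+r. ennreal (2 * r * circle_mean q (\<lambda>z. \<integral>t. f (of_real t * z) * g (of_real t * z) \<partial>\<mu>) r) \<partial>\<eta>)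
         \<le> ennreal (c * X powr (q/s) * F powr (q/p))"
    if \<mu>: "unit_interval_measure \<mu>" and f: "disc_holomorphic f" and F: "0 \<le> F" and X: "0 \<le> X"
      and fF: "(\<integral>\<^sup>+r. ennreal (2 * r * circle_mean p f r) \<partial>\<nu>) \<le> ennreal F"
      and dX: "\<And>J. (\<Sum>k<J. dyadic_term q s \<omega> ?n ?e (dyadic_tail \<mu>) k) \<le> X" for \<mu> f F X
  proof -
    let ?u = "dyadic_tail \<mu>"
    define H where "H j = circle_mean p f (dyadic_radius (Suc j))" for j
    define G where "G j = circle_mean s g (dyadic_radius (Suc j))" for j
    define Y where "Y j = ?u j * (H j powr (1/p) * G j powr (1/s))" for j
    have HG: "0 \<le> H j" "0 \<le> G j" "0 \<le> Y j" for j by (auto simp: H_def G_def Y_def)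
    have hardy: "(\<Sum>k<J. ?e k * (\<Sum>j\<le>k. Y j) powr q) \<le> S * (\<Sum>j<J. ?e j * Y j powr q)" for J
    proof -
      have "(\<Sum>k<J. ?e k * (\<Sum>j\<le>k. Y j) powr q) = (\<Sum>k<J. ?e k * (\<Sum>j<J. (if j \<le> k then 1 else 0) * Y j) powr q)"
      proof (rule sum.cong[OF refl])
        fix k assume "k \<in> {..<J}"
        then have "(\<Sum>j\<le>k. Y j) = (\<Sum>j<J. (if j \<le> k then 1 else 0) * Y j)"
          by (intro sum.mono_neutral_cong_left) auto
        then show "?e k * (\<Sum>j\<le>k. Y j) powr q = ?e k * (\<Sum>j<J. (if j \<le> k then 1 else 0) * Y j) powr q"
          by (simp only:)
      qed
      also have "\<dots> \<le> S * (\<Sum>j<J. ?e j * Y j powr q)"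
        unfolding S_def
      proof (rule weighted_schur_sum[OF q a])
        fix k j
        \<comment> \<open>The kernel vanishes for j > k, so only the decay of the tails of \<eta>
          from j to k >= j enters.\<close>
        show "?e k powr (1/q) * (if j \<le> k then 1 else 0) \<le> 2 powr (1/q) * a ^ ((k - j) + (j - k)) * ?e j powr (1/q)"
        proof (cases "j \<le> k")
          case True
          have "?e k \<le> 2 * (2 powr (- 1 / real m\<eta>)) ^ (k - j) * ?e j"
            using ue True by (intro halving_geometric_decay dyadic_tail_antimono) auto
          then have "?e k powr (1/q) \<le> (2 * (2 powr (- 1 / real m\<eta>)) ^ (k - j) * ?e j) powr (1/q)"
            using q by (intro powr_mono2) auto
          also have "\<dots> = 2 powr (1/q) * ((2 powr (- 1 / real m\<eta>)) ^ (k - j)) powr (1/q) * ?e j powr (1/q)"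
            by (simp only: powr_mult)
          also have "((2 powr (- 1 / real m\<eta>)) ^ (k - j)) powr (1/q) = a ^ (k - j)"
            unfolding a_def by (simp add: powr_realpow[symmetric] powr_powr mult.commute)
          finally show ?thesis using True by simp
        qed (use a in auto)
      qed (use HG in auto)
      finally show ?thesis .
    qed
    \<comment> \<open>The factor \<nu>_j^(q/p) is inserted and removed so that the first factor
      becomes a power of \<nu>_j H_j, the level term for the norm of f.\<close>
    have point: "?e j * Y j powr q = (?n j * H j) powr (q/p) * (?e j * ?u j powr q * G j powr (q/s) * ?n j powr (- (q/p)))" for j
    proof -
      have "?n j powr (q/p) * ?n j powr (- (q/p)) = 1" using un(3)[of j] by (simp add: powr_add[symmetric])
      moreover have "Y j powr q = ?u j powr q * H j powr (q/p) * G j powr (q/s)"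
        by (simp add: Y_def powr_mult powr_powr)
      moreover have "(?n j * H j) powr (q/p) = ?n j powr (q/p) * H j powr (q/p)" by (rule powr_mult)
      ultimately show ?thesis by (simp add: mult_ac)
    qed
    have qs: "q/p + q/s = 1"
    proof -
      have "q * (1/q) = q * (1/p + 1/s)" using pqs by simp
      then show ?thesis using q by (simp add: algebra_simps)
    qed
    \<comment> \<open>Since q/p + q/s = 1, the exponent -(q/p)(s/q) is 1 - s/q, which is the total
      power of \<nu>_j in \<open>dyadic_term\<close>; \<open>gA\<close> supplies the order of the
      s-mean of g.\<close>
    have dterm: "(?e j * ?u j powr q * G j powr (q/s) * ?n j powr (- (q/p))) powr (s/q) \<le> A * dyadic_term q s \<omega> ?n ?e ?u j" for j
    proof -
      have "(?e j * ?u j powr q * G j powr (q/s) * ?n j powr (- (q/p))) powr (s/q)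
        = ?e j powr (s/q) * ?u j powr s * G j * ?n j powr (- (q/p) * (s/q))"
        using q s HG by (simp add: powr_mult powr_powr)
      also have "- (q/p) * (s/q) = 1 - s/q"
      proof -
        have "(q/p) * (s/q) + 1 = (q/p + q/s) * (s/q)" using q s by (simp add: algebra_simps)
        then show ?thesis unfolding qs by (simp add: algebra_simps)
      qed
      also have "?e j powr (s/q) * ?u j powr s * G j * ?n j powr (1 - s/q) \<le> ?e j powr (s/q) * ?u j powr s * (A * (2 ^ j / \<omega> j) powr s / 2 ^ j) * ?n j powr (1 - s/q)"
        using gA[of j] by (intro mult_right_mono mult_left_mono) (auto simp: G_def)
      also have "\<dots> = A * dyadic_term q s \<omega> ?n ?e ?u j"
      proof -
        have "?n j powr (1 - s/q) = ?n j / ?n j powr (s/q)" using un(3)[of j] by (simp add: powr_diff)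
        moreover have "((?e j / ?n j) powr (1/q)) powr s = ?e j powr (s/q) / ?n j powr (s/q)"
          using un(3)[of j] ue(2)[of j] by (simp add: powr_powr powr_divide mult.commute)
        ultimately show ?thesis unfolding dyadic_term_def by (simp only: powr_mult) (simp add: mult_ac)
      qed
      finally show ?thesis .
    qed
    have sumH: "(\<Sum>k<J. ?n k * H k) \<le> 2 * C\<nu> * real m\<nu> * F" for J
    proof -
      have "ennreal (\<Sum>k<J. ?n k * H k) = (\<Sum>k<J. ennreal (?n k * H k))"
        using HG by (intro sum_ennreal[symmetric]) auto
      also have "\<dots> \<le> ennreal (2 * C\<nu> * real m\<nu>) * (\<integral>\<^sup>+r. ennreal (2 * r * circle_mean p f r) \<partial>\<nu>)"
        unfolding H_def using un q p f
        by (intro dyadic_lower_sum circle_mean_mono circle_mean_measurable) (auto simp: disc_holomorphic_def)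
      also have "\<dots> \<le> ennreal (2 * C\<nu> * real m\<nu>) * ennreal F" by (intro mult_left_mono fF) auto
      also have "\<dots> = ennreal (2 * C\<nu> * real m\<nu> * F)" using un F by (simp add: ennreal_mult)
      finally show ?thesis using un F by (subst (asm) ennreal_le_iff) auto
    qed
    have holder: "(\<Sum>j<J. ?e j * Y j powr q) \<le> (2 * C\<nu> * real m\<nu> * F) powr (q/p) * (A * X) powr (q/s)" for J
    proof -
      have e: "1 < p/q" "1 < s/q" "1/(p/q) + 1/(s/q) = 1" using q p s qs by auto
      have "(\<Sum>j<J. ?e j * Y j powr q) \<le>
         (\<Sum>j<J. ((?n j * H j) powr (q/p)) powr (p/q)) powr (1/(p/q)) *
         (\<Sum>j<J. (?e j * ?u j powr q * G j powr (q/s) * ?n j powr (- (q/p))) powr (s/q)) powr (1/(s/q))"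
        unfolding point by (rule holder_sum[OF finite_lessThan e]) auto
      also have "(\<Sum>j<J. ((?n j * H j) powr (q/p)) powr (p/q)) = (\<Sum>j<J. ?n j * H j)"
        using q p HG by (intro sum.cong) (auto simp: powr_powr)
      also have "1/(p/q) = q/p" by simp
      also have "1/(s/q) = q/s" by simp
      also have "(\<Sum>j<J. ?n j * H j) powr (q/p) * (\<Sum>j<J. (?e j * ?u j powr q * G j powr (q/s) * ?n j powr (- (q/p))) powr (s/q)) powr (q/s)
          \<le> (2 * C\<nu> * real m\<nu> * F) powr (q/p) * (A * X) powr (q/s)"
      proof (intro mult_mono powr_mono2 sumH)
        have "(\<Sum>j<J. (?e j * ?u j powr q * G j powr (q/s) * ?n j powr (- (q/p))) powr (s/q)) \<le> (\<Sum>j<J. A * dyadic_term q s \<omega> ?n ?e ?u j)"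
          by (intro sum_mono dterm)
        also have "\<dots> \<le> A * X" unfolding sum_distrib_left[symmetric] using A by (intro mult_left_mono dX) auto
        finally show "(\<Sum>j<J. (?e j * ?u j powr q * G j powr (q/s) * ?n j powr (- (q/p))) powr (s/q)) \<le> A * X" .
      qed (use q p s HG in \<open>auto intro!: sum_nonneg mult_nonneg_nonneg\<close>)
      finally show ?thesis .
    qed
    have "(\<integral>\<^sup>+r. ennreal (2 * r * circle_mean q (\<lambda>z. \<integral>t. f (of_real t * z) * g (of_real t * z) \<partial>\<mu>) r) \<partial>\<eta>)
       \<le> (\<Sum>k. ennreal (2 * ?e k * (\<Sum>j\<le>k. Y j) powr q))"
    proof (rule dyadic_upper_sum[OF ue(1)])
      fix k r assume r: "dyadic_radius k \<le> r" "r < dyadic_radius (Suc k)"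
      then have "0 \<le> r" using dyadic_radius_bounds(1)[of k] by linarith
      then show "circle_mean q (\<lambda>z. \<integral>t. f (of_real t * z) * g (of_real t * z) \<partial>\<mu>) r \<le> (\<Sum>j\<le>k. Y j) powr q"
        unfolding Y_def H_def G_def using r by (intro circle_mean_dilation_average \<mu> f g q p s pqs)
    qed simp
    also have "\<dots> \<le> ennreal (c * X powr (q/s) * F powr (q/p))"
    proof (rule ennreal_suminf_le)
      fix J
      have "(\<Sum>k<J. ennreal (2 * ?e k * (\<Sum>j\<le>k. Y j) powr q)) = ennreal (\<Sum>k<J. 2 * ?e k * (\<Sum>j\<le>k. Y j) powr q)"
        by (intro sum_ennreal) auto
      also have "\<dots> \<le> ennreal (c * X powr (q/s) * F powr (q/p))"
      proof (rule ennreal_leI)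
        have "(\<Sum>k<J. 2 * ?e k * (\<Sum>j\<le>k. Y j) powr q) = 2 * (\<Sum>k<J. ?e k * (\<Sum>j\<le>k. Y j) powr q)"
          by (simp add: sum_distrib_left mult.assoc)
        also have "\<dots> \<le> 2 * (S * ((2 * C\<nu> * real m\<nu> * F) powr (q/p) * (A * X) powr (q/s)))"
          using order_trans[OF hardy[of J] mult_left_mono[OF holder[of J] less_imp_le[OF S]]] by simp
        also have "\<dots> = (2 * S * ((2 * C\<nu> * real m\<nu>) powr (q/p) * A powr (q/s))) * (X powr (q/s) * F powr (q/p))"
          by (simp only: powr_mult mult_ac)
        also have "\<dots> \<le> c * (X powr (q/s) * F powr (q/p))"
          unfolding c_def by (intro mult_right_mono) auto
        finally show "(\<Sum>k<J. 2 * ?e k * (\<Sum>j\<le>k. Y j) powr q) \<le> c * X powr (q/s) * F powr (q/p)"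
          by (simp only: mult.assoc)
      qed
      finally show "(\<Sum>k<J. ennreal (2 * ?e k * (\<Sum>j\<le>k. Y j) powr q)) \<le> ennreal (c * X powr (q/s) * F powr (q/p))" .
    qed
    finally show ?thesis .
  qed
  with c show ?thesis using that by blast
qed

section \<open>Necessity\<close>

lemma dyadic_radius_le_1 [simp]: "dyadic_radius k \<le> 1"
  by (rule less_imp_le) simp

text \<open>The triangle inequality for p-means, with real bounds b_j for the norms: Jensen's
  inequality with the weights y_j b_j is applied to |F_j|/b_j.\<close>

lemma circle_mean_sum_le:
  assumes J: "finite J" and p: "1 < p" and r: "0 \<le> r" "r < 1"
    and F: "\<And>j. j \<in> J \<Longrightarrow> disc_holomorphic (F j)" and f: "disc_holomorphic f"
    and y: "\<And>j. j \<in> J \<Longrightarrow> 0 \<le> y j" and b: "\<And>j. j \<in> J \<Longrightarrow> 0 < b j"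
    and fF: "\<And>z. norm z = r \<Longrightarrow> norm (f z) \<le> (\<Sum>j\<in>J. y j * norm (F j z))"
    and Fb: "\<And>j. j \<in> J \<Longrightarrow> circle_mean p (F j) r \<le> b j powr p"
  shows "circle_mean p f r \<le> (\<Sum>j\<in>J. y j * b j) powr p"
proof -
  let ?W = "\<Sum>j\<in>J. y j * b j"
  let ?v = "\<lambda>j. ?W powr (p - 1) * (y j * b j / b j powr p)"
  have W: "0 \<le> ?W" using y b by (intro sum_nonneg mult_nonneg_nonneg) (auto simp: less_imp_le)
  have Fm: "(\<lambda>\<zeta>. norm (F j (of_real r * \<zeta>)) powr p) \<in> borel_measurable circle_measure" if "j \<in> J" for j
  proof -
    have [measurable]: "F j \<in> borel_measurable borel" using F[OF that] by (simp add: disc_holomorphic_def)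
    show ?thesis by measurable
  qed
  have v: "0 \<le> ?v j" if "j \<in> J" for j using y[OF that] b[OF that] by simp
  have "ennreal (circle_mean p f r) = (\<integral>\<^sup>+\<zeta>. ennreal (norm (f (of_real r * \<zeta>)) powr p) \<partial>circle_measure)"
    using nn_integral_circle_mean[OF f r, of p] p by simp
  also have "\<dots> \<le> (\<integral>\<^sup>+\<zeta>. (\<Sum>j\<in>J. ennreal (?v j) * ennreal (norm (F j (of_real r * \<zeta>)) powr p)) \<partial>circle_measure)"
  proof (rule nn_integral_mono_AE, rule eventually_mono[OF AE_circle_norm])
    fix \<zeta> :: complex assume z: "norm \<zeta> = 1"
    let ?z = "of_real r * \<zeta>"
    have nz: "norm ?z = r" using z r by (simp add: norm_mult)
    have "norm (f ?z) \<le> (\<Sum>j\<in>J. y j * norm (F j ?z))" by (rule fF[OF nz])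
    also have "\<dots> = (\<Sum>j\<in>J. (y j * b j) * (norm (F j ?z) / b j))"
      using b by (intro sum.cong) (auto dest: b)
    finally have "norm (f ?z) powr p \<le> (\<Sum>j\<in>J. (y j * b j) * (norm (F j ?z) / b j)) powr p"
      using p by (intro powr_mono2) auto
    also have "\<dots> \<le> ?W powr (p - 1) * (\<Sum>j\<in>J. (y j * b j) * (norm (F j ?z) / b j) powr p)"
      using y b by (intro jensen_powr_sum J p) (auto simp: less_imp_le)
    also have "\<dots> = (\<Sum>j\<in>J. ?v j * norm (F j ?z) powr p)"
      unfolding sum_distrib_left by (intro sum.cong) (auto simp: powr_divide less_imp_le b)
    finally have "ennreal (norm (f ?z) powr p) \<le> ennreal (\<Sum>j\<in>J. ?v j * norm (F j ?z) powr p)" by (rule ennreal_leI)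
    also have "\<dots> = (\<Sum>j\<in>J. ennreal (?v j * norm (F j ?z) powr p))"
      by (rule sum_ennreal[symmetric]) (rule mult_nonneg_nonneg[OF v], auto)
    also have "\<dots> = (\<Sum>j\<in>J. ennreal (?v j) * ennreal (norm (F j ?z) powr p))"
      using v by (intro sum.cong ennreal_mult refl) auto
    finally show "ennreal (norm (f ?z) powr p) \<le> (\<Sum>j\<in>J. ennreal (?v j) * ennreal (norm (F j ?z) powr p))" .
  qed
  also have "\<dots> = (\<Sum>j\<in>J. \<integral>\<^sup>+\<zeta>. ennreal (?v j) * ennreal (norm (F j (of_real r * \<zeta>)) powr p) \<partial>circle_measure)"
    using Fm by (intro nn_integral_sum borel_measurable_times_ennreal) auto
  also have "\<dots> \<le> (\<Sum>j\<in>J. ennreal (?W powr (p - 1) * (y j * b j)))"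
  proof (intro sum_mono)
    fix j assume j: "j \<in> J"
    have "(\<integral>\<^sup>+\<zeta>. ennreal (?v j) * ennreal (norm (F j (of_real r * \<zeta>)) powr p) \<partial>circle_measure)
      = ennreal (?v j) * (\<integral>\<^sup>+\<zeta>. ennreal (norm (F j (of_real r * \<zeta>)) powr p) \<partial>circle_measure)"
      using Fm[OF j] by (intro nn_integral_cmult) auto
    also have "\<dots> = ennreal (?v j) * ennreal (circle_mean p (F j) r)"
      using nn_integral_circle_mean[OF F[OF j] r, of p] p by simp
    also have "\<dots> \<le> ennreal (?v j) * ennreal (b j powr p)"
      by (intro mult_left_mono ennreal_leI Fb j) auto
    also have "\<dots> = ennreal (?W powr (p - 1) * (y j * b j))"
      using v[OF j] b[OF j] by (subst ennreal_mult[symmetric]) auto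
    finally show "(\<integral>\<^sup>+\<zeta>. ennreal (?v j) * ennreal (norm (F j (of_real r * \<zeta>)) powr p) \<partial>circle_measure) \<le> ennreal (?W powr (p - 1) * (y j * b j))" .
  qed
  also have "\<dots> = ennreal (\<Sum>j\<in>J. ?W powr (p - 1) * (y j * b j))"
    using y b by (intro sum_ennreal mult_nonneg_nonneg) (auto simp: less_imp_le)
  also have "(\<Sum>j\<in>J. ?W powr (p - 1) * (y j * b j)) = ?W powr p"
  proof -
    have "?W powr (p - 1) * ?W = ?W powr p"
      using W powr_add[of ?W "p - 1" 1] by (cases "?W = 0") auto
    then show ?thesis by (simp only: sum_distrib_left)
  qed
  finally show ?thesis by (simp add: ennreal_le_iff)
qed

text \<open>The factor 2^j is 1/(1 - r_j), so the modulus is at most 1 on the disc and of order 1 at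
  z = r_j: a bump of width 2^-j at the boundary point 1, which decays faster for larger M.\<close>

definition cauchy_power :: "nat \<Rightarrow> nat \<Rightarrow> complex \<Rightarrow> complex" where
  "cauchy_power M j z = (if norm z < 1 then (1 / (2 ^ j * (1 - of_real (dyadic_radius j) * z))) ^ M else 0)"

lemma cauchy_denominator_nonzero:
  fixes z :: complex
  assumes "norm z < 1"
  shows "1 - of_real (dyadic_radius j) * z \<noteq> 0"
proof -
  have "norm (of_real (dyadic_radius j) * z) \<le> 1 * norm z"
    unfolding norm_mult norm_of_real using dyadic_radius_bounds[of j] by (intro mult_right_mono) auto
  then have "norm (of_real (dyadic_radius j) * z) < 1" using assms by linarith
  then show ?thesis by auto
qed

lemma disc_holomorphic_cauchy_power: "disc_holomorphic (cauchy_power M j)"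
  unfolding cauchy_power_def
proof (rule disc_holomorphic_truncate)
  have "2 ^ j * (1 - of_real (dyadic_radius j) * z) \<noteq> 0" if "z \<in> ball 0 1" for z :: complex
  proof -
    have "1 - of_real (dyadic_radius j) * z \<noteq> 0" using that by (intro cauchy_denominator_nonzero) simp
    then show ?thesis by (simp only: mult_eq_0_iff) simp
  qed
  then show "(\<lambda>z. (1 / (2 ^ j * (1 - of_real (dyadic_radius j) * z))) ^ M) holomorphic_on ball 0 1"
    by (intro holomorphic_on_power holomorphic_on_divide holomorphic_on_mult holomorphic_on_diff holomorphic_on_const holomorphic_on_ident)
qed

text \<open>1 - r_j r_(k+1) is at least 2^(-min(j,k)-1), which is inserted into the kernel integral
  with exponent Mp. For k >= j the bound has order 2^-j; for k < j it gains a factor 2^(-(Mp-1)) per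
  level, as small as desired for large M.\<close>

lemma cauchy_power_mean_bound:
  assumes p: "1 < p" and M: "0 < M"
  obtains C where "0 < C"
    "\<And>j k. circle_mean p (cauchy_power M j) (dyadic_radius (Suc k)) \<le> C * (2 powr (- (real M * p - 1))) ^ (j - k) / 2 ^ j"
proof -
  let ?s = "real M * p"
  have "1 * 1 < real M * p" using M p by (intro mult_le_less_imp_less) auto
  then have s: "1 < ?s" by simp
  obtain C where C: "0 < C" "\<And>x. 0 \<le> x \<Longrightarrow> x < 1 \<Longrightarrow>
       (\<integral>\<^sup>+\<zeta>. ennreal (norm (1 - of_real x * \<zeta>) powr (- ?s)) \<partial>circle_measure) \<le> ennreal (C * (1 - x) powr (1 - ?s))"
    using circle_kernel_bound[OF s] by blast
  have "circle_mean p (cauchy_power M j) (dyadic_radius (Suc k)) \<le> C * 2 powr (?s - 1) * (2 powr (- (?s - 1))) ^ (j - k) / 2 ^ j" for j k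
  proof -
    let ?r = "dyadic_radius (Suc k)" and ?x = "dyadic_radius j * dyadic_radius (Suc k)"
    have x: "0 \<le> ?x" "?x < 1"
    proof -
      have "?x \<le> dyadic_radius j * 1"
        by (rule mult_left_mono[OF less_imp_le[OF dyadic_radius_bounds(2)] dyadic_radius_bounds(1)])
      then show "?x < 1" using dyadic_radius_bounds(2)[of j] by linarith
      show "0 \<le> ?x" by (intro mult_nonneg_nonneg dyadic_radius_bounds)
    qed
    have lower: "(1/2) ^ Suc (min j k) \<le> 1 - ?x"
    proof -
      have 1: "?x \<le> dyadic_radius j * 1"
        by (rule mult_left_mono[OF less_imp_le[OF dyadic_radius_bounds(2)] dyadic_radius_bounds(1)])
      have 2: "?x \<le> 1 * dyadic_radius (Suc k)"
        by (rule mult_right_mono[OF less_imp_le[OF dyadic_radius_bounds(2)] dyadic_radius_bounds(1)])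
      show ?thesis
      proof (cases "j \<le> k")
        case True
        have 3: "(1/2::real) ^ Suc j \<le> (1/2) ^ j" by (intro power_decreasing) auto
        have m: "min j k = j" using True by simp
        show ?thesis unfolding m using 1 3 dyadic_radius_def[of j] by linarith
      next
        case False
        then have "min j k = k" by simp
        moreover have "(1/2::real) ^ Suc k = 1 - dyadic_radius (Suc k)" by (simp add: dyadic_radius_def)
        ultimately show ?thesis using 2 by simp
      qed
    qed
    have "ennreal (circle_mean p (cauchy_power M j) ?r) = (\<integral>\<^sup>+\<zeta>. ennreal (norm (cauchy_power M j (of_real ?r * \<zeta>)) powr p) \<partial>circle_measure)"
      using nn_integral_circle_mean[OF disc_holomorphic_cauchy_power dyadic_radius_bounds, of p M j "Suc k"] p by simp
    also have "\<dots> = (\<integral>\<^sup>+\<zeta>. ennreal ((2 ^ j) powr (- ?s)) * ennreal (norm (1 - of_real ?x * \<zeta>) powr (- ?s)) \<partial>circle_measure)"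
    proof (rule nn_integral_cong_AE, rule eventually_mono[OF AE_circle_norm])
      fix \<zeta> :: complex assume z: "norm \<zeta> = 1"
      have nz: "norm (of_real ?r * \<zeta>) < 1" using z dyadic_radius_bounds[of "Suc k"] by (simp add: norm_mult)
      let ?d = "2 ^ j * norm (1 - of_real ?x * \<zeta>)"
      have d: "0 < ?d" using cauchy_denominator_nonzero[OF nz, of j] by (simp add: mult.assoc)
      have "norm (cauchy_power M j (of_real ?r * \<zeta>)) = (1 / ?d) ^ M"
        using nz by (simp add: cauchy_power_def norm_power norm_divide norm_mult mult.assoc)
      also have "\<dots> = ?d powr (- real M)"
        using d by (simp add: powr_minus powr_realpow power_one_over inverse_eq_divide)
      finally have "norm (cauchy_power M j (of_real ?r * \<zeta>)) powr p = ?d powr (- ?s)"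
        by (simp add: powr_powr)
      also have "\<dots> = (2 ^ j) powr (- ?s) * norm (1 - of_real ?x * \<zeta>) powr (- ?s)" by (rule powr_mult)
      finally show "ennreal (norm (cauchy_power M j (of_real ?r * \<zeta>)) powr p) = ennreal ((2 ^ j) powr (- ?s)) * ennreal (norm (1 - of_real ?x * \<zeta>) powr (- ?s))"
        by (simp add: ennreal_mult)
    qed
    also have "\<dots> = ennreal ((2 ^ j) powr (- ?s)) * (\<integral>\<^sup>+\<zeta>. ennreal (norm (1 - of_real ?x * \<zeta>) powr (- ?s)) \<partial>circle_measure)"
      by (rule nn_integral_cmult) measurable
    also have "\<dots> \<le> ennreal ((2 ^ j) powr (- ?s)) * ennreal (C * (1 - ?x) powr (1 - ?s))"
      by (intro mult_left_mono C(2) x) auto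
    also have "\<dots> = ennreal ((2 ^ j) powr (- ?s) * (C * (1 - ?x) powr (1 - ?s)))"
      using C by (intro ennreal_mult[symmetric]) auto
    also have "\<dots> \<le> ennreal (C * 2 powr (?s - 1) * (2 powr (- (?s - 1))) ^ (j - k) / 2 ^ j)"
    proof (rule ennreal_leI)
      have "(1 - ?x) powr (1 - ?s) \<le> ((1/2) ^ Suc (min j k)) powr (1 - ?s)"
        using s lower by (intro powr_mono2') auto
      also have "((1/2) ^ Suc (min j k)) powr (1 - ?s) = 2 powr (real (Suc (min j k)) * (?s - 1))"
      proof -
        have "(1/2::real) ^ Suc (min j k) = 2 powr (- real (Suc (min j k)))"
          by (simp only: powr_minus powr_realpow[OF zero_less_numeral] power_one_over inverse_eq_divide)
        then show ?thesis by (simp only: powr_powr) (simp add: algebra_simps)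
      qed
      finally have 1: "(1 - ?x) powr (1 - ?s) \<le> 2 powr (real (Suc (min j k)) * (?s - 1))" .
      have 2: "(2 ^ j) powr (- ?s) = (2::real) powr (- (real j * ?s))"
        by (simp add: powr_realpow[symmetric] powr_powr)
      have "(2 ^ j) powr (- ?s) * (C * (1 - ?x) powr (1 - ?s)) \<le> 2 powr (- (real j * ?s)) * (C * 2 powr (real (Suc (min j k)) * (?s - 1)))"
        unfolding 2 using C 1 by (intro mult_left_mono) auto
      also have "\<dots> = C * 2 powr (- (real j * ?s) + real (Suc (min j k)) * (?s - 1))"
        by (simp only: powr_add mult_ac)
      also have "- (real j * ?s) + real (Suc (min j k)) * (?s - 1) = (?s - 1) + (- (?s - 1) * real (j - k)) + (- real j)"
      proof (cases "j \<le> k")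
        case True then show ?thesis by (simp add: min_def algebra_simps)
      next
        case False
        then have "real (j - k) = real j - real k" by (intro of_nat_diff) simp
        then show ?thesis using False by (simp add: min_def algebra_simps)
      qed
      also have "C * 2 powr ((?s - 1) + (- (?s - 1) * real (j - k)) + (- real j)) = C * 2 powr (?s - 1) * (2 powr (- (?s - 1))) ^ (j - k) / 2 ^ j"
      proof -
        have "2 powr (- (?s - 1) * real (j - k)) = (2 powr (- (?s - 1))) powr real (j - k)" by (rule powr_powr[symmetric])
        also have "\<dots> = (2 powr (- (?s - 1))) ^ (j - k)" by (rule powr_realpow) simp
        finally have a: "2 powr (- (?s - 1) * real (j - k)) = (2 powr (- (?s - 1))) ^ (j - k)" .
        have b: "2 powr (- real j) = 1 / 2 ^ j" by (simp add: powr_minus_divide powr_realpow)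
        show ?thesis unfolding powr_add a b by (simp only: mult.assoc times_divide_eq_right mult_1_right)
      qed
      finally show "(2 ^ j) powr (- ?s) * (C * (1 - ?x) powr (1 - ?s)) \<le> C * 2 powr (?s - 1) * (2 powr (- (?s - 1))) ^ (j - k) / 2 ^ j" .
    qed
    finally show ?thesis using C by (subst (asm) ennreal_le_iff) auto
  qed
  then show ?thesis using that[of "C * 2 powr (?s - 1)"] C by simp
qed

definition test_function :: "nat \<Rightarrow> (nat \<Rightarrow> real) \<Rightarrow> nat \<Rightarrow> complex \<Rightarrow> complex" where
  "test_function M y J z = (\<Sum>j<J. of_real (y j) * cauchy_power M j z)"

lemma disc_holomorphic_test_function: "disc_holomorphic (test_function M y J)"
proof -
  have "cauchy_power M j holomorphic_on ball 0 1" "cauchy_power M j \<in> borel_measurable borel" for j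
    using disc_holomorphic_cauchy_power[of M j] by (auto simp: disc_holomorphic_def)
  note [measurable] = this(2) and hol = this(1)
  show ?thesis unfolding disc_holomorphic_def test_function_def
    by (intro conjI holomorphic_on_sum holomorphic_on_mult holomorphic_on_const hol) measurable
qed

text \<open>The interaction of bump j with level k is controlled by the Schur bound. For j <= k the
  tails of \<nu> decay; for j > k the tail at k may exceed the tail at j by C\<nu> per level, and
  the decay of the bump must beat this. That fixes M, independently of the coefficients y.\<close>

lemma test_function_norm_bound:
  assumes p: "1 < p" and nu: "doubling_measure \<nu> C\<nu>" "halving_measure \<nu> m"
  obtains M c where "0 < M" "0 < c"
    "\<And>J y. (\<And>j. 0 \<le> y j) \<Longrightarrow> (\<integral>\<^sup>+r. ennreal (2 * r * circle_mean p (test_function M y J) r) \<partial>\<nu>)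
      \<le> ennreal (c * (\<Sum>j<J. dyadic_tail \<nu> j / 2 ^ j * y j powr p))"
proof -
  let ?n = "dyadic_tail \<nu>"
  have un: "unit_interval_measure \<nu>" "1 \<le> C\<nu>" "\<And>k. 0 < ?n k" "\<And>k. ?n k \<le> C\<nu> * ?n (Suc k)" "\<And>k. ?n (k + m) \<le> ?n k / 2" "0 < m"
    using nu by (auto simp: doubling_measure_def halving_measure_def)
  \<comment> \<open>M = M0 + 1 gives M p - 1 >= M0, so the bumps gain at least the factor 2^(-M0) <
    1/(2 C\<nu>) per level, and C\<nu> times this is at most 1/2 <= \<theta>.\<close>
  obtain M0 where M0: "2 * C\<nu> < 2 ^ M0" using real_arch_pow[of 2 "2 * C\<nu>"] by auto
  define M where "M = Suc M0"
  have M: "0 < M" by (simp add: M_def)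
  obtain C where C: "0 < C" "\<And>j k. circle_mean p (cauchy_power M j) (dyadic_radius (Suc k)) \<le> C * (2 powr (- (real M * p - 1))) ^ (j - k) / 2 ^ j"
    using cauchy_power_mean_bound[OF p M] by blast
  define \<beta> where "\<beta> = 2 powr (- (real M * p - 1))"
  define \<theta> where "\<theta> = 2 powr (- 1 / real m)"
  have beta: "0 < \<beta>" "C\<nu> * \<beta> \<le> \<theta>"
  proof -
    show "0 < \<beta>" by (simp add: \<beta>_def)
    have "real M * 1 \<le> real M * p" using p by (intro mult_left_mono) auto
    moreover have "real M = real M0 + 1" by (simp add: M_def)
    ultimately have "- (real M * p - 1) \<le> - real M0" by linarith
    then have "\<beta> \<le> 2 powr (- real M0)" unfolding \<beta>_def by (rule powr_mono) simp
    also have "\<dots> = 1 / 2 ^ M0" by (simp add: powr_minus_divide powr_realpow)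
    finally have "C\<nu> * \<beta> \<le> C\<nu> * (1 / 2 ^ M0)" using un(2) by (intro mult_left_mono) auto
    also have "\<dots> \<le> 1/2" using M0 by (simp add: field_simps)
    also have "(1/2::real) = 2 powr (- 1)" by (simp add: powr_minus_divide)
    also have "\<dots> \<le> \<theta>" unfolding \<theta>_def using un(6) by (intro powr_mono) (auto simp: field_simps)
    finally show "C\<nu> * \<beta> \<le> \<theta>" .
  qed
  define a where "a = \<theta> powr (1/p)"
  have th: "0 < \<theta>" "\<theta> < 1"
  proof -
    have "2 powr (- 1 / real m) < 2 powr 0" using un(6) by (intro powr_less_mono) auto
    then show "0 < \<theta>" "\<theta> < 1" by (auto simp: \<theta>_def)
  qed
  have a: "0 < a" "a < 1"
  proof -
    have "\<theta> powr (1/p) < 1 powr (1/p)" using p th by (intro powr_less_mono2) auto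
    then show "0 < a" "a < 1" using th by (auto simp: a_def)
  qed
  have apow: "(\<theta> ^ i) powr (1/p) = a ^ i" for i
    unfolding a_def using th by (simp add: powr_realpow[symmetric] powr_powr mult.commute)
  define S where "S = (2 powr (1/p) * (2 / (1 - a))) powr p"
  define c where "c = 2 * (S * C)"
  have c: "0 < c" using a C by (auto simp: c_def S_def)
  have "(\<integral>\<^sup>+r. ennreal (2 * r * circle_mean p (test_function M y J) r) \<partial>\<nu>) \<le> ennreal (c * (\<Sum>j<J. ?n j / 2 ^ j * y j powr p))"
    if y: "\<And>j. 0 \<le> y j" for J y
  proof -
    let ?f = "test_function M y J"
    \<comment> \<open>Extended by 0 beyond J, so that both indices of the Schur sum can run up to a
      common K >= J.\<close>
    define Y where "Y j = (if j < J then y j else 0)" for j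
    have Y: "0 \<le> Y j" for j using y by (simp add: Y_def)
    define X where "X j = (C / 2 ^ j) powr (1/p) * Y j" for j
    define \<kappa> where "\<kappa> k j = (\<beta> ^ (j - k)) powr (1/p)" for k j :: nat
    have X: "0 \<le> X j" for j using Y by (simp add: X_def)
    have level: "circle_mean p ?f (dyadic_radius (Suc k)) \<le> (\<Sum>j<K. \<kappa> k j * X j) powr p" if "J \<le> K" for k K
    proof -
      have "circle_mean p ?f (dyadic_radius (Suc k)) \<le> (\<Sum>j\<in>{..<J}. y j * ((C / 2 ^ j) powr (1/p) * \<kappa> k j)) powr p"
      proof (rule circle_mean_sum_le[where F = "cauchy_power M"])
        show "norm (?f z) \<le> (\<Sum>j\<in>{..<J}. y j * norm (cauchy_power M j z))" for z
          unfolding test_function_def using y by (intro order_trans[OF norm_sum]) (auto simp: norm_mult)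
        show "circle_mean p (cauchy_power M j) (dyadic_radius (Suc k)) \<le> ((C / 2 ^ j) powr (1/p) * \<kappa> k j) powr p" for j
        proof -
          have "((C / 2 ^ j) powr (1/p) * \<kappa> k j) powr p = C / 2 ^ j * \<beta> ^ (j - k)"
            unfolding \<kappa>_def powr_mult powr_powr using p C beta by simp
          then show ?thesis using C(2)[of j k] by (simp add: \<beta>_def)
        qed
        show "0 < (C / 2 ^ j) powr (1/p) * \<kappa> k j" for j using C beta by (simp add: \<kappa>_def)
      qed (use p y in \<open>auto intro: disc_holomorphic_cauchy_power disc_holomorphic_test_function\<close>)
      also have "(\<Sum>j\<in>{..<J}. y j * ((C / 2 ^ j) powr (1/p) * \<kappa> k j)) = (\<Sum>j<K. \<kappa> k j * X j)"
        using that by (intro sum.mono_neutral_cong_left) (auto simp: X_def Y_def)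
      finally show ?thesis .
    qed
    have schur: "(\<Sum>k<K. ?n k * (\<Sum>j<K. \<kappa> k j * X j) powr p) \<le> S * (\<Sum>j<K. ?n j * X j powr p)" for K
      unfolding S_def
    proof (rule weighted_schur_sum[OF p a])
      fix k j
      show "?n k powr (1/p) * \<kappa> k j \<le> 2 powr (1/p) * a ^ ((k - j) + (j - k)) * ?n j powr (1/p)"
      proof -
        have "?n k * \<beta> ^ (j - k) \<le> 2 * \<theta> ^ ((k - j) + (j - k)) * ?n j"
        proof (cases "j \<le> k")
          case True
          have "?n k \<le> 2 * \<theta> ^ (k - j) * ?n j"
            unfolding \<theta>_def using un True by (intro halving_geometric_decay dyadic_tail_antimono) auto
          then show ?thesis using True by simp
        next
          case False
          then have kj: "k \<le> j" by simp
          have "?n k \<le> C\<nu> ^ (j - k) * ?n (k + (j - k))"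
            using un by (intro dyadic_tail_doubling_iterate[where \<tau> = ?n]) auto
          then have "?n k * \<beta> ^ (j - k) \<le> (C\<nu> ^ (j - k) * ?n j) * \<beta> ^ (j - k)"
            using kj beta by (intro mult_right_mono) auto
          also have "\<dots> = (C\<nu> * \<beta>) ^ (j - k) * ?n j" by (simp add: power_mult_distrib)
          also have "\<dots> \<le> \<theta> ^ (j - k) * ?n j"
            using beta un(2) by (intro mult_right_mono power_mono) auto
          also have "\<dots> \<le> 2 * \<theta> ^ (j - k) * ?n j" using th by (intro mult_right_mono) auto
          finally show ?thesis using kj by simp
        qed
        then have "(?n k * \<beta> ^ (j - k)) powr (1/p) \<le> (2 * \<theta> ^ ((k - j) + (j - k)) * ?n j) powr (1/p)"
          using p beta by (intro powr_mono2) auto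
        then show ?thesis unfolding powr_mult apow \<kappa>_def .
      qed
    qed (use X beta in \<open>auto simp: \<kappa>_def\<close>)
    have "(\<integral>\<^sup>+r. ennreal (2 * r * circle_mean p ?f r) \<partial>\<nu>) \<le> (\<Sum>k. ennreal (2 * ?n k * circle_mean p ?f (dyadic_radius (Suc k))))"
    proof (rule dyadic_upper_sum[OF un(1)])
      fix k r assume r: "dyadic_radius k \<le> r" "r < dyadic_radius (Suc k)"
      have "0 \<le> r" using r(1) dyadic_radius_bounds(1)[of k] by linarith
      then show "circle_mean p ?f r \<le> circle_mean p ?f (dyadic_radius (Suc k))"
        using r p by (intro circle_mean_mono disc_holomorphic_test_function) auto
    qed simp
    also have "\<dots> \<le> ennreal (c * (\<Sum>j<J. ?n j / 2 ^ j * y j powr p))"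
    proof (rule ennreal_suminf_le)
      fix K0
      define K where "K = max K0 J"
      have K: "J \<le> K" "K0 \<le> K" by (auto simp: K_def)
      have "(\<Sum>k<K0. ennreal (2 * ?n k * circle_mean p ?f (dyadic_radius (Suc k)))) = ennreal (\<Sum>k<K0. 2 * ?n k * circle_mean p ?f (dyadic_radius (Suc k)))"
        by (intro sum_ennreal) auto
      also have "\<dots> \<le> ennreal (c * (\<Sum>j<J. ?n j / 2 ^ j * y j powr p))"
      proof (rule ennreal_leI)
        have "(\<Sum>k<K0. 2 * ?n k * circle_mean p ?f (dyadic_radius (Suc k))) \<le> (\<Sum>k<K. 2 * ?n k * circle_mean p ?f (dyadic_radius (Suc k)))"
          using K by (intro sum_mono2) auto
        also have "\<dots> \<le> (\<Sum>k<K. 2 * ?n k * (\<Sum>j<K. \<kappa> k j * X j) powr p)"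
          using K by (intro sum_mono mult_left_mono level) auto
        also have "\<dots> = 2 * (\<Sum>k<K. ?n k * (\<Sum>j<K. \<kappa> k j * X j) powr p)" by (simp add: sum_distrib_left mult.assoc)
        also have "\<dots> \<le> 2 * (S * (\<Sum>j<K. ?n j * X j powr p))" by (intro mult_left_mono schur) auto
        also have "(\<Sum>j<K. ?n j * X j powr p) = (\<Sum>j<J. C * (?n j / 2 ^ j * y j powr p))"
        proof (rule sum.mono_neutral_cong_right)
          show "?n j * X j powr p = C * (?n j / 2 ^ j * y j powr p)" if "j \<in> {..<J}" for j
          proof -
            have "X j powr p = C / 2 ^ j * y j powr p"
              unfolding X_def powr_mult powr_powr using that p C by (simp add: Y_def)
            then show ?thesis by simp
          qed
        qed (use K in \<open>auto simp: X_def Y_def\<close>)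
        also have "\<dots> = C * (\<Sum>j<J. ?n j / 2 ^ j * y j powr p)" by (simp only: sum_distrib_left)
        finally show "(\<Sum>k<K0. 2 * ?n k * circle_mean p ?f (dyadic_radius (Suc k))) \<le> c * (\<Sum>j<J. ?n j / 2 ^ j * y j powr p)"
          by (simp only: c_def mult.assoc)
      qed
      finally show "(\<Sum>k<K0. ennreal (2 * ?n k * circle_mean p ?f (dyadic_radius (Suc k)))) \<le> ennreal (c * (\<Sum>j<J. ?n j / 2 ^ j * y j powr p))" .
    qed
    finally show ?thesis .
  qed
  with M c show ?thesis using that by blast
qed

text \<open>The growth estimate between r_k and r_(k+1), where 1 - r_k/r_(k+1) >= 2^(-k-1), bounds
  the value at r_k by the circle mean at r_(k+1); the level sum of these means is controlled by the
  radial integral.\<close>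

lemma radial_sum_lower_bound:
  assumes q: "1 < q" and eta: "doubling_measure \<eta> C\<eta>" "halving_measure \<eta> m"
  obtains c where "0 < c"
    "\<And>g G J. disc_holomorphic g \<Longrightarrow> 0 \<le> G \<Longrightarrow> (\<integral>\<^sup>+r. ennreal (2 * r * circle_mean q g r) \<partial>\<eta>) \<le> ennreal G \<Longrightarrow>
       (\<Sum>k<J. dyadic_tail \<eta> k / 2 ^ k * norm (g (of_real (dyadic_radius k))) powr q) \<le> c * G"
proof -
  let ?e = "dyadic_tail \<eta>"
  have ue: "unit_interval_measure \<eta>" "1 \<le> C\<eta>" "\<And>k. 0 < ?e k" "\<And>k. ?e k \<le> C\<eta> * ?e (Suc k)" "\<And>k. ?e (k + m) \<le> ?e k / 2" "0 < m"
    using eta by (auto simp: doubling_measure_def halving_measure_def)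
  obtain C where C: "0 < C" "\<And>f x R. disc_holomorphic f \<Longrightarrow> 0 \<le> x \<Longrightarrow> x < R \<Longrightarrow> R < 1 \<Longrightarrow>
       norm (f (of_real x)) powr q * (1 - x / R) \<le> C * circle_mean q f R"
    using disc_point_growth[OF q] by blast
  have "(\<Sum>k<J. ?e k / 2 ^ k * norm (g (of_real (dyadic_radius k))) powr q) \<le> 2 * C * (2 * C\<eta> * real m) * G"
    if g: "disc_holomorphic g" and G: "0 \<le> G" "(\<integral>\<^sup>+r. ennreal (2 * r * circle_mean q g r) \<partial>\<eta>) \<le> ennreal G" for g G J
  proof -
    have "(\<Sum>k<J. ?e k / 2 ^ k * norm (g (of_real (dyadic_radius k))) powr q) \<le> (\<Sum>k<J. 2 * C * (?e k * circle_mean q g (dyadic_radius (Suc k))))"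
    proof (intro sum_mono)
      fix k
      let ?a = "norm (g (of_real (dyadic_radius k))) powr q"
      have gr: "?a * (1 - dyadic_radius k / dyadic_radius (Suc k)) \<le> C * circle_mean q g (dyadic_radius (Suc k))"
        by (rule C(2)[OF g]) auto
      have pos: "0 < dyadic_radius (Suc k)" using dyadic_radius_less_iff[of 0 "Suc k"] by simp
      have "1 / 2 ^ k / 2 = dyadic_radius (Suc k) - dyadic_radius k" by (simp add: dyadic_radius_def power_one_over)
      also have "\<dots> \<le> (dyadic_radius (Suc k) - dyadic_radius k) / dyadic_radius (Suc k)"
      proof -
        have "0 \<le> dyadic_radius (Suc k) - dyadic_radius k" using dyadic_radius_mono[of k "Suc k"] by simp
        from mult_left_mono[OF less_imp_le[OF dyadic_radius_bounds(2)[of "Suc k"]] this]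
        show ?thesis using pos by (simp only: pos_le_divide_eq mult_1_right)
      qed
      also have "\<dots> = 1 - dyadic_radius k / dyadic_radius (Suc k)" using pos by (simp add: diff_divide_distrib)
      finally have "?a * (1 / 2 ^ k / 2) \<le> ?a * (1 - dyadic_radius k / dyadic_radius (Suc k))" by (intro mult_left_mono) auto
      with gr have "?a * (1 / 2 ^ k / 2) \<le> C * circle_mean q g (dyadic_radius (Suc k))" by linarith
      then have "?e k * (?a * (1 / 2 ^ k / 2)) \<le> ?e k * (C * circle_mean q g (dyadic_radius (Suc k)))" by (intro mult_left_mono) auto
      then show "?e k / 2 ^ k * ?a \<le> 2 * C * (?e k * circle_mean q g (dyadic_radius (Suc k)))" by (simp add: mult_ac)
    qed
    also have "\<dots> = 2 * C * (\<Sum>k<J. ?e k * circle_mean q g (dyadic_radius (Suc k)))" by (simp only: sum_distrib_left)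
    also have "\<dots> \<le> 2 * C * ((2 * C\<eta> * real m) * G)"
    proof (intro mult_left_mono)
      have "ennreal (\<Sum>k<J. ?e k * circle_mean q g (dyadic_radius (Suc k))) = (\<Sum>k<J. ennreal (?e k * circle_mean q g (dyadic_radius (Suc k))))"
        by (intro sum_ennreal[symmetric]) auto
      also have "\<dots> \<le> ennreal (2 * C\<eta> * real m) * (\<integral>\<^sup>+r. ennreal (2 * r * circle_mean q g r) \<partial>\<eta>)"
        using ue q g by (intro dyadic_lower_sum circle_mean_mono circle_mean_measurable) (auto simp: disc_holomorphic_def)
      also have "\<dots> \<le> ennreal (2 * C\<eta> * real m) * ennreal G" by (intro mult_left_mono G) auto
      also have "\<dots> = ennreal (2 * C\<eta> * real m * G)" using ue G by (simp add: ennreal_mult)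
      finally show "(\<Sum>k<J. ?e k * circle_mean q g (dyadic_radius (Suc k))) \<le> 2 * C\<eta> * real m * G"
        using ue G by (subst (asm) ennreal_le_iff) auto
    qed (use C in auto)
    finally show ?thesis by (simp only: mult.assoc)
  qed
  moreover have "0 < 2 * C * (2 * C\<eta> * real m)" using C ue by simp
  ultimately show ?thesis using that by blast
qed

lemma geometric_power_lower:
  fixes y :: real
  assumes "0 \<le> y" "y < 1"
  shows "real n * y ^ (n - 1) \<le> 1 / (1 - y)"
proof -
  have "real n * y ^ (n - 1) = (\<Sum>i<n. y ^ (n - 1))" by simp
  also have "\<dots> \<le> (\<Sum>i<n. y ^ i)" using assms by (intro sum_mono power_decreasing) auto
  also have "\<dots> \<le> (\<Sum>i. y ^ i)" using assms by (intro sum_le_suminf summable_geometric) auto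
  also have "\<dots> = 1 / (1 - y)" using assms by (intro suminf_geometric) auto
  finally show ?thesis .
qed

text \<open>A lower bound of the bump by a power of x, for x = t r_k, is what produces moments of
  \<mu> after integration in t. It comes from 2^k y^(2^k - 1) <= 1 + y + ... + y^(2^k - 1) <= 1/(1 -
  y).\<close>

lemma cauchy_power_lower:
  assumes x: "0 \<le> x" "x < 1"
  shows "cauchy_power M k (of_real x) = of_real ((1 / (2 ^ k * (1 - dyadic_radius k * x))) ^ M)"
    and "(dyadic_radius k * x) ^ (M * (2 ^ k - 1)) \<le> (1 / (2 ^ k * (1 - dyadic_radius k * x))) ^ M"
proof -
  show "cauchy_power M k (of_real x) = of_real ((1 / (2 ^ k * (1 - dyadic_radius k * x))) ^ M)"
    using x by (simp add: cauchy_power_def)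
  let ?y = "dyadic_radius k * x"
  have "?y \<le> 1 * x" using x by (intro mult_right_mono) auto
  then have y: "0 \<le> ?y" "?y < 1" using x by auto
  have "2 ^ k * ?y ^ (2 ^ k - 1) \<le> 1 / (1 - ?y)" using geometric_power_lower[OF y, of "2 ^ k"] by simp
  then have "?y ^ (2 ^ k - 1) \<le> 1 / (2 ^ k * (1 - ?y))" using y by (simp add: field_simps)
  then have "(?y ^ (2 ^ k - 1)) ^ M \<le> (1 / (2 ^ k * (1 - ?y))) ^ M" using y by (intro power_mono) auto
  then show "?y ^ (M * (2 ^ k - 1)) \<le> (1 / (2 ^ k * (1 - ?y))) ^ M"
    by (simp add: power_mult[symmetric] mult.commute)
qed

text \<open>Only block k is kept: it has 2^k coefficients, all at least a, and exponents up to 2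
  (2^k - 1).\<close>

lemma kernel_fun_lower:
  assumes s: "\<And>k. summable (\<lambda>n. lam n * dyadic_radius k ^ n)" and nn: "\<And>n. 0 \<le> lam n"
    and low: "\<And>n. n \<in> dyadic_block k \<Longrightarrow> a \<le> lam n" and a: "0 \<le> a" and x: "0 \<le> x" "x < 1"
  shows "a * 2 ^ k * x ^ (2 * (2 ^ k - 1)) \<le> (\<Sum>n. lam n * x ^ n)"
proof -
  have "a * 2 ^ k * x ^ (2 * (2 ^ k - 1)) = (\<Sum>n\<in>dyadic_block k. a * x ^ (2 * (2 ^ k - 1)))"
    by (simp add: card_dyadic_block)
  also have "\<dots> \<le> (\<Sum>n\<in>dyadic_block k. lam n * x ^ n)"
  proof (intro sum_mono mult_mono low)
    fix n assume n: "n \<in> dyadic_block k"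
    then show "x ^ (2 * (2 ^ k - 1)) \<le> x ^ n"
      using x by (intro power_decreasing) (auto simp: dyadic_block_def)
  qed (use nn x in auto)
  also have "\<dots> \<le> (\<Sum>n. lam n * x ^ n)"
    using nn x kernel_fun_of_real(1)[where lam = lam, OF s x] by (intro sum_le_suminf) auto
  finally show ?thesis .
qed

text \<open>The moment exponent collects \<open>M (2\<^sup>k - 1)\<close> from the test function and \<open>2 (2\<^sup>k - 1)\<close> from the kernel.\<close>

lemma dilation_average_radial_lower:
  assumes \<mu>: "unit_interval_measure \<mu>"
    and s: "\<And>k. summable (\<lambda>n. lam n * dyadic_radius k ^ n)" and nn: "\<And>n. 0 \<le> lam n"
    and low: "\<And>n. n \<in> dyadic_block k \<Longrightarrow> a \<le> lam n" and a: "0 \<le> a"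
    and y: "\<And>j. 0 \<le> y j" and k: "k < J"
  shows "exp (- (2 * real M + 2)) * a * 2 ^ k * y k * (\<integral>t. t ^ ((M + 2) * (2 ^ k - 1)) \<partial>\<mu>)
    \<le> norm (\<integral>t. test_function M y J (of_real t * of_real (dyadic_radius k)) * kernel_fun lam (of_real t * of_real (dyadic_radius k)) \<partial>\<mu>)"
proof -
  interpret mu: finite_measure \<mu> using \<mu> by (simp add: unit_interval_measure_def)
  have smu[measurable_cong]: "sets \<mu> = sets borel" using \<mu> by (simp add: unit_interval_measure_def)
  have AEt: "AE t in \<mu>. t \<in> {0..<1}" using \<mu> by (simp add: unit_interval_measure_def)
  let ?r = "dyadic_radius k" and ?n = "2 ^ k - 1 :: nat"
  let ?h = "\<lambda>z. test_function M y J z * kernel_fun lam z"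
  have h: "disc_holomorphic ?h"
    by (intro disc_holomorphic_mult disc_holomorphic_test_function disc_holomorphic_kernel s)
  have hm[measurable]: "?h \<in> borel_measurable borel" using h by (simp add: disc_holomorphic_def)
  have meas: "(\<lambda>t. ?h (of_real (t * ?r))) \<in> borel_measurable \<mu>" using hm by measurable
  \<comment> \<open>For t < 1 the arguments t r_k stay in the closed disc of radius r_k, where the
    product is bounded; this gives integrability.\<close>
  obtain B where B: "0 \<le> B" "\<And>z. norm z \<le> ?r \<Longrightarrow> norm (?h z) \<le> B"
    using disc_holomorphic_bounded[OF h, of ?r] dyadic_radius_bounds(2)[of k] by blast
  have tr: "0 \<le> t * ?r" "t * ?r \<le> ?r" "t * ?r < 1" if "t \<in> {0..<1}" for t
  proof -
    show "0 \<le> t * ?r" using that by simp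
    have "t * ?r \<le> 1 * ?r" using that by (intro mult_right_mono) auto
    then show "t * ?r \<le> ?r" "t * ?r < 1" using dyadic_radius_bounds(2)[of k] by linarith+
  qed
  have int: "integrable \<mu> (\<lambda>t. ?h (of_real (t * ?r)))"
  proof (rule mu.integrable_const_bound[OF _ meas])
    show "AE t in \<mu>. norm (?h (of_real (t * ?r))) \<le> B"
      using AEt by eventually_elim (rule B(2), use tr in \<open>simp del: of_real_mult\<close>)
  qed
  define c where "c = exp (- (2 * real M + 2)) * a * 2 ^ k * y k"
  have point: "c * t ^ ((M + 2) * ?n) \<le> Re (?h (of_real (t * ?r)))" if t: "t \<in> {0..<1}" for t
  proof -
    define x where "x = t * ?r"
    have x: "0 \<le> x" "x < 1" using tr[OF t] by (auto simp: x_def)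
    define P where "P j = (1 / (2 ^ j * (1 - dyadic_radius j * x))) ^ M" for j
    define L where "L = (\<Sum>n. lam n * x ^ n)"
    have P: "0 \<le> P j" for j
    proof -
      have "(0::real) \<le> (dyadic_radius j * x) ^ (M * (2 ^ j - 1))" using x by (intro zero_le_power mult_nonneg_nonneg) auto
      then show ?thesis using cauchy_power_lower(2)[OF x, of j M] unfolding P_def by linarith
    qed
    have tf: "test_function M y J (of_real x) = of_real (\<Sum>j<J. y j * P j)"
      unfolding test_function_def P_def using cauchy_power_lower(1)[OF x] by simp
    have "Re (?h (of_real x)) = (\<Sum>j<J. y j * P j) * L"
      unfolding tf L_def kernel_fun_of_real(2)[where lam = lam, OF s x] by (simp flip: of_real_mult)
    \<comment> \<open>All bumps and kernel coefficients are nonnegative on the radius, so the test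
      function may be reduced to its k-th bump.\<close>
    moreover have "(y k * (?r * x) ^ (M * ?n)) * (a * 2 ^ k * x ^ (2 * ?n)) \<le> (\<Sum>j<J. y j * P j) * L"
    proof (rule mult_mono)
      have "y k * (?r * x) ^ (M * ?n) \<le> y k * P k"
        unfolding P_def by (intro mult_left_mono cauchy_power_lower(2) x y)
      also have "\<dots> \<le> (\<Sum>j<J. y j * P j)" using k y P by (intro member_le_sum) auto
      finally show "y k * (?r * x) ^ (M * ?n) \<le> (\<Sum>j<J. y j * P j)" .
      show "a * 2 ^ k * x ^ (2 * ?n) \<le> L" unfolding L_def by (rule kernel_fun_lower[OF s nn low a x])
      show "0 \<le> (\<Sum>j<J. y j * P j)" using y P by (intro sum_nonneg mult_nonneg_nonneg) auto
      show "0 \<le> a * 2 ^ k * x ^ (2 * ?n)" using a x by simp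
    qed
    moreover have "c * t ^ ((M + 2) * ?n) \<le> (y k * (?r * x) ^ (M * ?n)) * (a * 2 ^ k * x ^ (2 * ?n))"
    proof -
      \<comment> \<open>With x = t r_k the radius occurs to the power (2M + 2)(2^k - 1), and
        r_k^(2^k - 1) >= 1/e; this is the origin of the constant e^(-(2M+2)).\<close>
      have "(?r * x) ^ (M * ?n) * x ^ (2 * ?n) = (?r ^ ?n) ^ (2 * M + 2) * t ^ ((M + 2) * ?n)"
      proof -
        have "?r ^ (M * ?n) * (t * ?r) ^ (M * ?n) * (t * ?r) ^ (2 * ?n) = ?r ^ (M * ?n + M * ?n + 2 * ?n) * t ^ (M * ?n + 2 * ?n)"
          by (simp only: power_mult_distrib power_add mult_ac)
        also have "M * ?n + M * ?n + 2 * ?n = ?n * (2 * M + 2)" by (simp only: algebra_simps mult_2)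
        also have "M * ?n + 2 * ?n = (M + 2) * ?n" by (simp only: distrib_right)
        also have "?r ^ (?n * (2 * M + 2)) = (?r ^ ?n) ^ (2 * M + 2)" by (rule power_mult)
        finally show ?thesis by (simp only: x_def power_mult_distrib)
      qed
      moreover have "exp (- (2 * real M + 2)) \<le> (?r ^ ?n) ^ (2 * M + 2)"
      proof -
        have "exp (- (2 * real M + 2)) = exp (- 1 :: real) ^ (2 * M + 2)"
          unfolding exp_of_nat_mult[symmetric] by simp
        also have "\<dots> \<le> (?r ^ ?n) ^ (2 * M + 2)" by (intro power_mono dyadic_radius_power_lower) auto
        finally show ?thesis .
      qed
      then have "exp (- (2 * real M + 2)) * (t ^ ((M + 2) * ?n) * (a * 2 ^ k * y k)) \<le> (?r ^ ?n) ^ (2 * M + 2) * (t ^ ((M + 2) * ?n) * (a * 2 ^ k * y k))"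
        using t a y by (intro mult_right_mono) auto
      ultimately show ?thesis unfolding c_def by (simp only: mult_ac)
    qed
    ultimately show ?thesis unfolding x_def[symmetric] by linarith
  qed
  have "c * (\<integral>t. t ^ ((M + 2) * ?n) \<partial>\<mu>) = (\<integral>t. c * t ^ ((M + 2) * ?n) \<partial>\<mu>)"
    by (rule integral_mult_right_zero[symmetric])
  also have "\<dots> \<le> (\<integral>t. Re (?h (of_real (t * ?r))) \<partial>\<mu>)"
  proof (rule integral_mono_AE)
    show "integrable \<mu> (\<lambda>t. c * t ^ ((M + 2) * ?n))"
      by (intro integrable_mult_right integrable_unit_interval_power \<mu>)
    show "integrable \<mu> (\<lambda>t. Re (?h (of_real (t * ?r))))" using int by (rule integrable_Re)
    show "AE t in \<mu>. c * t ^ ((M + 2) * ?n) \<le> Re (?h (of_real (t * ?r)))"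
      using AEt by eventually_elim (rule point)
  qed
  also have "\<dots> = Re (\<integral>t. ?h (of_real (t * ?r)) \<partial>\<mu>)" by (rule integral_Re[OF int])
  also have "\<dots> \<le> norm (\<integral>t. ?h (of_real (t * ?r)) \<partial>\<mu>)" by (rule complex_Re_le_cmod)
  finally show ?thesis by (simp only: c_def of_real_mult)
qed

text \<open>Boundedness with constant B in terms of powers of the norms: F bounds the p-th power of
  the norm of f, so F^(q/p) bounds its q-th power.\<close>

definition dilation_bound :: "real \<Rightarrow> real \<Rightarrow> real measure \<Rightarrow> real measure \<Rightarrow> (complex \<Rightarrow> complex) \<Rightarrow> real measure \<Rightarrow> real \<Rightarrow> bool" where
  "dilation_bound p q \<nu> \<eta> g \<mu> B \<longleftrightarrow> (\<forall>f F. disc_holomorphic f \<longrightarrow> 0 \<le> F \<longrightarrow>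
     (\<integral>\<^sup>+r. ennreal (2 * r * circle_mean p f r) \<partial>\<nu>) \<le> ennreal F \<longrightarrow>
     (\<integral>\<^sup>+r. ennreal (2 * r * circle_mean q (\<lambda>z. \<integral>t. f (of_real t * z) * g (of_real t * z) \<partial>\<mu>) r) \<partial>\<eta>)
       \<le> ennreal (B powr q * F powr (q/p)))"

text \<open>With coefficients extremal for Hoelder's inequality, the bound for the p-th power of the
  norm of f and the lower bound for the q-th power of the norm of its image are multiples of the
  same partial sum T. M and c come before \<mu>, B and J, which makes the estimate uniform.\<close>

lemma dilation_average_necessity:
  assumes q: "1 < q" and p: "q < p" and s: "q < s" and pqs: "1/q = 1/p + 1/s"
    and nu: "doubling_measure \<nu> C\<nu>" "halving_measure \<nu> m\<nu>" and eta: "doubling_measure \<eta> C\<eta>" "halving_measure \<eta> m\<eta>"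
    and sm: "\<And>k. summable (\<lambda>n. lam n * dyadic_radius k ^ n)" and nn: "\<And>n. 0 \<le> lam n"
    and \<omega>: "\<And>k. 0 < \<omega> k" and A: "0 < A" and low: "\<And>n k. n \<in> dyadic_block k \<Longrightarrow> A / \<omega> k \<le> lam n"
  shows "\<exists>M c. 0 < c \<and> (\<forall>\<mu> B J. unit_interval_measure \<mu> \<longrightarrow> 0 \<le> B \<longrightarrow> dilation_bound p q \<nu> \<eta> (kernel_fun lam) \<mu> B \<longrightarrow>
       (\<Sum>k<J. dyadic_term q s \<omega> (dyadic_tail \<nu>) (dyadic_tail \<eta>) (\<lambda>k. \<integral>t. t ^ ((M + 2) * (2 ^ k - 1)) \<partial>\<mu>) k) \<le> c * B powr s)"
proof -
  let ?n = "dyadic_tail \<nu>" and ?e = "dyadic_tail \<eta>"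
  have pos: "0 < ?n k" "0 < ?e k" for k using nu eta by (auto simp: doubling_measure_def)
  have p1: "1 < p" using p q by simp
  have qs: "q/s = 1 - q/p"
  proof -
    have "q * (1/q) = q * (1/p + 1/s)" using pqs by simp
    then show ?thesis using q by (simp add: algebra_simps)
  qed
  have sq: "s/q = p / (p - q)"
  proof -
    have "q/s = (p - q) / p" using p q by (simp add: qs field_simps)
    then have "inverse (q/s) = inverse ((p - q) / p)" by simp
    then show ?thesis by simp
  qed
  obtain M c1 where M: "0 < M" and c1: "0 < c1"
    "\<And>J y. (\<And>j. 0 \<le> y j) \<Longrightarrow> (\<integral>\<^sup>+r. ennreal (2 * r * circle_mean p (test_function M y J) r) \<partial>\<nu>)
      \<le> ennreal (c1 * (\<Sum>j<J. ?n j / 2 ^ j * y j powr p))"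
    using test_function_norm_bound[OF p1 nu] by blast
  obtain c2 where c2: "0 < c2"
    "\<And>g G J. disc_holomorphic g \<Longrightarrow> 0 \<le> G \<Longrightarrow> (\<integral>\<^sup>+r. ennreal (2 * r * circle_mean q g r) \<partial>\<eta>) \<le> ennreal G \<Longrightarrow>
       (\<Sum>k<J. ?e k / 2 ^ k * norm (g (of_real (dyadic_radius k))) powr q) \<le> c2 * G"
    using radial_sum_lower_bound[OF q eta] by blast
  define d where "d = exp (- (2 * real M + 2)) * A"
  have d: "0 < d" using A by (simp add: d_def)
  define K where "K = c2 * c1 powr (q/p) / d powr q"
  have K: "0 < K" using c1 c2 d by (simp add: K_def)
  define c where "c = K powr (s/q)"
  have c: "0 < c" using K by (simp add: c_def)
  have "(\<Sum>k<J. dyadic_term q s \<omega> ?n ?e (\<lambda>k. \<integral>t. t ^ ((M + 2) * (2 ^ k - 1)) \<partial>\<mu>) k) \<le> c * B powr s"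
    if \<mu>: "unit_interval_measure \<mu>" and B: "0 \<le> B"
      and bound: "dilation_bound p q \<nu> \<eta> (kernel_fun lam) \<mu> B" for \<mu> B J
  proof -
    have bd: "(\<integral>\<^sup>+r. ennreal (2 * r * circle_mean q (\<lambda>z. \<integral>t. f (of_real t * z) * kernel_fun lam (of_real t * z) \<partial>\<mu>) r) \<partial>\<eta>)
            \<le> ennreal (B powr q * F powr (q/p))"
      if "disc_holomorphic f" "0 \<le> F" "(\<integral>\<^sup>+r. ennreal (2 * r * circle_mean p f r) \<partial>\<nu>) \<le> ennreal F" for f F
      using bound that unfolding dilation_bound_def by blast
    define u where "u k = (\<integral>t. t ^ ((M + 2) * (2 ^ k - 1)) \<partial>\<mu>)" for k
    have u: "0 \<le> u k" for k
    proof -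
      have "AE t in \<mu>. t \<in> {0..<1}" using \<mu> by (simp add: unit_interval_measure_def)
      then have "AE t in \<mu>. 0 \<le> t ^ ((M + 2) * (2 ^ k - 1))" by eventually_elim simp
      then show ?thesis unfolding u_def by (rule integral_nonneg_AE)
    qed
    define Q where "Q k = u k * (2 ^ k / \<omega> k)" for k
    have Q: "0 \<le> Q k" for k using u[of k] \<omega>[of k] by (simp add: Q_def)
    define E N where "E k = ?e k / 2 ^ k" and "N k = ?n k / 2 ^ k" for k
    have EN: "0 < E k" "0 < N k" for k using pos[of k] by (simp_all add: E_def N_def)
    \<comment> \<open>Solves N y^p = E Q^q y^q, the case of equality in Hoelder's
      inequality.\<close>
    define y where "y k = (E k * Q k powr q / N k) powr (1 / (p - q))" for k
    have y: "0 \<le> y k" for k by (simp add: y_def)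
    define T where "T = (\<Sum>k<J. N k * y k powr p)"
    have T: "0 \<le> T" unfolding T_def using EN by (intro sum_nonneg mult_nonneg_nonneg) (auto simp: less_imp_le)
    have y1: "N k * y k powr p = E k * Q k powr q * y k powr q" for k
    proof -
      have z: "0 \<le> E k * Q k powr q / N k" using EN[of k] by simp
      have "y k powr (p - q) = E k * Q k powr q / N k"
      proof -
        have e: "1 / (p - q) * (p - q) = 1" using p by simp
        show ?thesis unfolding y_def powr_powr e by (rule powr_one[OF z])
      qed
      moreover have "y k powr p = y k powr (p - q) * y k powr q" by (simp add: powr_add[symmetric])
      ultimately show ?thesis using EN[of k] by simp
    qed
    \<comment> \<open>The identity s/q = p/(p - q) makes the common terms of the two sums equal to
      \<open>dyadic_term\<close>.\<close>
    have y2: "N k * y k powr p = dyadic_term q s \<omega> ?n ?e u k" for k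
    proof -
      have "y k powr p = (E k * Q k powr q / N k) powr (s/q)"
        unfolding y_def powr_powr sq by simp
      also have "E k * Q k powr q / N k = Q k powr q * (?e k / ?n k)" by (simp add: E_def N_def)
      also have "(Q k powr q * (?e k / ?n k)) powr (s/q) = (Q k * (?e k / ?n k) powr (1/q)) powr s"
        using q Q[of k] by (simp only: powr_mult powr_powr) simp
      finally show ?thesis unfolding dyadic_term_def N_def Q_def by (simp add: mult.commute)
    qed
    let ?f = "test_function M y J"
    let ?g = "\<lambda>z. \<integral>t. ?f (of_real t * z) * kernel_fun lam (of_real t * z) \<partial>\<mu>"
    have g: "disc_holomorphic ?g"
      using disc_holomorphic_dilation_average[OF \<mu> disc_holomorphic_mult[OF disc_holomorphic_test_function disc_holomorphic_kernel[where lam = lam, OF sm]]] by simp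
    have "(\<integral>\<^sup>+r. ennreal (2 * r * circle_mean p ?f r) \<partial>\<nu>) \<le> ennreal (c1 * T)"
      unfolding T_def N_def by (rule c1(2)[OF y])
    then have gB: "(\<integral>\<^sup>+r. ennreal (2 * r * circle_mean q ?g r) \<partial>\<eta>) \<le> ennreal (B powr q * (c1 * T) powr (q/p))"
      using c1 T by (intro bd disc_holomorphic_test_function) auto
    have "d powr q * T = (\<Sum>k<J. E k * (d * Q k * y k) powr q)"
      unfolding T_def sum_distrib_left y1 by (intro sum.cong refl) (simp add: powr_mult mult_ac)
    also have "\<dots> \<le> (\<Sum>k<J. E k * norm (?g (of_real (dyadic_radius k))) powr q)"
    proof (intro sum_mono mult_left_mono powr_mono2)
      fix k assume k: "k \<in> {..<J}"
      have "d * Q k * y k = exp (- (2 * real M + 2)) * (A / \<omega> k) * 2 ^ k * y k * (\<integral>t. t ^ ((M + 2) * (2 ^ k - 1)) \<partial>\<mu>)"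
        by (simp add: d_def Q_def u_def)
      also have "\<dots> \<le> norm (?g (of_real (dyadic_radius k)))"
        using k A \<omega>[of k] by (intro dilation_average_radial_lower \<mu> sm nn low y) (auto simp: less_imp_le)
      finally show "d * Q k * y k \<le> norm (?g (of_real (dyadic_radius k)))" .
    qed (use q d Q y EN in \<open>auto simp: less_imp_le\<close>)
    also have "\<dots> \<le> c2 * (B powr q * (c1 * T) powr (q/p))"
      unfolding E_def by (rule c2(2)[OF g _ gB]) simp
    finally have "d powr q * T \<le> c2 * (B powr q * (c1 * T) powr (q/p))" .
    then have "T \<le> c2 * (B powr q * (c1 * T) powr (q/p)) / d powr q" using d by (simp add: pos_le_divide_eq mult.commute)
    also have "\<dots> = K * B powr q * T powr (q/p)" by (simp add: K_def powr_mult)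
    finally have main: "T \<le> K * B powr q * T powr (q/p)" .
    have "T \<le> c * B powr s"
    proof (cases "T = 0")
      case True
      then show ?thesis using c by simp
    next
      case False
      with T have T0: "0 < T" by simp
      have "T powr (q/s) = T / T powr (q/p)" unfolding qs using T0 by (simp add: powr_diff)
      also have "\<dots> \<le> K * B powr q" using main T0 by (simp add: pos_divide_le_eq)
      finally have "(T powr (q/s)) powr (s/q) \<le> (K * B powr q) powr (s/q)" using q s by (intro powr_mono2) auto
      then show ?thesis using T0 q s by (simp add: powr_powr powr_mult c_def)
    qed
    then show ?thesis unfolding T_def y2 u_def[abs_def] .
  qed
  with c show ?thesis by (intro exI[of _ M] exI[of _ c] conjI allI impI)
qed

section \<open>Weights and weighted Bergman spaces\<close>

text \<open>Area integrability bounds the tail from 1/2 on, because there 2 \<pi> r >= 1; the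
  doubling condition at r = 0 extends this to the whole interval.\<close>

lemma D_hat_tail_finite:
  assumes "\<omega> \<in> D_hat"
  shows "weight_tail \<omega> 0 < \<infinity>"
proof -
  have rw: "radial_weight \<omega>" using assms by (simp add: D_hat_def)
  obtain C where C: "\<And>r. 0 \<le> r \<Longrightarrow> r < 1 \<Longrightarrow> weight_tail \<omega> r \<le> ennreal C * weight_tail \<omega> ((1 + r) / 2)"
    using assms by (auto simp: D_hat_def)
  obtain v where vm[measurable]: "v \<in> borel_measurable borel" and vnn: "\<And>r. 0 \<le> v r"
    and v1: "AE r in lborel. r \<in> {0..<1} \<longrightarrow> \<omega> (of_real r) = v r"
    and v2: "AE z in lborel. z \<in> ball 0 1 \<longrightarrow> \<omega> z = v (norm z)"
    using radial_weight_borel_profile[OF rw] by blast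
  have "set_integrable lebesgue (ball 0 1) \<omega>" using rw unfolding radial_weight_def weight_def by blast
  then have int: "integrable lebesgue (\<lambda>z. indicator (ball 0 1) z *\<^sub>R \<omega> z)" by (simp only: set_integrable_def)
  have "weight_tail \<omega> ((1 + 0) / 2) = (\<integral>\<^sup>+s. ennreal (\<omega> (of_real s)) * indicator {1/2..<1} s \<partial>lborel)"
    unfolding weight_tail_def by (simp add: nn_integral_completion)
  also have "\<dots> \<le> (\<integral>\<^sup>+r. ennreal (v r) * ennreal (2 * pi * r) * indicator {0..<1} r \<partial>lborel)"
  proof (rule nn_integral_mono_AE)
    show "AE r in lborel. ennreal (\<omega> (of_real r)) * indicator {1/2..<1} r \<le> ennreal (v r) * ennreal (2 * pi * r) * indicator {0..<1} r"
      using v1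
    proof eventually_elim
      case (elim r)
      show ?case
      proof (cases "r \<in> {1/2..<1}")
        case True
        have "2 * 1 * (1/2) \<le> 2 * pi * r" using True pi_ge_two by (intro mult_mono) auto
        then have "v r * 1 \<le> v r * (2 * pi * r)" by (intro mult_left_mono vnn) simp
        then show ?thesis using True elim vnn by (simp add: ennreal_mult[symmetric] ennreal_leI)
      qed simp
    qed
  qed
  also have "\<dots> = (\<integral>\<^sup>+z. ennreal (v (norm z)) * indicator (ball 0 1) z \<partial>(lborel :: complex measure))"
    by (rule nn_integral_radial[symmetric]) measurable
  also have "\<dots> = (\<integral>\<^sup>+z. ennreal (norm (indicator (ball 0 1) z *\<^sub>R \<omega> z)) \<partial>lborel)"
  proof (rule nn_integral_cong_AE)
    show "AE z in lborel. ennreal (v (norm z)) * indicator (ball 0 1) z = ennreal (norm (indicator (ball 0 1) z *\<^sub>R \<omega> z))"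
      using v2 by eventually_elim (auto simp: vnn split: split_indicator)
  qed
  also have "\<dots> = (\<integral>\<^sup>+z. ennreal (norm (indicator (ball 0 1) z *\<^sub>R \<omega> z)) \<partial>lebesgue)"
    by (rule nn_integral_completion[symmetric])
  also have "\<dots> < \<infinity>" using int by (simp add: integrable_iff_bounded)
  finally have "ennreal C * weight_tail \<omega> ((1 + 0) / 2) < \<infinity>" by (simp add: ennreal_mult_less_top)
  then show ?thesis using C[of 0] by (auto intro: le_less_trans)
qed

lemma weight_measure_tail:
  assumes "weight_measure \<nu> N" "0 \<le> r"
  shows "weight_tail \<nu> r = ennreal (measure N {r..<1})"
proof -
  interpret finite_measure N using assms by (simp add: weight_measure_def unit_interval_measure_def)
  have "weight_tail \<nu> r = emeasure N {r..<1}" using assms unfolding weight_measure_def by blast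
  then show ?thesis by (simp add: emeasure_eq_measure)
qed

text \<open>The point is the positivity of all tails: a vanishing tail at 0 would make the weight
  vanish almost everywhere in the disc, and doubling carries positivity from level 0 to level
  k.\<close>

lemma D_hat_doubling_measure:
  assumes "\<omega> \<in> D_hat"
  obtains N C where "weight_measure \<omega> N" "doubling_measure N C"
proof -
  have rw: "radial_weight \<omega>" using assms by (simp add: D_hat_def)
  obtain N where N: "weight_measure \<omega> N"
    using radial_weight_measure_exists[OF rw D_hat_tail_finite[OF assms]] by blast
  then have uN: "unit_interval_measure N" by (simp add: weight_measure_def)
  interpret finite_measure N using uN by (simp add: unit_interval_measure_def)
  obtain C :: real where C: "C > 1" "\<And>r. 0 \<le> r \<Longrightarrow> r < 1 \<Longrightarrow> weight_tail \<omega> r \<le> ennreal C * weight_tail \<omega> ((1 + r) / 2)"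
    using assms by (auto simp: D_hat_def)
  have dbl: "dyadic_tail N k \<le> C * dyadic_tail N (Suc k)" for k
  proof -
    have "ennreal (dyadic_tail N k) \<le> ennreal C * ennreal (dyadic_tail N (Suc k))"
      using C(2)[of "dyadic_radius k"] weight_measure_tail[OF N, of "dyadic_radius k"] weight_measure_tail[OF N, of "dyadic_radius (Suc k)"]
      unfolding dyadic_tail_def dyadic_radius_Suc[symmetric] by simp
    also have "\<dots> = ennreal (C * dyadic_tail N (Suc k))" using C by (intro ennreal_mult[symmetric]) auto
    finally show ?thesis using C by (subst (asm) ennreal_le_iff) auto
  qed
  have nz: "dyadic_tail N 0 \<noteq> 0"
  proof
    assume 0: "dyadic_tail N 0 = 0"
    have sN: "sets N = sets borel" using uN by (simp add: unit_interval_measure_def)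
    have "{0..<1} \<in> null_sets N" using 0 by (simp add: dyadic_tail_def null_sets_def emeasure_eq_measure sN)
    then have "AE r in N. r \<notin> {0..<1}" by (rule AE_not_in)
    moreover have "AE r in N. r \<in> {0..<1}" using uN by (simp add: unit_interval_measure_def)
    ultimately have AEF: "AE r in N. False" by eventually_elim simp
    \<comment> \<open>The area formula with F = 1 expresses the total area integral of \<omega>
      through N.\<close>
    define F :: "complex \<Rightarrow> real" where "F z = 1" for z
    have area: "(\<lambda>z. indicator (ball 0 1) z * (F z * \<omega> z)) \<in> borel_measurable lebesgue \<and>
        (\<integral>\<^sup>+z. ennreal (indicator (ball 0 1) z * (F z * \<omega> z)) \<partial>lebesgue)
          = (\<integral>\<^sup>+r. (\<integral>\<^sup>+\<zeta>. ennreal (F (of_real r * \<zeta>)) \<partial>circle_measure) * ennreal (2 * pi * r) \<partial>N)"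
      using N unfolding weight_measure_def by (elim conjE allE[of _ F]) (auto simp: F_def[abs_def])
    have "(\<integral>\<^sup>+r. (\<integral>\<^sup>+\<zeta>. ennreal (F (of_real r * \<zeta>)) \<partial>circle_measure) * ennreal (2 * pi * r) \<partial>N) = (\<integral>\<^sup>+r. 0 \<partial>N)"
      using AEF by (intro nn_integral_cong_AE) (rule eventually_mono, auto)
    then have "(\<integral>\<^sup>+z. ennreal (indicator (ball 0 1) z * (F z * \<omega> z)) \<partial>lebesgue) = 0" using area by simp
    then have "AE z in lebesgue. ennreal (indicator (ball 0 1) z * (F z * \<omega> z)) = 0"
      using area by (subst (asm) nn_integral_0_iff_AE) auto
    then have "AE z in lebesgue. z \<in> ball 0 1 \<longrightarrow> \<omega> z = 0"
    proof eventually_elim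
      case (elim z)
      have "z \<in> ball 0 1 \<longrightarrow> 0 \<le> \<omega> z" using rw unfolding radial_weight_def weight_def by blast
      then show ?case using elim by (auto simp: F_def ennreal_eq_0_iff)
    qed
    moreover have "\<not> (AE z in lebesgue. z \<in> ball 0 1 \<longrightarrow> \<omega> z = 0)" using assms unfolding D_hat_def by blast
    ultimately show False by blast
  qed
  have "0 < dyadic_tail N k" for k
  proof -
    have "dyadic_tail N 0 \<le> C ^ k * dyadic_tail N (0 + k)"
      using C by (intro dyadic_tail_doubling_iterate[where \<tau> = "dyadic_tail N"] dbl) auto
    moreover have "0 < dyadic_tail N 0" using nz dyadic_tail_nonneg[of N 0] by (metis less_eq_real_def)
    ultimately have "dyadic_tail N k \<noteq> 0" by auto
    then show ?thesis using dyadic_tail_nonneg[of N k] by (metis less_eq_real_def)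
  qed
  then have "doubling_measure N C" using uN C dbl by (simp add: doubling_measure_def)
  with N show ?thesis using that by blast
qed

text \<open>The condition is iterated i times until C^i > 2; the corresponding contraction of 1 - r
  by K^i is then covered by m dyadic levels with 2^m > K^i.\<close>

lemma D_check_halving_measure:
  assumes "\<nu> \<in> D_check" and N: "weight_measure \<nu> N"
  obtains m where "halving_measure N m"
proof -
  have uN: "unit_interval_measure N" using N by (simp add: weight_measure_def)
  interpret finite_measure N using uN by (simp add: unit_interval_measure_def)
  have sN: "sets N = sets borel" using uN by (simp add: unit_interval_measure_def)
  obtain C K :: real where CK: "C > 1" "K > 1"
    and ck: "\<And>r. 0 \<le> r \<Longrightarrow> r < 1 \<Longrightarrow> ennreal C * weight_tail \<nu> (1 - (1 - r) / K) \<le> weight_tail \<nu> r"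
    using assms by (auto simp: D_check_def)
  define t where "t r = measure N {r..<1}" for r
  have step: "C * t (1 - x / K) \<le> t (1 - x)" if x: "0 < x" "x \<le> 1" for x
  proof -
    have "x / K \<le> x / 1" using CK x by (intro divide_left_mono) auto
    then have "0 \<le> 1 - x / K" using x by simp
    then have "ennreal C * ennreal (t (1 - x / K)) \<le> ennreal (t (1 - x))"
      using ck[of "1 - x"] x weight_measure_tail[OF N, of "1 - x"] weight_measure_tail[OF N, of "1 - x / K"] by (simp add: t_def)
    then have "ennreal (C * t (1 - x / K)) \<le> ennreal (t (1 - x))"
      using CK by (subst ennreal_mult) (auto simp: t_def)
    then show ?thesis by (subst (asm) ennreal_le_iff) (auto simp: t_def)
  qed
  have iter: "C ^ i * t (1 - x / K ^ i) \<le> t (1 - x)" if x: "0 < x" "x \<le> 1" for x i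
  proof (induction i)
    case (Suc i)
    have "1 \<le> K ^ i" using CK by (intro one_le_power) auto
    then have "x / K ^ i \<le> x / 1" using x by (intro divide_left_mono) auto
    then have le: "x / K ^ i \<le> 1" using x by linarith
    have "0 < x / K ^ i" using x CK by simp
    then have "C * t (1 - (x / K ^ i) / K) \<le> t (1 - x / K ^ i)" using le by (rule step)
    then have "C ^ i * (C * t (1 - (x / K ^ i) / K)) \<le> C ^ i * t (1 - x / K ^ i)" using CK by (intro mult_left_mono) auto
    then show ?case using Suc by (simp add: mult_ac)
  qed simp
  obtain i where i: "2 < C ^ i" using real_arch_pow[of C 2] CK by auto
  obtain m where m: "K ^ i < 2 ^ m" using real_arch_pow[of 2 "K ^ i"] by auto
  have "0 < m"
  proof (rule ccontr)
    assume "\<not> 0 < m"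
    moreover have "1 \<le> K ^ i" using CK by (intro one_le_power) auto
    ultimately show False using m by simp
  qed
  moreover have "dyadic_tail N (k + m) \<le> dyadic_tail N k / 2" for k
  proof -
    let ?x = "(1/2::real) ^ k"
    have x: "0 < ?x" "?x \<le> 1" by (auto intro: power_le_one)
    have "(1/2::real) ^ (k + m) = ?x / 2 ^ m" by (simp add: power_add power_one_over)
    also have "\<dots> \<le> ?x / K ^ i" using m x CK by (intro divide_left_mono) auto
    finally have "dyadic_tail N (k + m) \<le> t (1 - ?x / K ^ i)"
      unfolding t_def dyadic_tail_def by (intro finite_measure_mono) (auto simp: sN dyadic_radius_def)
    then have "2 * dyadic_tail N (k + m) \<le> C ^ i * t (1 - ?x / K ^ i)"
      using i by (intro mult_mono) (auto simp: t_def)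
    also have "\<dots> \<le> t (1 - ?x)" by (rule iter[OF x])
    also have "\<dots> = dyadic_tail N k" by (simp add: t_def dyadic_tail_def dyadic_radius_def)
    finally show ?thesis by simp
  qed
  ultimately show ?thesis using that by (auto simp: halving_measure_def)
qed

text \<open>The p-th power of the Bergman norm in polar coordinates: the normalization 1/\<pi>
  leaves 2 r of the density 2 \<pi> r.\<close>

definition radial_energy :: "real \<Rightarrow> real measure \<Rightarrow> (complex \<Rightarrow> complex) \<Rightarrow> ennreal" where
  "radial_energy p N h = (\<integral>\<^sup>+r. ennreal (2 * r * circle_mean p h r) \<partial>N)"

text \<open>Only the values in the disc matter, so f may be replaced by h, which is Borel on the
  plane; then the area formula of \<open>weight_measure\<close> applies to |h|^p.\<close>

lemma bergman_radial_energy: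
  assumes rw: "radial_weight \<nu>" and N: "weight_measure \<nu> N" and h: "disc_holomorphic h" and p: "0 < p"
    and fh: "\<And>z. norm z < 1 \<Longrightarrow> f z = h z"
  shows "f \<in> bergman_space p \<nu> \<longleftrightarrow> radial_energy p N h < \<infinity>"
    and "bergman_norm p \<nu> f = enn2real (radial_energy p N h) powr (1/p)"
proof -
  have uN: "unit_interval_measure N" using N by (simp add: weight_measure_def)
  have [measurable_cong]: "sets N = sets borel" using uN by (simp add: unit_interval_measure_def)
  have hm[measurable]: "h \<in> borel_measurable borel" using h by (simp add: disc_holomorphic_def)
  define F where "F z = norm (h z) powr p" for z
  have Fm: "F \<in> borel_measurable borel" unfolding F_def by measurable
  have F0: "0 \<le> F z" for z by (simp add: F_def)
  have eqf: "indicator (ball 0 1) z *\<^sub>R (cmod (f z) powr p * \<nu> z) = indicator (ball 0 1) z * (F z * \<nu> z)" for z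
    using fh by (auto simp: F_def split: split_indicator)
  have area: "(\<lambda>z. indicator (ball 0 1) z * (F z * \<nu> z)) \<in> borel_measurable lebesgue"
        "(\<integral>\<^sup>+z. ennreal (indicator (ball 0 1) z * (F z * \<nu> z)) \<partial>lebesgue)
          = (\<integral>\<^sup>+r. (\<integral>\<^sup>+\<zeta>. ennreal (F (of_real r * \<zeta>)) \<partial>circle_measure) * ennreal (2 * pi * r) \<partial>N)"
    using N F0 Fm unfolding weight_measure_def by blast+
  have "(\<integral>\<^sup>+r. (\<integral>\<^sup>+\<zeta>. ennreal (F (of_real r * \<zeta>)) \<partial>circle_measure) * ennreal (2 * pi * r) \<partial>N)
     = (\<integral>\<^sup>+r. ennreal pi * ennreal (2 * r * circle_mean p h r) \<partial>N)"
  proof (rule nn_integral_cong_AE)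
    have "AE r in N. r \<in> {0..<1}" using uN by (simp add: unit_interval_measure_def)
    then show "AE r in N. (\<integral>\<^sup>+\<zeta>. ennreal (F (of_real r * \<zeta>)) \<partial>circle_measure) * ennreal (2 * pi * r) = ennreal pi * ennreal (2 * r * circle_mean p h r)"
    proof eventually_elim
      case (elim r)
      have "(\<integral>\<^sup>+\<zeta>. ennreal (F (of_real r * \<zeta>)) \<partial>circle_measure) = ennreal (circle_mean p h r)"
        unfolding F_def using elim p by (intro nn_integral_circle_mean h) auto
      then show ?case using elim by (simp add: ennreal_mult[symmetric] mult_ac)
    qed
  qed
  also have "\<dots> = ennreal pi * radial_energy p N h"
    unfolding radial_energy_def using circle_mean_measurable[OF hm] by (intro nn_integral_cmult) measurable
  finally have nn: "(\<integral>\<^sup>+z. ennreal (indicator (ball 0 1) z * (F z * \<nu> z)) \<partial>lebesgue) = ennreal pi * radial_energy p N h"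
    using area(2) by simp
  have nu0: "0 \<le> indicator (ball 0 1) z * (F z * \<nu> z)" for z
  proof -
    have "z \<in> ball 0 1 \<longrightarrow> 0 \<le> \<nu> z" using rw unfolding radial_weight_def weight_def by blast
    then show ?thesis using F0[of z] by (auto split: split_indicator)
  qed
  have fin: "ennreal pi * radial_energy p N h < \<infinity> \<longleftrightarrow> radial_energy p N h < \<infinity>"
    by (auto simp: ennreal_mult_less_top)
  have "f holomorphic_on ball 0 1"
    by (rule holomorphic_transform[of h]) (use h fh in \<open>auto simp: disc_holomorphic_def\<close>)
  moreover have "set_integrable lebesgue (ball 0 1) (\<lambda>z. cmod (f z) powr p * \<nu> z) \<longleftrightarrow> radial_energy p N h < \<infinity>"
    unfolding set_integrable_def eqf integrable_iff_bounded using area(1) nu0 nn fin by simp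
  ultimately show "f \<in> bergman_space p \<nu> \<longleftrightarrow> radial_energy p N h < \<infinity>"
    by (simp add: bergman_space_def)
  have "(LINT z:ball 0 1|lebesgue. cmod (f z) powr p * \<nu> z) = enn2real (ennreal pi * radial_energy p N h)"
    unfolding set_lebesgue_integral_def eqf
    using area(1) nu0 by (subst integral_eq_nn_integral) (auto simp: nn)
  then show "bergman_norm p \<nu> f = enn2real (radial_energy p N h) powr (1/p)"
    by (simp add: bergman_norm_def enn2real_mult)
qed

text \<open>Measures in \<open>M_plus\<close> live on the subspace [0, 1); the push-forward under
  the inclusion moves them to the line and keeps the moments.\<close>

lemma M_plus_unit_interval_measure:
  assumes "\<mu> \<in> M_plus"
  shows "unit_interval_measure (distr \<mu> borel (\<lambda>t. t))"
    and "measure_moment \<mu> n = (\<integral>t. t ^ n \<partial>distr \<mu> borel (\<lambda>t. t))"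
    and "space \<mu> = {0..<1}" and "(\<lambda>t. t) \<in> borel_measurable \<mu>"
proof -
  have s: "sets \<mu> = sets (restrict_space borel {0..<1})" and f: "finite_measure \<mu>" using assms by (auto simp: M_plus_def)
  show m: "(\<lambda>t. t) \<in> borel_measurable \<mu>"
    using measurable_restrict_space1[of "\<lambda>t. t" borel borel "{0..<1}"] measurable_cong_sets[OF s refl] by auto
  show sp: "space \<mu> = {0..<1}" using sets_eq_imp_space_eq[OF s] by (simp add: space_restrict_space)
  have "AE t in distr \<mu> borel (\<lambda>t. t). t \<in> {0..<1}"
    using m by (subst AE_distr_iff) (auto simp: sp intro!: AE_I2)
  then show "unit_interval_measure (distr \<mu> borel (\<lambda>t. t))"
    using finite_measure.finite_measure_distr[OF f m] by (simp add: unit_interval_measure_def)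
  show "measure_moment \<mu> n = (\<integral>t. t ^ n \<partial>distr \<mu> borel (\<lambda>t. t))"
    using m by (simp add: measure_moment_def integral_distr)
qed

lemma C_op_eq_dilation_average:
  assumes mu: "\<mu> \<in> M_plus" and h: "disc_holomorphic h" and fh: "\<And>z. norm z < 1 \<Longrightarrow> f z = h z"
    and k: "disc_holomorphic (kernel_fun (\<lambda>n. 1 / (2 * weight_moment \<omega> (2 * n + 1))))" and z: "norm z < 1"
  shows "C_op \<mu> \<omega> f z = (\<integral>t. h (of_real t * z) * kernel_fun (\<lambda>n. 1 / (2 * weight_moment \<omega> (2 * n + 1))) (of_real t * z) \<partial>distr \<mu> borel (\<lambda>t. t))"
proof -
  note M = M_plus_unit_interval_measure[OF mu]
  let ?k = "kernel_fun (\<lambda>n. 1 / (2 * weight_moment \<omega> (2 * n + 1)))"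
  have [measurable]: "h \<in> borel_measurable borel" "?k \<in> borel_measurable borel"
    using h k by (auto simp: disc_holomorphic_def)
  have "C_op \<mu> \<omega> f z = (\<integral>t. h (of_real t * z) * ?k (of_real t * z) \<partial>\<mu>)"
    unfolding C_op_def
  proof (rule Bochner_Integration.integral_cong[OF refl])
    fix t assume t: "t \<in> space \<mu>"
    have "norm (of_real t * z) \<le> 1 * norm z" unfolding norm_mult using t M(3) by (intro mult_right_mono) auto
    then have n: "norm (of_real t * z) < 1" using z by simp
    then show "f (of_real t * z) * B_kernel \<omega> t z = h (of_real t * z) * ?k (of_real t * z)"
      by (simp add: fh B_kernel_def kernel_fun_def)
  qed
  also have "\<dots> = (\<integral>t. h (of_real t * z) * ?k (of_real t * z) \<partial>distr \<mu> borel (\<lambda>t. t))"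
    by (rule integral_distr[symmetric, OF M(4)]) measurable
  finally show ?thesis .
qed

text \<open>Truncated subtraction sends every i <= m to level 0, so the first term is counted m
  additional times.\<close>

lemma sum_shifted_le:
  fixes g :: "nat \<Rightarrow> real"
  assumes g: "\<And>k. 0 \<le> g k" and J: "0 < J"
  shows "(\<Sum>i<J. g (i - m)) \<le> (real m + 1) * (\<Sum>k<J. g k)"
proof -
  have eq: "(\<Sum>i<m + L. g (i - m)) = real m * g 0 + (\<Sum>k<L. g k)" for L
    by (induction L) auto
  have "(\<Sum>i<J. g (i - m)) \<le> (\<Sum>i<m + J. g (i - m))" using g by (intro sum_mono2) auto
  also have "\<dots> = real m * g 0 + (\<Sum>k<J. g k)" by (rule eq)
  finally have "(\<Sum>i<J. g (i - m)) \<le> real m * g 0 + (\<Sum>k<J. g k)" .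
  moreover have "g 0 \<le> (\<Sum>k<J. g k)" using g J by (intro member_le_sum) auto
  then have "real m * g 0 \<le> real m * (\<Sum>k<J. g k)" by (intro mult_left_mono) auto
  ultimately show ?thesis unfolding distrib_right by linarith
qed

section \<open>Comparison with moments\<close>

text \<open>One constant D for everything later asked of a weight: w is its moment sequence, \<tau>
  its tails at the dyadic radii.\<close>

definition comparable_moments :: "(nat \<Rightarrow> real) \<Rightarrow> (nat \<Rightarrow> real) \<Rightarrow> real \<Rightarrow> bool" where
  "comparable_moments w \<tau> D \<longleftrightarrow> 1 \<le> D \<and> (\<forall>k. 0 < \<tau> k) \<and> (\<forall>j k. j \<le> k \<longrightarrow> \<tau> k \<le> \<tau> j) \<and> (\<forall>k. \<tau> k \<le> D * \<tau> (Suc k)) \<and>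
     (\<forall>n k. n \<in> dyadic_block k \<longrightarrow> \<tau> k \<le> D * w n \<and> w n \<le> D * \<tau> k)"

lemma doubling_measure_comparable_moments:
  assumes N: "doubling_measure N C"
  shows "\<exists>D. comparable_moments (\<lambda>n. \<integral>r. r ^ n \<partial>N) (dyadic_tail N) D"
proof -
  have uN: "unit_interval_measure N" and C: "1 \<le> C" and pos: "\<And>k. 0 < dyadic_tail N k"
    and d: "\<And>k. dyadic_tail N k \<le> C * dyadic_tail N (Suc k)"
    using N by (auto simp: doubling_measure_def)
  obtain D0 where D0: "0 < D0" "\<And>M n k. unit_interval_measure M \<Longrightarrow> (\<And>k. dyadic_tail M k \<le> C * dyadic_tail M (Suc k)) \<Longrightarrow> 2 ^ k \<le> n + 1 \<Longrightarrow>
       (\<integral>r. r ^ n \<partial>M) \<le> D0 * dyadic_tail M k"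
  proof (rule moment_upper_bound[of C])
    show "0 \<le> C" using C by simp
  qed blast
  define D where "D = max (exp 2) (max C D0)"
  have D: "exp 2 \<le> D" "C \<le> D" "D0 \<le> D" by (auto simp: D_def)
  have "dyadic_tail N k \<le> D * (\<integral>r. r ^ n \<partial>N)" if n: "n \<in> dyadic_block k" for n k
  proof -
    have l: "exp (- 2) * dyadic_tail N k \<le> (\<integral>r. r ^ n \<partial>N)"
      using n by (intro moment_lower_bound uN) (simp add: dyadic_block_iff)
    then have "exp 2 * (exp (- 2) * dyadic_tail N k) \<le> exp 2 * (\<integral>r. r ^ n \<partial>N)" by (intro mult_left_mono) auto
    then have "dyadic_tail N k \<le> exp 2 * (\<integral>r. r ^ n \<partial>N)" by (simp add: mult.assoc[symmetric] exp_add[symmetric])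
    also have "\<dots> \<le> D * (\<integral>r. r ^ n \<partial>N)"
    proof (intro mult_right_mono D)
      have "0 \<le> exp (- 2) * dyadic_tail N k" by simp
      with l show "0 \<le> (\<integral>r. r ^ n \<partial>N)" by linarith
    qed
    finally show ?thesis .
  qed
  moreover have "(\<integral>r. r ^ n \<partial>N) \<le> D * dyadic_tail N k" if n: "n \<in> dyadic_block k" for n k
  proof -
    have "(\<integral>r. r ^ n \<partial>N) \<le> D0 * dyadic_tail N k" using n by (intro D0(2) uN d) (simp add: dyadic_block_iff)
    also have "\<dots> \<le> D * dyadic_tail N k" by (intro mult_right_mono D) simp
    finally show ?thesis .
  qed
  moreover have "dyadic_tail N k \<le> D * dyadic_tail N (Suc k)" for k
    using order_trans[OF d mult_right_mono[OF D(2)]] by simp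
  moreover have "dyadic_tail N k \<le> dyadic_tail N j" if "j \<le> k" for j k by (rule dyadic_tail_antimono[OF uN that])
  ultimately show ?thesis
    unfolding comparable_moments_def using pos D C by (intro exI[of _ D]) auto
qed

lemma comparable_momentsD:
  assumes "comparable_moments w \<tau> D"
  shows "1 \<le> D" "0 < \<tau> k" "j \<le> k \<Longrightarrow> \<tau> k \<le> \<tau> j" "\<tau> k \<le> D * \<tau> (Suc k)"
    "n \<in> dyadic_block k \<Longrightarrow> \<tau> k \<le> D * w n" "n \<in> dyadic_block k \<Longrightarrow> w n \<le> D * \<tau> k"
  using assms by (auto simp: comparable_moments_def)

lemma comparable_moments_pos:
  assumes "comparable_moments w \<tau> D" "n \<in> dyadic_block k"
  shows "0 < w n"
proof -
  have "0 < D * w n" using comparable_momentsD(2,5)[OF assms(1)] assms(2) by (meson less_le_trans)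
  then show ?thesis using comparable_momentsD(1)[OF assms(1)] by (simp add: zero_less_mult_iff)
qed

lemma dyadic_block_cover: "\<exists>k. n \<in> dyadic_block k"
proof -
  define k where "k = (LEAST k. n + 1 < 2 ^ Suc k)"
  have "n + 1 < 2 ^ Suc (n + 1)" using less_exp[of "Suc (n + 1)"] by simp
  then have k: "n + 1 < 2 ^ Suc k" unfolding k_def by (rule LeastI[where P = "\<lambda>k. n + 1 < 2 ^ Suc k"])
  have "2 ^ k \<le> n + 1"
  proof (cases k)
    case (Suc j)
    have "\<not> n + 1 < 2 ^ Suc j" using Suc not_less_Least[of j "\<lambda>k. n + 1 < 2 ^ Suc k"] by (simp add: k_def)
    then show ?thesis using Suc by simp
  qed simp
  with k show ?thesis by (auto simp: dyadic_block_iff)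
qed

text \<open>The common shape of the summands of \<open>N_term\<close>, with a = n + 1, and of
  \<open>dyadic_term\<close>, with a = 2^k, so that one monotonicity lemma compares the two.\<close>

definition moment_term :: "real \<Rightarrow> real \<Rightarrow> real \<Rightarrow> real \<Rightarrow> real \<Rightarrow> real \<Rightarrow> real \<Rightarrow> real" where
  "moment_term q s x w e v a = (x * a / w * (e / v) powr (1/q)) powr s * (v / a\<^sup>2)"

lemma dyadic_term_eq_moment_term:
  "dyadic_term q s \<omega> \<nu> \<eta> u k = 2 ^ k * moment_term q s (u k) (\<omega> k) (\<eta> k) (\<nu> k) (2 ^ k)"
  by (simp add: dyadic_term_def moment_term_def power2_eq_square)

text \<open>Each argument except x may be off by a factor c. The constant counts them: c^2 from a/w
  and (c^2)^(1/q) from e/v, both raised to the power s, and c^3 from v/a^2.\<close>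

lemma moment_term_mono:
  assumes q: "0 < q" and s: "0 < s" and c: "1 \<le> c"
    and x: "0 \<le> x" "x \<le> x'" and w: "0 < w" "0 < w'" "w' \<le> c * w" and e: "0 < e" "e \<le> c * e'"
    and v: "0 < v" "0 < v'" "v' \<le> c * v" "v \<le> c * v'" and a: "0 < a" "0 < a'" "a \<le> c * a'" "a' \<le> c * a"
  shows "moment_term q s x w e v a \<le> (c\<^sup>2 * (c\<^sup>2) powr (1/q)) powr s * c ^ 3 * moment_term q s x' w' e' v' a'"
proof -
  have c0: "0 < c" using c by simp
  have e': "0 \<le> e'"
  proof -
    have "0 < c * e'" using e by linarith
    then show ?thesis using c0 by (simp add: zero_less_mult_iff)
  qed
  have 1: "x * a / w \<le> c\<^sup>2 * (x' * a' / w')"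
  proof -
    have "x * a / w = x * a * (1/w)" by simp
    also have "\<dots> \<le> x' * (c * a') * (c / w')"
    proof (intro mult_mono)
      show "1 / w \<le> c / w'" using w by (simp add: field_simps)
    qed (use x a w c0 in auto)
    finally show ?thesis by (simp add: power2_eq_square mult_ac)
  qed
  have 2: "(e / v) powr (1/q) \<le> (c\<^sup>2) powr (1/q) * (e' / v') powr (1/q)"
  proof -
    have "e / v = e * (1/v)" by simp
    also have "\<dots> \<le> (c * e') * (c / v')"
    proof (intro mult_mono)
      show "1 / v \<le> c / v'" using v by (simp add: field_simps)
    qed (use e e' v c0 in auto)
    finally have "e / v \<le> c\<^sup>2 * (e' / v')" by (simp add: power2_eq_square mult_ac)
    then have "(e / v) powr (1/q) \<le> (c\<^sup>2 * (e' / v')) powr (1/q)" using e v q by (intro powr_mono2) auto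
    then show ?thesis by (simp only: powr_mult)
  qed
  have 3: "(x * a / w * (e / v) powr (1/q)) powr s \<le> (c\<^sup>2 * (c\<^sup>2) powr (1/q)) powr s * (x' * a' / w' * (e' / v') powr (1/q)) powr s"
  proof -
    have "x * a / w * (e / v) powr (1/q) \<le> (c\<^sup>2 * (x' * a' / w')) * ((c\<^sup>2) powr (1/q) * (e' / v') powr (1/q))"
      using x a w by (intro mult_mono 1 2) auto
    also have "\<dots> = (c\<^sup>2 * (c\<^sup>2) powr (1/q)) * (x' * a' / w' * (e' / v') powr (1/q))" by (simp only: mult_ac)
    finally have "(x * a / w * (e / v) powr (1/q)) powr s \<le> ((c\<^sup>2 * (c\<^sup>2) powr (1/q)) * (x' * a' / w' * (e' / v') powr (1/q))) powr s"
      using s x a w by (intro powr_mono2) auto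
    then show ?thesis by (simp only: powr_mult)
  qed
  have 4: "v / a\<^sup>2 \<le> c ^ 3 * (v' / a'\<^sup>2)"
  proof -
    have "a'\<^sup>2 \<le> (c * a)\<^sup>2" using a by (intro power_mono) auto
    then have "1 / a\<^sup>2 \<le> c\<^sup>2 / a'\<^sup>2" using a by (simp add: power_mult_distrib field_simps)
    then have "v * (1 / a\<^sup>2) \<le> (c * v') * (c\<^sup>2 / a'\<^sup>2)" using v a c0 by (intro mult_mono) auto
    then show ?thesis by (simp add: power2_eq_square power3_eq_cube mult_ac)
  qed
  have "moment_term q s x w e v a \<le> ((c\<^sup>2 * (c\<^sup>2) powr (1/q)) powr s * (x' * a' / w' * (e' / v') powr (1/q)) powr s) * (c ^ 3 * (v' / a'\<^sup>2))"
    unfolding moment_term_def using v a by (intro mult_mono 3 4) auto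
  then show ?thesis unfolding moment_term_def by (simp only: mult_ac)
qed

lemma moment_term_nonneg: "0 \<le> v \<Longrightarrow> 0 \<le> moment_term q s x w e v a"
  by (simp add: moment_term_def)

text \<open>The 2^k copies of \<open>moment_term\<close> in \<open>dyadic_term\<close> are compared
  one by one with the terms of block k. The lower bound on D gives D >= 2, which covers n + 1 <= 2 *
  2^k; the extra D^s comes from u <= D x.\<close>

lemma dyadic_term_le_block_sum:
  assumes q: "0 < q" and s: "0 < s" and W: "comparable_moments w \<omega> D" "comparable_moments v \<nu> D" "comparable_moments e \<eta> D"
    and D: "exp 2 \<le> D" and u: "\<And>k. 0 \<le> u k" and x: "\<And>n k. n \<in> dyadic_block k \<Longrightarrow> u k \<le> D * x n"
  shows "dyadic_term q s \<omega> \<nu> \<eta> u k \<le> (D\<^sup>2 * (D\<^sup>2) powr (1/q)) powr s * D ^ 3 * D powr s *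
     (\<Sum>n\<in>dyadic_block k. moment_term q s (x n) (w n) (e n) (v n) (real n + 1))"
proof -
  let ?K = "(D\<^sup>2 * (D\<^sup>2) powr (1/q)) powr s * D ^ 3"
  have D2: "2 \<le> D" "0 < D" "1 \<le> D"
  proof -
    have "1 + (2::real) \<le> exp 2" by (rule exp_ge_add_one_self)
    then show "2 \<le> D" "0 < D" "1 \<le> D" using D by linarith+
  qed
  have "dyadic_term q s \<omega> \<nu> \<eta> u k = (\<Sum>n\<in>dyadic_block k. moment_term q s (u k) (\<omega> k) (\<eta> k) (\<nu> k) (2 ^ k))"
    by (simp add: dyadic_term_eq_moment_term card_dyadic_block)
  also have "\<dots> \<le> (\<Sum>n\<in>dyadic_block k. ?K * (D powr s * moment_term q s (x n) (w n) (e n) (v n) (real n + 1)))"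
  proof (rule sum_mono)
    fix n assume n: "n \<in> dyadic_block k"
    have a: "2 ^ k \<le> real n + 1" "real n + 1 \<le> 2 * 2 ^ k"
    proof -
      have "real (2 ^ k) \<le> real (n + 1)" "real (n + 1) \<le> real (2 ^ Suc k)"
        using n unfolding dyadic_block_iff by (simp_all only: of_nat_le_iff less_imp_le)
      then show "2 ^ k \<le> real n + 1" "real n + 1 \<le> 2 * 2 ^ k" by simp_all
    qed
    have "moment_term q s (u k) (\<omega> k) (\<eta> k) (\<nu> k) (2 ^ k) \<le> ?K * moment_term q s (D * x n) (w n) (e n) (v n) (real n + 1)"
    proof (rule moment_term_mono[OF q s D2(3)])
      show "(2::real) ^ k \<le> D * (real n + 1)" using mult_mono[OF D2(3) a(1)] D2 by simp
      show "real n + 1 \<le> D * 2 ^ k" using order_trans[OF a(2) mult_right_mono[OF D2(1)]] by simp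
    qed (use n u x W in \<open>auto intro: comparable_momentsD comparable_moments_pos\<close>)
    also have "moment_term q s (D * x n) (w n) (e n) (v n) (real n + 1) = D powr s * moment_term q s (x n) (w n) (e n) (v n) (real n + 1)"
      unfolding moment_term_def times_divide_eq_right[symmetric] mult.assoc by (subst powr_mult) (simp only: mult.assoc)
    finally show "moment_term q s (u k) (\<omega> k) (\<eta> k) (\<nu> k) (2 ^ k) \<le> ?K * (D powr s * moment_term q s (x n) (w n) (e n) (v n) (real n + 1))" .
  qed
  also have "\<dots> = ?K * D powr s * (\<Sum>n\<in>dyadic_block k. moment_term q s (x n) (w n) (e n) (v n) (real n + 1))"
    by (simp only: sum_distrib_left mult.assoc)
  finally show ?thesis .
qed

text \<open>Block i is compared with level i - m, or with level 0 if i < m. The constant c allows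
  for m doublings and one comparison of moments with tails, and for n + 1 <= 2 * 2^m * 2^(i-m); the
  separate factor 2^m bounds the ratio of the block sizes.\<close>

lemma block_sum_le_dyadic_term:
  assumes q: "0 < q" and s: "0 < s" and W: "comparable_moments w \<omega> D" "comparable_moments v \<nu> D" "comparable_moments e \<eta> D"
    and x: "\<And>n. 0 \<le> x n" and u: "\<And>n i. n \<in> dyadic_block i \<Longrightarrow> x n \<le> u (i - m)" and c: "c = 2 ^ Suc m * D ^ Suc m"
  shows "(\<Sum>n\<in>dyadic_block i. moment_term q s (x n) (w n) (e n) (v n) (real n + 1))
    \<le> (c\<^sup>2 * (c\<^sup>2) powr (1/q)) powr s * c ^ 3 * 2 ^ m * dyadic_term q s \<omega> \<nu> \<eta> u (i - m)"
proof -
  let ?k = "i - m" and ?K = "(c\<^sup>2 * (c\<^sup>2) powr (1/q)) powr s * c ^ 3"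
  have D: "1 \<le> D" by (rule comparable_momentsD(1)[OF W(1)])
  have Dm: "1 \<le> D ^ m" using D by (rule one_le_power)
  have Dc: "D \<le> c" "D * D ^ m \<le> c" "1 \<le> c" "2 * 2 ^ m \<le> c"
  proof -
    have two: "(1::real) \<le> 2 ^ Suc m" by (rule one_le_power) simp
    show 1: "D * D ^ m \<le> c" unfolding c power_Suc[of D] using mult_right_mono[OF two, of "D * D ^ m"] D by simp
    have "D * 1 \<le> D * D ^ m" using Dm D by (intro mult_left_mono) auto
    then show 2: "D \<le> c" using 1 by simp
    then show "1 \<le> c" using D by simp
    have "1 \<le> D ^ Suc m" using D by (rule one_le_power)
    then have "2 ^ Suc m * 1 \<le> c" unfolding c by (intro mult_left_mono) auto
    then show "2 * 2 ^ m \<le> c" by simp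
  qed
  have doub: "\<tau> ?k \<le> D ^ m * \<tau> i" if T: "comparable_moments z \<tau> D" for z \<tau>
  proof -
    have "\<tau> ?k \<le> D ^ m * \<tau> (?k + m)"
      using D by (intro dyadic_tail_doubling_iterate[where \<tau> = \<tau>] comparable_momentsD(4)[OF T]) auto
    also have "\<dots> \<le> D ^ m * \<tau> i" using D by (intro mult_left_mono comparable_momentsD(3)[OF T]) auto
    finally show ?thesis .
  qed
  have up: "z n \<le> c * \<tau> ?k" and down: "\<tau> ?k \<le> c * z n" if T: "comparable_moments z \<tau> D" and n: "n \<in> dyadic_block i" for z \<tau> n
  proof -
    have "z n \<le> D * \<tau> i" by (rule comparable_momentsD(6)[OF T n])
    also have "\<dots> \<le> c * \<tau> ?k"
      using Dc D comparable_momentsD(2)[OF T, of i] by (intro mult_mono comparable_momentsD(3)[OF T]) auto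
    finally show "z n \<le> c * \<tau> ?k" .
    have "\<tau> ?k \<le> D ^ m * \<tau> i" by (rule doub[OF T])
    also have "\<dots> \<le> D ^ m * (D * z n)" using D by (intro mult_left_mono comparable_momentsD(5)[OF T n]) auto
    also have "\<dots> = D * D ^ m * z n" by (simp only: mult_ac)
    also have "\<dots> \<le> c * z n" using comparable_moments_pos[OF T n] by (intro mult_right_mono Dc) auto
    finally show "\<tau> ?k \<le> c * z n" .
  qed
  have pw: "(2::real) ^ ?k \<le> 2 ^ i" "(2::real) ^ i \<le> 2 ^ m * 2 ^ ?k"
  proof -
    show "(2::real) ^ ?k \<le> 2 ^ i" by (intro power_increasing) auto
    have "(2::real) ^ i \<le> 2 ^ (m + ?k)" by (intro power_increasing) auto
    then show "(2::real) ^ i \<le> 2 ^ m * 2 ^ ?k" by (simp only: power_add)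
  qed
  let ?t = "moment_term q s (u ?k) (\<omega> ?k) (\<eta> ?k) (\<nu> ?k) (2 ^ ?k)"
  have t0: "0 \<le> ?t" using comparable_momentsD(2)[OF W(2)] by (intro moment_term_nonneg) (auto simp: less_imp_le)
  have K0: "0 \<le> ?K" using Dc by simp
  have "(\<Sum>n\<in>dyadic_block i. moment_term q s (x n) (w n) (e n) (v n) (real n + 1)) \<le> (\<Sum>n\<in>dyadic_block i. ?K * ?t)"
  proof (rule sum_mono)
    fix n assume n: "n \<in> dyadic_block i"
    have a: "2 ^ i \<le> real n + 1" "real n + 1 \<le> 2 * 2 ^ i"
    proof -
      have "real (2 ^ i) \<le> real (n + 1)" "real (n + 1) \<le> real (2 ^ Suc i)"
        using n unfolding dyadic_block_iff by (simp_all only: of_nat_le_iff less_imp_le)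
      then show "2 ^ i \<le> real n + 1" "real n + 1 \<le> 2 * 2 ^ i" by simp_all
    qed
    show "moment_term q s (x n) (w n) (e n) (v n) (real n + 1) \<le> ?K * ?t"
    proof (rule moment_term_mono[OF q s Dc(3)])
      have "real n + 1 \<le> 2 * (2 ^ m * 2 ^ ?k)" using order_trans[OF a(2) mult_left_mono[OF pw(2), of 2]] by simp
      also have "\<dots> = (2 * 2 ^ m) * 2 ^ ?k" by simp
      also have "\<dots> \<le> c * 2 ^ ?k" by (intro mult_right_mono Dc) auto
      finally show "real n + 1 \<le> c * 2 ^ ?k" .
      have "2 ^ ?k \<le> 1 * (real n + 1)" using order_trans[OF pw(1) a(1)] by simp
      also have "\<dots> \<le> c * (real n + 1)" by (intro mult_right_mono Dc) auto
      finally show "2 ^ ?k \<le> c * (real n + 1)" .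
    qed (use n u x in \<open>auto intro: up[OF W(1)] down[OF W(1)] up[OF W(2)] down[OF W(2)] up[OF W(3)] comparable_momentsD(2)[OF W(1)] comparable_momentsD(2)[OF W(2)]
         comparable_moments_pos[OF W(1)] comparable_moments_pos[OF W(2)] comparable_moments_pos[OF W(3)]\<close>)
  qed
  also have "\<dots> = 2 ^ i * (?K * ?t)" by (simp add: card_dyadic_block)
  also have "\<dots> \<le> (2 ^ m * 2 ^ ?k) * (?K * ?t)" by (rule mult_right_mono[OF pw(2) mult_nonneg_nonneg[OF K0 t0]])
  also have "\<dots> = ?K * 2 ^ m * dyadic_term q s \<omega> \<nu> \<eta> u ?k"
    unfolding dyadic_term_eq_moment_term by (simp only: mult_ac)
  finally show ?thesis .
qed

lemma comparable_moments_weaken: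
  assumes "comparable_moments w \<tau> D" "D \<le> D'"
  shows "comparable_moments w \<tau> D'"
proof -
  note c = comparable_momentsD[OF assms(1)]
  have "\<tau> k \<le> D' * \<tau> (Suc k)" for k
    using c(4)[of k] mult_right_mono[OF assms(2) less_imp_le[OF c(2)[of "Suc k"]]] by linarith
  moreover have "\<tau> k \<le> D' * w n" if "n \<in> dyadic_block k" for n k
    using c(5)[OF that] mult_right_mono[OF assms(2) less_imp_le[OF comparable_moments_pos[OF assms(1) that]]] by linarith
  moreover have "w n \<le> D' * \<tau> k" if "n \<in> dyadic_block k" for n k
    using c(6)[OF that] mult_right_mono[OF assms(2) less_imp_le[OF c(2)[of k]]] by linarith
  ultimately show ?thesis unfolding comparable_moments_def using c(1) c(2) c(3) assms(2) by auto
qed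

lemma N_term_eq_moment_term:
  assumes pq: "0 < q" "q < p"
  shows "N_term p q \<omega> \<nu> \<eta> \<mu> n = moment_term q (q * p / (p - q)) (measure_moment \<mu> n) (weight_moment \<omega> n) (weight_moment \<eta> n) (weight_moment \<nu> n) (real n + 1)"
  unfolding N_term_def moment_term_def by (simp add: powr_divide)

lemma kernel_coefficients:
  assumes N: "doubling_measure N C" and cm: "comparable_moments w (dyadic_tail N) D" and w: "\<And>n. w n = (\<integral>r. r ^ n \<partial>N)"
  defines "lam \<equiv> (\<lambda>n. 1 / (2 * w (2 * n + 1)))"
  shows "0 \<le> lam n" "lam n \<le> lam (Suc n)" "n \<in> dyadic_block k \<Longrightarrow> lam n \<le> D\<^sup>2 / dyadic_tail N k"
    and "n \<in> dyadic_block k \<Longrightarrow> 1 / (2 * D) / dyadic_tail N k \<le> lam n"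
proof -
  have wpos: "0 < w n" for n
  proof -
    obtain k where "n \<in> dyadic_block k" using dyadic_block_cover by blast
    then show ?thesis by (rule comparable_moments_pos[OF cm])
  qed
  have uN: "unit_interval_measure N" using N by (simp add: doubling_measure_def)
  note c = comparable_momentsD[OF cm]
  show "0 \<le> lam n" using wpos[of "2 * n + 1"] by (simp add: lam_def)
  have "w (2 * Suc n + 1) \<le> w (2 * n + 1)" unfolding w by (intro moment_antimono uN) simp
  then show "lam n \<le> lam (Suc n)" unfolding lam_def using wpos by (intro divide_left_mono) auto
  assume n: "n \<in> dyadic_block k"
  \<comment> \<open>n + 1 is doubled to 2n + 2, so the odd index 2n + 1 of the kernel lies exactly
    one block further.\<close>
  then have n': "2 * n + 1 \<in> dyadic_block (Suc k)" by (auto simp: dyadic_block_iff)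
  have t: "0 < dyadic_tail N k" by (rule c(2))
  have "dyadic_tail N k \<le> D * (D * w (2 * n + 1))"
    using c(4)[of k] mult_left_mono[OF c(5)[OF n'], of D] c(1) by linarith
  also have "\<dots> \<le> D * (D * w (2 * n + 1)) * 2" using wpos[of "2 * n + 1"] c(1) by simp
  finally have "dyadic_tail N k \<le> D\<^sup>2 * (2 * w (2 * n + 1))" by (simp add: power2_eq_square mult_ac)
  then show "lam n \<le> D\<^sup>2 / dyadic_tail N k"
    unfolding lam_def using t wpos[of "2 * n + 1"] by (simp add: field_simps)
  have "w (2 * n + 1) \<le> D * dyadic_tail N (Suc k)" by (rule c(6)[OF n'])
  also have "\<dots> \<le> D * dyadic_tail N k" using c(1) by (intro mult_left_mono c(3)) auto
  finally have "2 * w (2 * n + 1) \<le> 2 * D * dyadic_tail N k" by simp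
  then have "1 / (2 * D * dyadic_tail N k) \<le> 1 / (2 * w (2 * n + 1))"
    using t c(1) wpos[of "2 * n + 1"] by (intro divide_left_mono) auto
  then show "1 / (2 * D) / dyadic_tail N k \<le> lam n" unfolding lam_def by simp
qed

section \<open>Two-sided estimate of the operator by the moment sum\<close>

lemma C_op_energy:
  assumes \<eta>: "radial_weight \<eta>" "weight_measure \<eta> N\<eta>" and mu: "\<mu> \<in> M_plus" and h: "disc_holomorphic h"
    and fh: "\<And>z. norm z < 1 \<Longrightarrow> f z = h z" and q: "0 < q"
    and k: "disc_holomorphic (kernel_fun lam)" and lam: "lam = (\<lambda>n. 1 / (2 * weight_moment \<omega> (2 * n + 1)))"
  defines "g \<equiv> (\<lambda>z. \<integral>t. h (of_real t * z) * kernel_fun lam (of_real t * z) \<partial>distr \<mu> borel (\<lambda>t. t))"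
  shows "C_op \<mu> \<omega> f \<in> bergman_space q \<eta> \<longleftrightarrow> radial_energy q N\<eta> g < \<infinity>"
    and "bergman_norm q \<eta> (C_op \<mu> \<omega> f) = enn2real (radial_energy q N\<eta> g) powr (1/q)"
proof -
  have g: "disc_holomorphic g"
    unfolding g_def
    using disc_holomorphic_dilation_average[OF M_plus_unit_interval_measure(1)[OF mu] disc_holomorphic_mult[OF h k]] by simp
  have eq: "C_op \<mu> \<omega> f z = g z" if "norm z < 1" for z
    unfolding g_def lam by (rule C_op_eq_dilation_average[OF mu h fh k[unfolded lam] that])
  show "C_op \<mu> \<omega> f \<in> bergman_space q \<eta> \<longleftrightarrow> radial_energy q N\<eta> g < \<infinity>"
    and "bergman_norm q \<eta> (C_op \<mu> \<omega> f) = enn2real (radial_energy q N\<eta> g) powr (1/q)"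
    by (rule bergman_radial_energy[OF \<eta> g q eq], assumption)+
qed

lemma weight_measure_moment:
  assumes "weight_measure \<nu> N"
  shows "weight_moment \<nu> = (\<lambda>n. \<integral>r. r ^ n \<partial>N)"
proof
  have "\<forall>n. weight_moment \<nu> n = (\<integral>r. r ^ n \<partial>N)" using assms unfolding weight_measure_def by (elim conjE)
  then show "weight_moment \<nu> n = (\<integral>r. r ^ n \<partial>N)" for n by (rule spec)
qed

text \<open>Formulated with bounding constants and summability rather than extended reals, so that
  infinite values are postponed to the final theorem. One K serves both directions and all
  \<mu>.\<close>

lemma N_quantity_bounds_C_op:
  fixes p q :: real
  assumes q: "1 < q" and p: "q < p" and \<omega>: "\<omega> \<in> D_hat" and \<nu>: "\<nu> \<in> D_both" and \<eta>: "\<eta> \<in> D_both"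
  shows "\<exists>K>0. \<forall>\<mu>\<in>M_plus.
    (summable (N_term p q \<omega> \<nu> \<eta> \<mu>) \<longrightarrow>
       K * (\<Sum>n. N_term p q \<omega> \<nu> \<eta> \<mu> n) powr ((p - q) / (q * p)) \<in> bounding_constants p \<nu> q \<eta> (C_op \<mu> \<omega>)) \<and>
    (\<forall>B\<in>bounding_constants p \<nu> q \<eta> (C_op \<mu> \<omega>).
       summable (N_term p q \<omega> \<nu> \<eta> \<mu>) \<and> (\<Sum>n. N_term p q \<omega> \<nu> \<eta> \<mu> n) powr ((p - q) / (q * p)) \<le> K * B)"
proof -
  define s where "s = q * p / (p - q)"
  have inv_s: "1 / s = (p - q) / (q * p)" by (simp add: s_def)
  have pqs: "1/q = 1/p + 1/s" unfolding inv_s using q p by (simp add: field_simps)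
  have s: "q < s" unfolding s_def using q p by (simp add: field_simps)
  have s1: "1 < s" using s q by simp
  have p1: "1 < p" using p q by simp
  obtain N\<omega> C\<omega> where w: "weight_measure \<omega> N\<omega>" "doubling_measure N\<omega> C\<omega>" using D_hat_doubling_measure[OF \<omega>] .
  have nu: "\<nu> \<in> D_hat" "\<nu> \<in> D_check" and eta: "\<eta> \<in> D_hat" "\<eta> \<in> D_check" using \<nu> \<eta> by (auto simp: D_both_def)
  obtain N\<nu> C\<nu> where v: "weight_measure \<nu> N\<nu>" "doubling_measure N\<nu> C\<nu>" using D_hat_doubling_measure[OF nu(1)] .
  obtain m\<nu> where vh: "halving_measure N\<nu> m\<nu>" using D_check_halving_measure[OF nu(2) v(1)] .
  obtain N\<eta> C\<eta> where e: "weight_measure \<eta> N\<eta>" "doubling_measure N\<eta> C\<eta>" using D_hat_doubling_measure[OF eta(1)] .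
  obtain m\<eta> where eh: "halving_measure N\<eta> m\<eta>" using D_check_halving_measure[OF eta(2) e(1)] .
  have rv: "radial_weight \<nu>" and re: "radial_weight \<eta>" using nu eta by (auto simp: D_hat_def)
  have mom: "weight_moment \<omega> = (\<lambda>n. \<integral>r. r ^ n \<partial>N\<omega>)" "weight_moment \<nu> = (\<lambda>n. \<integral>r. r ^ n \<partial>N\<nu>)" "weight_moment \<eta> = (\<lambda>n. \<integral>r. r ^ n \<partial>N\<eta>)"
    by (rule weight_measure_moment, fact)+
  obtain D1 D2 D3 where D123: "comparable_moments (weight_moment \<omega>) (dyadic_tail N\<omega>) D1"
     "comparable_moments (weight_moment \<nu>) (dyadic_tail N\<nu>) D2" "comparable_moments (weight_moment \<eta>) (dyadic_tail N\<eta>) D3"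
    unfolding mom using doubling_measure_comparable_moments[OF w(2)] doubling_measure_comparable_moments[OF v(2)] doubling_measure_comparable_moments[OF e(2)] by blast
  \<comment> \<open>One constant for all three weights; exp 2 is included for the lower moment bound
    of \<mu> and to have D >= 2.\<close>
  define D where "D = max (max D1 D2) (max D3 (exp 2))"
  have cm: "comparable_moments (weight_moment \<omega>) (dyadic_tail N\<omega>) D" "comparable_moments (weight_moment \<nu>) (dyadic_tail N\<nu>) D"
     "comparable_moments (weight_moment \<eta>) (dyadic_tail N\<eta>) D" and De: "exp 2 \<le> D"
    unfolding D_def
    by (rule comparable_moments_weaken[OF D123(1)], simp, rule comparable_moments_weaken[OF D123(2)], simp,
        rule comparable_moments_weaken[OF D123(3)], simp, simp)
  have D1: "1 \<le> D" by (rule comparable_momentsD(1)[OF cm(1)])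
  define lam where "lam = (\<lambda>n. 1 / (2 * weight_moment \<omega> (2 * n + 1)))"
  note kc0 = kernel_coefficients[OF w(2) cm(1) fun_cong[OF mom(1)]]
  have kc: "\<And>n. 0 \<le> lam n" "\<And>n. lam n \<le> lam (Suc n)" "\<And>n k. n \<in> dyadic_block k \<Longrightarrow> lam n \<le> D\<^sup>2 / dyadic_tail N\<omega> k"
    "\<And>n k. n \<in> dyadic_block k \<Longrightarrow> 1 / (2 * D) / dyadic_tail N\<omega> k \<le> lam n"
    unfolding lam_def by (fact kc0)+
  obtain Dk where Dk: "0 < Dk" "\<And>lam \<tau> k. (\<And>n. 0 \<le> lam n) \<Longrightarrow> (\<And>k. 0 < \<tau> k) \<Longrightarrow> (\<And>j k. j \<le> k \<Longrightarrow> \<tau> k \<le> \<tau> j) \<Longrightarrow>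
       (\<And>k. \<tau> k \<le> D * \<tau> (Suc k)) \<Longrightarrow> (\<And>k n. n \<in> dyadic_block k \<Longrightarrow> lam n \<le> D\<^sup>2 / \<tau> k) \<Longrightarrow>
       summable (\<lambda>n. lam n * dyadic_radius (Suc k) ^ n) \<and> (\<Sum>n. lam n * dyadic_radius (Suc k) ^ n) \<le> Dk * (2 ^ k / \<tau> k)"
  proof (rule dyadic_series_bound[of "D\<^sup>2" D])
    show "0 \<le> D\<^sup>2" "1 \<le> D" using D1 by simp_all
  qed blast
  note series = Dk(2)[of lam "dyadic_tail N\<omega>", OF kc(1) comparable_momentsD(2,3,4)[OF cm(1)] kc(3)]
  have sm: "summable (\<lambda>n. lam n * dyadic_radius k ^ n)" for k
  proof (cases k)
    case 0 then show ?thesis by (intro summable_finite[of "{0}"]) auto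
  next
    case (Suc j) then show ?thesis using series[of j] by simp
  qed
  have kern: "disc_holomorphic (kernel_fun lam)" by (rule disc_holomorphic_kernel[OF sm])
  obtain Ck where Ck: "0 < Ck"
    "\<And>lam r. (\<And>k. summable (\<lambda>n. lam n * dyadic_radius k ^ n)) \<Longrightarrow> (\<And>n. 0 \<le> lam n) \<Longrightarrow> (\<And>n. lam n \<le> lam (Suc n)) \<Longrightarrow> 0 \<le> r \<Longrightarrow> r < 1 \<Longrightarrow>
       circle_mean s (kernel_fun lam) r \<le> Ck * (\<Sum>n. lam n * r ^ n) powr s * (1 - r)"
    using kernel_fun_mean_bound[OF s1] by blast
  \<comment> \<open>The kernel constant times the s-th power of the series constant; the remaining 1
    - r = 2^(-k-1) of the kernel estimate gives the factor 1/2^k in \<open>gA\<close>.\<close>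
  define A where "A = Ck * Dk powr s"
  have A: "0 < A" using Ck Dk by (simp add: A_def)
  have gA: "circle_mean s (kernel_fun lam) (dyadic_radius (Suc k)) \<le> A * (2 ^ k / dyadic_tail N\<omega> k) powr s / 2 ^ k" for k
  proof -
    let ?L = "\<Sum>n. lam n * dyadic_radius (Suc k) ^ n" and ?B = "2 ^ k / dyadic_tail N\<omega> k"
    have L: "0 \<le> ?L" using kc(1) by (intro suminf_nonneg sm) auto
    have "circle_mean s (kernel_fun lam) (dyadic_radius (Suc k)) \<le> Ck * ?L powr s * (1 - dyadic_radius (Suc k))"
      by (intro Ck(2) sm kc) auto
    also have "\<dots> \<le> Ck * (Dk * ?B) powr s * (1 / 2 ^ k)"
    proof (intro mult_mono)
      show "?L powr s \<le> (Dk * ?B) powr s" using series[of k] L s1 by (intro powr_mono2) auto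
      show "1 - dyadic_radius (Suc k) \<le> 1 / 2 ^ k" by (simp add: dyadic_radius_def power_one_over field_simps)
    qed (use Ck in auto)
    also have "\<dots> = A * ?B powr s / 2 ^ k" unfolding A_def powr_mult by simp
    finally show ?thesis .
  qed
  have wp: "0 < dyadic_tail N\<omega> k" for k by (rule comparable_momentsD(2)[OF cm(1)])
  obtain c1 where c1: "0 < c1"
    "\<And>\<mu> f F X. unit_interval_measure \<mu> \<Longrightarrow> disc_holomorphic f \<Longrightarrow> 0 \<le> F \<Longrightarrow> 0 \<le> X \<Longrightarrow>
       (\<integral>\<^sup>+r. ennreal (2 * r * circle_mean p f r) \<partial>N\<nu>) \<le> ennreal F \<Longrightarrow>
       (\<And>J. (\<Sum>k<J. dyadic_term q s (dyadic_tail N\<omega>) (dyadic_tail N\<nu>) (dyadic_tail N\<eta>) (dyadic_tail \<mu>) k) \<le> X) \<Longrightarrow>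
       (\<integral>\<^sup>+r. ennreal (2 * r * circle_mean q (\<lambda>z. \<integral>t. f (of_real t * z) * kernel_fun lam (of_real t * z) \<partial>\<mu>) r) \<partial>N\<eta>)
         \<le> ennreal (c1 * X powr (q/s) * F powr (q/p))"
    using dilation_average_sufficiency[OF q p s pqs v(2) vh e(2) eh kern wp A gA] by blast
  have D2: "0 < 1 / (2 * D)" using D1 by simp
  have "\<exists>M c2. 0 < c2 \<and> (\<forall>\<mu> B J. unit_interval_measure \<mu> \<longrightarrow> 0 \<le> B \<longrightarrow> dilation_bound p q N\<nu> N\<eta> (kernel_fun lam) \<mu> B \<longrightarrow>
       (\<Sum>k<J. dyadic_term q s (dyadic_tail N\<omega>) (dyadic_tail N\<nu>) (dyadic_tail N\<eta>) (\<lambda>k. \<integral>t. t ^ ((M + 2) * (2 ^ k - 1)) \<partial>\<mu>) k) \<le> c2 * B powr s)"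
    by (rule dilation_average_necessity[OF q p s pqs v(2) vh e(2) eh sm kc(1) wp D2]) (rule kc(4))
  then obtain M c2 where c2: "0 < c2"
    "\<forall>\<mu> B J. unit_interval_measure \<mu> \<longrightarrow> 0 \<le> B \<longrightarrow> dilation_bound p q N\<nu> N\<eta> (kernel_fun lam) \<mu> B \<longrightarrow>
       (\<Sum>k<J. dyadic_term q s (dyadic_tail N\<omega>) (dyadic_tail N\<nu>) (dyadic_tail N\<eta>) (\<lambda>k. \<integral>t. t ^ ((M + 2) * (2 ^ k - 1)) \<partial>\<mu>) k) \<le> c2 * B powr s"
    by (elim exE conjE)
  \<comment> \<open>Chosen for 2^m >= M + 2, which makes the exponent (M + 2)(2^(i-m) - 1) at most
    every n in block i.\<close>
  define m where "m = M + 2"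
  have m: "M + 2 \<le> 2 ^ m" unfolding m_def by (rule less_imp_le[OF less_exp])
  define a1 where "a1 = (D\<^sup>2 * (D\<^sup>2) powr (1/q)) powr s * D ^ 3 * D powr s"
  define c where "c = 2 ^ Suc m * D ^ Suc m"
  define a2 where "a2 = (c\<^sup>2 * (c\<^sup>2) powr (1/q)) powr s * c ^ 3 * 2 ^ m"
  have a: "0 < a1" "0 < a2" using D1 by (auto simp: a1_def a2_def c_def)
  define K1 where "K1 = c1 powr (1/q) * a1 powr (1/s)"
  define K2 where "K2 = (a2 * (real m + 1) * c2) powr (1/s)"
  have K: "0 < K1" "0 < K2" using c1 c2 a by (auto simp: K1_def K2_def)
  have Nt: "N_term p q \<omega> \<nu> \<eta> \<mu> n = moment_term q s (measure_moment \<mu> n) (weight_moment \<omega> n) (weight_moment \<eta> n) (weight_moment \<nu> n) (real n + 1)" for \<mu> n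
    unfolding s_def by (rule N_term_eq_moment_term) (use q p in auto)
  have Nt0: "0 \<le> N_term p q \<omega> \<nu> \<eta> \<mu> n" for \<mu> n
  proof -
    obtain k where "n \<in> dyadic_block k" using dyadic_block_cover by blast
    then have "0 < weight_moment \<nu> n" by (rule comparable_moments_pos[OF cm(2)])
    then show ?thesis unfolding Nt by (intro moment_term_nonneg less_imp_le)
  qed
  have suff: "K1 * (\<Sum>n. N_term p q \<omega> \<nu> \<eta> \<mu> n) powr (1/s) \<in> bounding_constants p \<nu> q \<eta> (C_op \<mu> \<omega>)"
    if mu: "\<mu> \<in> M_plus" and summ: "summable (N_term p q \<omega> \<nu> \<eta> \<mu>)" for \<mu>
  proof -
    define \<mu>' where "\<mu>' = distr \<mu> borel (\<lambda>t. t)"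
    have um: "unit_interval_measure \<mu>'" and mm: "\<And>n. measure_moment \<mu> n = (\<integral>t. t ^ n \<partial>\<mu>')"
      unfolding \<mu>'_def by (rule M_plus_unit_interval_measure[OF mu])+
    define S where "S = (\<Sum>n. N_term p q \<omega> \<nu> \<eta> \<mu> n)"
    have S: "0 \<le> S" unfolding S_def by (intro suminf_nonneg summ Nt0)
    have dX: "(\<Sum>k<J. dyadic_term q s (dyadic_tail N\<omega>) (dyadic_tail N\<nu>) (dyadic_tail N\<eta>) (dyadic_tail \<mu>') k) \<le> a1 * S" for J
    proof -
      have "(\<Sum>k<J. dyadic_term q s (dyadic_tail N\<omega>) (dyadic_tail N\<nu>) (dyadic_tail N\<eta>) (dyadic_tail \<mu>') k) \<le> (\<Sum>k<J. a1 * (\<Sum>n\<in>dyadic_block k. N_term p q \<omega> \<nu> \<eta> \<mu> n))"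
        unfolding Nt a1_def
      proof (intro sum_mono dyadic_term_le_block_sum cm De)
        fix n k assume n: "n \<in> dyadic_block k"
        have "exp 2 * (exp (- 2) * dyadic_tail \<mu>' k) \<le> D * (\<integral>t. t ^ n \<partial>\<mu>')"
          using n D1 De by (intro mult_mono moment_lower_bound um) (auto simp: dyadic_block_iff)
        then show "dyadic_tail \<mu>' k \<le> D * measure_moment \<mu> n" by (simp add: mm mult.assoc[symmetric] exp_add[symmetric])
      qed (use q s1 in auto)
      also have "\<dots> = a1 * (\<Sum>n<2 ^ J - 1. N_term p q \<omega> \<nu> \<eta> \<mu> n)"
        unfolding sum_dyadic_blocks by (simp only: sum_distrib_left)
      also have "\<dots> \<le> a1 * S" unfolding S_def using a Nt0 by (intro mult_left_mono sum_le_suminf summ) auto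
      finally show ?thesis .
    qed
    have "C_op \<mu> \<omega> f \<in> bergman_space q \<eta> \<and> bergman_norm q \<eta> (C_op \<mu> \<omega> f) \<le> K1 * S powr (1/s) * bergman_norm p \<nu> f"
      if f: "f \<in> bergman_space p \<nu>" for f
    proof -
      \<comment> \<open>A member of the Bergman space is arbitrary outside the disc; the truncation
        is Borel on the plane.\<close>
      define h where "h z = (if norm z < 1 then f z else 0)" for z
      have h: "disc_holomorphic h" unfolding h_def by (rule disc_holomorphic_truncate) (use f in \<open>simp add: bergman_space_def\<close>)
      have fh: "f z = h z" if "norm z < 1" for z using that by (simp add: h_def)
      have p0: "0 < p" and q0: "0 < q" using p1 q by auto
      have Ef: "radial_energy p N\<nu> h < \<infinity>" using bergman_radial_energy(1)[OF rv v(1) h p0 fh] f by blast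
      define F where "F = enn2real (radial_energy p N\<nu> h)"
      have F: "0 \<le> F" "radial_energy p N\<nu> h = ennreal F" using Ef by (auto simp: F_def)
      let ?g = "\<lambda>z. \<integral>t. h (of_real t * z) * kernel_fun lam (of_real t * z) \<partial>\<mu>'"
      have "radial_energy q N\<eta> ?g \<le> ennreal (c1 * (a1 * S) powr (q/s) * F powr (q/p))"
        unfolding radial_energy_def
        by (rule c1(2)[OF um h F(1)]) (use a S F dX in \<open>auto simp: radial_energy_def\<close>)
      moreover have "0 \<le> c1 * (a1 * S) powr (q/s) * F powr (q/p)" using c1 by simp
      ultimately have Eg: "radial_energy q N\<eta> ?g < \<infinity>" "enn2real (radial_energy q N\<eta> ?g) \<le> c1 * (a1 * S) powr (q/s) * F powr (q/p)"
        by (auto intro: le_less_trans enn2real_leI)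
      note op = C_op_energy[OF re e(1) mu h fh q0 kern lam_def, folded \<mu>'_def]
      have "bergman_norm q \<eta> (C_op \<mu> \<omega> f) = enn2real (radial_energy q N\<eta> ?g) powr (1/q)" by (rule op(2))
      also have "\<dots> \<le> (c1 * (a1 * S) powr (q/s) * F powr (q/p)) powr (1/q)" using Eg q by (intro powr_mono2) auto
      also have "\<dots> = K1 * S powr (1/s) * F powr (1/p)" using q by (simp add: K1_def powr_mult powr_powr mult_ac)
      also have "F powr (1/p) = bergman_norm p \<nu> f" unfolding F_def by (rule bergman_radial_energy(2)[OF rv v(1) h p0 fh, symmetric])
      finally show ?thesis using op(1) Eg(1) by simp
    qed
    then show ?thesis unfolding bounding_constants_def S_def using K by auto
  qed
  have nec: "summable (N_term p q \<omega> \<nu> \<eta> \<mu>) \<and> (\<Sum>n. N_term p q \<omega> \<nu> \<eta> \<mu> n) powr (1/s) \<le> K2 * B"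
    if mu: "\<mu> \<in> M_plus" and B: "B \<in> bounding_constants p \<nu> q \<eta> (C_op \<mu> \<omega>)" for \<mu> B
  proof -
    define \<mu>' where "\<mu>' = distr \<mu> borel (\<lambda>t. t)"
    have um: "unit_interval_measure \<mu>'" and mm: "\<And>n. measure_moment \<mu> n = (\<integral>t. t ^ n \<partial>\<mu>')"
      unfolding \<mu>'_def by (rule M_plus_unit_interval_measure[OF mu])+
    have B0: "0 \<le> B" and Bf: "\<And>f. f \<in> bergman_space p \<nu> \<Longrightarrow> C_op \<mu> \<omega> f \<in> bergman_space q \<eta> \<and> bergman_norm q \<eta> (C_op \<mu> \<omega> f) \<le> B * bergman_norm p \<nu> f"
      using B by (auto simp: bounding_constants_def)
    define u where "u k = (\<integral>t. t ^ ((M + 2) * (2 ^ k - 1)) \<partial>\<mu>')" for k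
    let ?d = "dyadic_term q s (dyadic_tail N\<omega>) (dyadic_tail N\<nu>) (dyadic_tail N\<eta>) u"
    have d0: "0 \<le> ?d k" for k by (simp add: dyadic_term_def)
    have dB: "(\<Sum>k<J. ?d k) \<le> c2 * B powr s" for J
      unfolding u_def[abs_def]
    proof (rule c2(2)[rule_format, OF um B0], unfold dilation_bound_def, intro allI impI)
      fix h F assume h: "disc_holomorphic h" and F: "0 \<le> F" "(\<integral>\<^sup>+r. ennreal (2 * r * circle_mean p h r) \<partial>N\<nu>) \<le> ennreal F"
      let ?g = "\<lambda>z. \<integral>t. h (of_real t * z) * kernel_fun lam (of_real t * z) \<partial>\<mu>'"
      have p0: "0 < p" and q0: "0 < q" using p1 q by auto
      have E: "radial_energy p N\<nu> h \<le> ennreal F" using F by (simp add: radial_energy_def)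
      then have E': "radial_energy p N\<nu> h < \<infinity>" "enn2real (radial_energy p N\<nu> h) \<le> F" using F by (auto intro: le_less_trans enn2real_leI)
      have hs: "h \<in> bergman_space p \<nu>" using bergman_radial_energy(1)[OF rv v(1) h p0 refl] E' by blast
      have hn: "bergman_norm p \<nu> h \<le> F powr (1/p)"
        unfolding bergman_radial_energy(2)[OF rv v(1) h p0 refl] using E' p0 by (intro powr_mono2) auto
      note op = C_op_energy[OF re e(1) mu h refl q0 kern lam_def, folded \<mu>'_def]
      have fin: "radial_energy q N\<eta> ?g < \<infinity>" using Bf[OF hs] op(1) by blast
      have "enn2real (radial_energy q N\<eta> ?g) powr (1/q) \<le> B * F powr (1/p)"
        using Bf[OF hs] mult_left_mono[OF hn B0] unfolding op(2) by linarith
      then have "(enn2real (radial_energy q N\<eta> ?g) powr (1/q)) powr q \<le> (B * F powr (1/p)) powr q" using q by (intro powr_mono2) auto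
      then have "enn2real (radial_energy q N\<eta> ?g) \<le> B powr q * F powr (q/p)" using q by (simp add: powr_powr powr_mult)
      then have "ennreal (enn2real (radial_energy q N\<eta> ?g)) \<le> ennreal (B powr q * F powr (q/p))" by (rule ennreal_leI)
      moreover have "ennreal (enn2real (radial_energy q N\<eta> ?g)) = radial_energy q N\<eta> ?g" using fin by simp
      ultimately have "radial_energy q N\<eta> ?g \<le> ennreal (B powr q * F powr (q/p))" by (simp only:)
      then show "(\<integral>\<^sup>+r. ennreal (2 * r * circle_mean q ?g r) \<partial>N\<eta>) \<le> ennreal (B powr q * F powr (q/p))"
        unfolding radial_energy_def .
    qed
    define X where "X = a2 * (real m + 1) * (c2 * B powr s)"
    have partial: "(\<Sum>n<J. N_term p q \<omega> \<nu> \<eta> \<mu> n) \<le> X" for J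
    proof -
      have J: "J \<le> 2 ^ Suc J - 1"
      proof -
        have "J < 2 ^ J" by (rule less_exp)
        then show ?thesis unfolding power_Suc by linarith
      qed
      have "(\<Sum>n<J. N_term p q \<omega> \<nu> \<eta> \<mu> n) \<le> (\<Sum>n<2 ^ Suc J - 1. N_term p q \<omega> \<nu> \<eta> \<mu> n)"
        using J by (intro sum_mono2 Nt0) (simp_all only: lessThan_subset_iff finite_lessThan)
      also have "\<dots> = (\<Sum>i<Suc J. \<Sum>n\<in>dyadic_block i. N_term p q \<omega> \<nu> \<eta> \<mu> n)" by (rule sum_dyadic_blocks)
      also have "\<dots> \<le> (\<Sum>i<Suc J. a2 * ?d (i - m))"
        unfolding Nt a2_def
      proof (intro sum_mono block_sum_le_dyadic_term[OF _ _ cm _ _ c_def])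
        show "0 \<le> measure_moment \<mu> n" for n
        proof -
          have "AE t in \<mu>'. t \<in> {0..<1}" using um by (simp add: unit_interval_measure_def)
          then have "AE t in \<mu>'. 0 \<le> t ^ n" by eventually_elim simp
          then show ?thesis unfolding mm by (rule integral_nonneg_AE)
        qed
        show "measure_moment \<mu> n \<le> u (i - m)" if n: "n \<in> dyadic_block i" for n i
        proof -
          \<comment> \<open>For i < m the level i - m is 0 and so is the exponent, leaving the total
            mass of \<mu> as the bound.\<close>
          have "(M + 2) * (2 ^ (i - m) - 1) \<le> n"
          proof (cases "m \<le> i")
            case True
            have "(M + 2) * (2 ^ (i - m) - 1) \<le> 2 ^ m * (2 ^ (i - m) - 1)" by (intro mult_right_mono m) simp
            also have "\<dots> = 2 ^ i - 2 ^ m" using True by (simp add: right_diff_distrib' power_add[symmetric])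
            also have "\<dots> \<le> 2 ^ i - 1" by (intro diff_le_mono2) simp
            also have "\<dots> \<le> n" using n by (simp add: dyadic_block_def)
            finally show ?thesis .
          qed simp
          then show ?thesis unfolding mm u_def by (intro moment_antimono um)
        qed
      qed (use q s1 in auto)
      also have "\<dots> = a2 * (\<Sum>i<Suc J. ?d (i - m))" by (simp only: sum_distrib_left)
      also have "\<dots> \<le> a2 * ((real m + 1) * (\<Sum>k<Suc J. ?d k))"
        using a by (intro mult_left_mono sum_shifted_le d0) auto
      also have "\<dots> \<le> a2 * ((real m + 1) * (c2 * B powr s))"
        using a by (intro mult_left_mono dB) auto
      finally show ?thesis by (simp only: X_def mult.assoc)
    qed
    have summ: "summable (N_term p q \<omega> \<nu> \<eta> \<mu>)"
    proof (rule bounded_imp_summable)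
      show "(\<Sum>n\<le>J. N_term p q \<omega> \<nu> \<eta> \<mu> n) \<le> X" for J unfolding lessThan_Suc_atMost[symmetric] by (rule partial)
    qed (rule Nt0)
    have "(\<Sum>n. N_term p q \<omega> \<nu> \<eta> \<mu> n) \<le> X" by (rule suminf_le_const[OF summ partial])
    then have "(\<Sum>n. N_term p q \<omega> \<nu> \<eta> \<mu> n) powr (1/s) \<le> X powr (1/s)"
      using s1 suminf_nonneg[OF summ Nt0] by (intro powr_mono2) auto
    also have "\<dots> = K2 * B"
    proof -
      have "X powr (1/s) = (a2 * (real m + 1) * c2 * B powr s) powr (1/s)" by (simp only: X_def mult.assoc)
      also have "\<dots> = K2 * (B powr s) powr (1/s)" unfolding K2_def by (rule powr_mult)
      also have "(B powr s) powr (1/s) = B" using B0 s1 by (simp add: powr_powr)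
      finally show ?thesis .
    qed
    finally show ?thesis using summ by blast
  qed
  define K where "K = max K1 K2"
  have "0 < K" "K1 \<le> K" "K2 \<le> K" using K by (auto simp: K_def)
  show ?thesis
  proof (intro exI[of _ K] conjI ballI impI)
    show "0 < K" by fact
  next
    fix \<mu> assume mu: "\<mu> \<in> M_plus" and summ: "summable (N_term p q \<omega> \<nu> \<eta> \<mu>)"
    let ?S = "(\<Sum>n. N_term p q \<omega> \<nu> \<eta> \<mu> n) powr (1/s)"
    have le: "K1 * ?S \<le> K * ?S" using \<open>K1 \<le> K\<close> by (intro mult_right_mono) auto
    have n0: "0 \<le> bergman_norm p \<nu> f" for f by (simp add: bergman_norm_def)
    have "K * ?S \<in> bounding_constants p \<nu> q \<eta> (C_op \<mu> \<omega>)"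
      using suff[OF mu summ] \<open>0 < K\<close> order_trans[OF _ mult_right_mono[OF le n0]] by (auto simp: bounding_constants_def)
    then show "K * (\<Sum>n. N_term p q \<omega> \<nu> \<eta> \<mu> n) powr ((p - q) / (q * p)) \<in> bounding_constants p \<nu> q \<eta> (C_op \<mu> \<omega>)"
      by (simp only: inv_s)
  next
    fix \<mu> B assume mu: "\<mu> \<in> M_plus" and B: "B \<in> bounding_constants p \<nu> q \<eta> (C_op \<mu> \<omega>)"
    have "0 \<le> B" using B by (simp add: bounding_constants_def)
    then have "K2 * B \<le> K * B" using \<open>K2 \<le> K\<close> by (rule mult_right_mono[rotated])
    then show "summable (N_term p q \<omega> \<nu> \<eta> \<mu>)" "(\<Sum>n. N_term p q \<omega> \<nu> \<eta> \<mu> n) powr ((p - q) / (q * p)) \<le> K * B"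
      using nec[OF mu B] unfolding inv_s by linarith+
  qed
qed

theorem theorem27:
  fixes p q :: real and \<omega> \<nu> \<eta> :: "complex \<Rightarrow> real"
  assumes "1 < q" and "q < p"
    and "\<omega> \<in> D_hat" and "\<nu> \<in> D_both" and "\<eta> \<in> D_both"
  shows "(\<forall>\<mu>\<in>M_plus.
            bergman_bounded p \<nu> q \<eta> (C_op \<mu> \<omega>) \<longleftrightarrow> N_quantity p q \<omega> \<nu> \<eta> \<mu> < \<infinity>)
       \<and> (\<exists>c::real. c > 0 \<and>
            (\<forall>\<mu>\<in>M_plus.
               ennreal (1 / c) * bergman_opnorm p \<nu> q \<eta> (C_op \<mu> \<omega>) \<le> N_quantity p q \<omega> \<nu> \<eta> \<mu>
               \<and> N_quantity p q \<omega> \<nu> \<eta> \<mu> \<le> ennreal c * bergman_opnorm p \<nu> q \<eta> (C_op \<mu> \<omega>)))"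
proof -
  let ?S = "\<lambda>\<mu>. (\<Sum>n. N_term p q \<omega> \<nu> \<eta> \<mu> n) powr ((p - q) / (q * p))"
  obtain K where K: "0 < K" and bounds: "\<forall>\<mu>\<in>M_plus.
      (summable (N_term p q \<omega> \<nu> \<eta> \<mu>) \<longrightarrow> K * ?S \<mu> \<in> bounding_constants p \<nu> q \<eta> (C_op \<mu> \<omega>)) \<and>
      (\<forall>B\<in>bounding_constants p \<nu> q \<eta> (C_op \<mu> \<omega>). summable (N_term p q \<omega> \<nu> \<eta> \<mu>) \<and> ?S \<mu> \<le> K * B)"
    using N_quantity_bounds_C_op[OF assms] by (elim exE conjE)
  have suff: "K * ?S \<mu> \<in> bounding_constants p \<nu> q \<eta> (C_op \<mu> \<omega>)"
    if "\<mu> \<in> M_plus" "summable (N_term p q \<omega> \<nu> \<eta> \<mu>)" for \<mu>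
    using bspec[OF bounds that(1)] that(2) by (elim conjE mp)
  have nec: "summable (N_term p q \<omega> \<nu> \<eta> \<mu>) \<and> ?S \<mu> \<le> K * B"
    if "\<mu> \<in> M_plus" "B \<in> bounding_constants p \<nu> q \<eta> (C_op \<mu> \<omega>)" for \<mu> B
    by (rule bspec[OF conjunct2[OF bspec[OF bounds that(1)]] that(2)])
  have KK: "ennreal (1 / K) * ennreal K = 1" using K by (simp add: ennreal_mult[symmetric])
  have N: "N_quantity p q \<omega> \<nu> \<eta> \<mu> = (if summable (N_term p q \<omega> \<nu> \<eta> \<mu>) then ennreal (?S \<mu>) else \<infinity>)" for \<mu>
    by (simp add: N_quantity_def)
  have "bergman_bounded p \<nu> q \<eta> (C_op \<mu> \<omega>) \<longleftrightarrow> N_quantity p q \<omega> \<nu> \<eta> \<mu> < \<infinity>" if mu: "\<mu> \<in> M_plus" for \<mu>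
  proof (cases "summable (N_term p q \<omega> \<nu> \<eta> \<mu>)")
    case True
    then show ?thesis using suff[OF mu True] unfolding bergman_bounded_def N by auto
  next
    case False
    then have "bounding_constants p \<nu> q \<eta> (C_op \<mu> \<omega>) = {}" using nec[OF mu] by blast
    then show ?thesis using False by (simp add: bergman_bounded_def N)
  qed
  moreover have "ennreal (1 / K) * bergman_opnorm p \<nu> q \<eta> (C_op \<mu> \<omega>) \<le> N_quantity p q \<omega> \<nu> \<eta> \<mu>" if mu: "\<mu> \<in> M_plus" for \<mu>
  proof (cases "summable (N_term p q \<omega> \<nu> \<eta> \<mu>)")
    case True
    have "bergman_opnorm p \<nu> q \<eta> (C_op \<mu> \<omega>) \<le> ennreal (K * ?S \<mu>)"
      unfolding bergman_opnorm_def by (intro Inf_lower imageI suff mu True)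
    then have "ennreal (1 / K) * bergman_opnorm p \<nu> q \<eta> (C_op \<mu> \<omega>) \<le> ennreal (1 / K) * ennreal (K * ?S \<mu>)"
      by (rule mult_left_mono) simp
    also have "\<dots> = ennreal (1 / K) * ennreal K * ennreal (?S \<mu>)" using K by (simp add: ennreal_mult mult.assoc)
    also have "\<dots> = N_quantity p q \<omega> \<nu> \<eta> \<mu>" using True by (simp add: N KK)
    finally show ?thesis .
  qed (simp add: N)
  moreover have "N_quantity p q \<omega> \<nu> \<eta> \<mu> \<le> ennreal K * bergman_opnorm p \<nu> q \<eta> (C_op \<mu> \<omega>)" if mu: "\<mu> \<in> M_plus" for \<mu>
  proof -
    \<comment> \<open>The constant is moved to the left so that the claim is a lower bound for the
      infimum; without any bounding constant the infimum is infinite and the claim is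
      vacuous.\<close>
    have "ennreal (1 / K) * N_quantity p q \<omega> \<nu> \<eta> \<mu> \<le> bergman_opnorm p \<nu> q \<eta> (C_op \<mu> \<omega>)"
      unfolding bergman_opnorm_def
    proof (rule Inf_greatest, elim imageE)
      fix x B assume x: "x = ennreal B" and B: "B \<in> bounding_constants p \<nu> q \<eta> (C_op \<mu> \<omega>)"
      have "N_quantity p q \<omega> \<nu> \<eta> \<mu> \<le> ennreal (K * B)" using nec[OF mu B] by (simp add: N ennreal_leI)
      then have "ennreal (1 / K) * N_quantity p q \<omega> \<nu> \<eta> \<mu> \<le> ennreal (1 / K) * ennreal (K * B)" by (rule mult_left_mono) simp
      also have "\<dots> = x" using K B by (simp add: x ennreal_mult[symmetric] bounding_constants_def)
      finally show "ennreal (1 / K) * N_quantity p q \<omega> \<nu> \<eta> \<mu> \<le> x" .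
    qed
    then have "ennreal K * (ennreal (1 / K) * N_quantity p q \<omega> \<nu> \<eta> \<mu>) \<le> ennreal K * bergman_opnorm p \<nu> q \<eta> (C_op \<mu> \<omega>)"
      by (rule mult_left_mono) simp
    moreover have "ennreal K * (ennreal (1 / K) * N_quantity p q \<omega> \<nu> \<eta> \<mu>) = N_quantity p q \<omega> \<nu> \<eta> \<mu>"
      using KK by (simp add: mult.assoc[symmetric] mult.commute[of "ennreal K"])
    ultimately show ?thesis by (simp only:)
  qed
  ultimately show ?thesis using K by (intro conjI ballI exI[of _ K])
qed

end
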